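(* Let $\mathcal{D}$ be a strongly reliable digraph property such that $d(\mathcal{D})\ge(1,1)$, and let $D$ be a connected digraph. Then $$\vec\chi_{\mathrm{DP}}(D:\mathcal{D})\le\max\Big\{\Big\lceil\frac{\Delta^+(D)}{d^+(\mathcal{D})}\Big\rceil,\Big\lceil\frac{\Delta^-(D)}{d^-(\mathcal{D})}\Big\rceil\Big\}$$ unless $D=K_1$, or $d^+(\mathcal{D})=d^-(\mathcal{D})=r\ge1$ and one of the following holds: (i) $D\in\mathrm{CR}(\mathcal{D})=\mathrm{Crit}(\mathcal{D},\vec\chi_{\mathrm{DP}},2)$ and $D$ is $r$-diregular; (ii) $D=D^\pm(K_{kr+1})\in\mathrm{Crit}(\mathcal{D},\vec\chi_{\mathrm{DP}},k+1)$ for some $k\ge1$; (iii) $r=1$ and $D=D^\pm(C_n)\in\mathrm{Crit}(\mathcal{D},\vec\chi_{\mathrm{DP}},3)$ with $n\ge3$.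
   Context: Digraphs are finite, without loops and parallel arcs (digons allowed). $\Delta^\pm(D)$ maximum out-/in-degree; pairs in $\mathbb{N}_0^2$ compared coordinatewise. $D$ is $r$-diregular if every vertex has in- and out-degree $r$. $K_1$ is the one-vertex digraph; $D^\pm(G)$ replaces each edge of undirected $G$ by a digon. Connected refers to the underlying graph. A digraph property is a class of digraphs closed under isomorphism; strongly reliable means nontrivial (contains a nonempty digraph but not all digraphs), hereditary (closed under induced subdigraphs), additive (closed under disjoint unions) and monotone (closed under subdigraphs). $\mathrm{CR}(\mathcal{D})$: digraphs $D\notin\mathcal{D}$ with $D-v\in\mathcal{D}$ for all $v$; $d(\mathcal{D})=(d^+(\mathcal{D}),d^-(\mathcal{D}))$ with $d^\pm(\mathcal{D})=\min\{\delta^\pm(D):D\in\mathrm{CR}(\mathcal{D})\}$. Cover of $D$: pair $(X,H)$, $H$ disjoint from $D$, $X_v\subseteq V(H)$ ($v\in V(D)$) pairwise disjoint with union $V(H)$, each independent in $H$, arcs of $H$ from $X_u$ to $X_v$ ($u\ne v$) forming a matching if $uv\in A(D)$ and none otherwise; a $k$-cover has $|X_v|\ge k$ for all $v$. A $\mathcal{D}$-transversal is $T\subseteq V(H)$ with $|T\cap X_v|=1$ for all $v$ and $H[T]\in\mathcal{D}$. $\vec\chi_{\mathrm{DP}}(D:\mathcal{D})$ is the least $k$ such that every $k$-cover of $D$ has a $\mathcal{D}$-transversal. $D$ is in $\mathrm{Crit}(\mathcal{D},\vec\chi_{\mathrm{DP}},k)$ if $\vec\chi_{\mathrm{DP}}(D':\mathcal{D})<\vec\chi_{\mathrm{DP}}(D:\mathcal{D})=k$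 for every proper induced subdigraph $D'$ of $D$. *)

theory Defs
  imports
    Complex_Main
    "HOL-Library.Infinite_Typeclass"
    "Graph_Theory.Graph_Theory"
begin

text \<open>
  A digraph (finite, loopless, no parallel arcs, digons allowed) is a
  \<^typ>\<open>'a pair_pre_digraph\<close> satisfying \<^const>\<open>pair_digraph\<close>; its arcs are pairs of vertices.
  The library notions for \<^typ>\<open>('a, 'b) pre_digraph\<close> apply through the coercion
  \<^const>\<open>with_proj\<close>. All digraphs under consideration have their vertices in one type
  \<^typ>\<open>'a\<close>. The definitions below have the intended meaning when \<^typ>\<open>'a\<close> is infinite:
  then every finite digraph has an isomorphic copy over \<^typ>\<open>'a\<close>, disjoint from any given one.
  The empty digraph is a digraph.
\<close>

definition pair_induce :: "'a pair_pre_digraph \<Rightarrow> 'a set \<Rightarrow> 'a pair_pre_digraph" where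
  "pair_induce D S = \<lparr>pverts = S, parcs = {(u, v) \<in> parcs D. u \<in> S \<and> v \<in> S}\<rparr>"

lemma with_proj_pair_induce: "with_proj (pair_induce D S) = with_proj D \<restriction> S"
  by (auto simp: with_proj_def pair_induce_def induce_subgraph_def)

definition pair_union :: "'a pair_pre_digraph \<Rightarrow> 'a pair_pre_digraph \<Rightarrow> 'a pair_pre_digraph" where
  "pair_union D E = \<lparr>pverts = pverts D \<union> pverts E, parcs = parcs D \<union> parcs E\<rparr>"

lemma with_proj_pair_union: "with_proj (pair_union D E) = union (with_proj D) (with_proj E)"
  by (simp add: with_proj_def pair_union_def union_def)


section \<open>Degrees\<close>

text \<open>Maxima and minima of degrees are meaningful for nonempty digraphs only.\<close>

definition max_out_degree :: "'a pair_pre_digraph \<Rightarrow> nat" where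
  "max_out_degree D = Max (out_degree D ` pverts D)"

definition max_in_degree :: "'a pair_pre_digraph \<Rightarrow> nat" where
  "max_in_degree D = Max (in_degree D ` pverts D)"

definition min_out_degree :: "'a pair_pre_digraph \<Rightarrow> nat" where
  "min_out_degree D = Min (out_degree D ` pverts D)"

definition min_in_degree :: "'a pair_pre_digraph \<Rightarrow> nat" where
  "min_in_degree D = Min (in_degree D ` pverts D)"

definition diregular :: "nat \<Rightarrow> 'a pair_pre_digraph \<Rightarrow> bool" where
  "diregular r D \<longleftrightarrow> (\<forall>v\<in>pverts D. out_degree D v = r \<and> in_degree D v = r)"


section \<open>Special digraphs\<close>

definition is_K1 :: "'a pair_pre_digraph \<Rightarrow> bool" where
  "is_K1 D \<longleftrightarrow> (\<exists>v. D = \<lparr>pverts = {v}, parcs = {}\<rparr>)"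

text \<open>
  \<open>bidirected V E\<close> replaces each edge of the undirected graph with vertex set \<open>V\<close> and edge set
  \<open>E\<close> (consisting of two-element subsets of \<open>V\<close>) by a digon.
\<close>

definition bidirected :: "'v set \<Rightarrow> 'v set set \<Rightarrow> 'v pair_pre_digraph" where
  "bidirected V E = \<lparr>pverts = V, parcs = {(u, v). {u, v} \<in> E}\<rparr>"

definition bidirected_complete :: "nat \<Rightarrow> nat pair_pre_digraph" where
  "bidirected_complete n = bidirected {..<n} {{i, j} | i j. i < n \<and> j < n \<and> i \<noteq> j}"

definition bidirected_cycle :: "nat \<Rightarrow> nat pair_pre_digraph" where
  "bidirected_cycle n = bidirected {..<n} {{i, (i + 1) mod n} | i. i < n}"


section \<open>Digraph properties\<close>

definition digraph_property :: "'a pair_pre_digraph set \<Rightarrow> bool" where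
  "digraph_property \<D> \<longleftrightarrow>
     (\<forall>D\<in>\<D>. pair_digraph D) \<and>
     (\<forall>D\<in>\<D>. \<forall>E::'a pair_pre_digraph.
        pair_digraph E \<and> digraph_iso (with_proj D) (with_proj E) \<longrightarrow> E \<in> \<D>)"

definition nontrivial :: "'a pair_pre_digraph set \<Rightarrow> bool" where
  "nontrivial \<D> \<longleftrightarrow>
     (\<exists>D\<in>\<D>. pverts D \<noteq> {}) \<and> (\<exists>D::'a pair_pre_digraph. pair_digraph D \<and> D \<notin> \<D>)"

definition hereditary :: "'a pair_pre_digraph set \<Rightarrow> bool" where
  "hereditary \<D> \<longleftrightarrow>
     (\<forall>D\<in>\<D>. \<forall>E::'a pair_pre_digraph. induced_subgraph (with_proj E) (with_proj D) \<longrightarrow> E \<in> \<D>)"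

definition additive :: "'a pair_pre_digraph set \<Rightarrow> bool" where
  "additive \<D> \<longleftrightarrow> (\<forall>D\<in>\<D>. \<forall>E\<in>\<D>. pverts D \<inter> pverts E = {} \<longrightarrow> pair_union D E \<in> \<D>)"

definition monotone_property :: "'a pair_pre_digraph set \<Rightarrow> bool" where
  "monotone_property \<D> \<longleftrightarrow>
     (\<forall>D\<in>\<D>. \<forall>E::'a pair_pre_digraph. subgraph (with_proj E) (with_proj D) \<longrightarrow> E \<in> \<D>)"

definition strongly_reliable :: "'a pair_pre_digraph set \<Rightarrow> bool" where
  "strongly_reliable \<D> \<longleftrightarrow>
     digraph_property \<D> \<and> nontrivial \<D> \<and> hereditary \<D> \<and> additive \<D> \<and> monotone_property \<D>"

definition CR :: "'a pair_pre_digraph set \<Rightarrow> 'a pair_pre_digraph set" where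
  "CR \<D> = {D. pair_digraph D \<and> D \<notin> \<D> \<and> (\<forall>v\<in>pverts D. pair_induce D (pverts D - {v}) \<in> \<D>)}"

text \<open>
  For a nontrivial hereditary \<open>\<D>\<close> over an infinite type, \<^term>\<open>CR \<D>\<close> is nonempty and all its
  members are nonempty, so the infima below are minima.
\<close>

definition d_out :: "'a pair_pre_digraph set \<Rightarrow> nat" where
  "d_out \<D> = (INF D\<in>CR \<D>. min_out_degree D)"

definition d_in :: "'a pair_pre_digraph set \<Rightarrow> nat" where
  "d_in \<D> = (INF D\<in>CR \<D>. min_in_degree D)"


section \<open>Covers and the DP-chromatic number\<close>

definition arcs_between :: "'a pair_pre_digraph \<Rightarrow> 'a set \<Rightarrow> 'a set \<Rightarrow> ('a \<times> 'a) set" where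
  "arcs_between H A B = {(x, y) \<in> parcs H. x \<in> A \<and> y \<in> B}"

definition arc_matching :: "('a \<times> 'a) set \<Rightarrow> bool" where
  "arc_matching M \<longleftrightarrow>
     (\<forall>e\<in>M. \<forall>f\<in>M. e \<noteq> f \<longrightarrow> {fst e, snd e} \<inter> {fst f, snd f} = {})"

definition independent_in :: "'a pair_pre_digraph \<Rightarrow> 'a set \<Rightarrow> bool" where
  "independent_in H A \<longleftrightarrow> arcs_between H A A = {}"

definition cover :: "'a pair_pre_digraph \<Rightarrow> ('a \<Rightarrow> 'a set) \<Rightarrow> 'a pair_pre_digraph \<Rightarrow> bool" where
  "cover D X H \<longleftrightarrow>
     pair_digraph H \<and> pverts H \<inter> pverts D = {} \<and>
     (\<forall>u\<in>pverts D. \<forall>v\<in>pverts D. u \<noteq> v \<longrightarrow> X u \<inter> X v = {}) \<and>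
     (\<Union>v\<in>pverts D. X v) = pverts H \<and>
     (\<forall>v\<in>pverts D. independent_in H (X v)) \<and>
     (\<forall>u\<in>pverts D. \<forall>v\<in>pverts D. u \<noteq> v \<longrightarrow>
        (if (u, v) \<in> parcs D then arc_matching (arcs_between H (X u) (X v))
         else arcs_between H (X u) (X v) = {}))"

definition k_cover ::
  "nat \<Rightarrow> 'a pair_pre_digraph \<Rightarrow> ('a \<Rightarrow> 'a set) \<Rightarrow> 'a pair_pre_digraph \<Rightarrow> bool" where
  "k_cover k D X H \<longleftrightarrow> cover D X H \<and> (\<forall>v\<in>pverts D. k \<le> card (X v))"

definition transversal ::
  "'a pair_pre_digraph set \<Rightarrow> 'a pair_pre_digraph \<Rightarrow> ('a \<Rightarrow> 'a set) \<Rightarrow> 'a pair_pre_digraph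
     \<Rightarrow> 'a set \<Rightarrow> bool" where
  "transversal \<D> D X H T \<longleftrightarrow>
     T \<subseteq> pverts H \<and> (\<forall>v\<in>pverts D. card (T \<inter> X v) = 1) \<and> pair_induce H T \<in> \<D>"

definition dp_chromatic :: "'a pair_pre_digraph set \<Rightarrow> 'a pair_pre_digraph \<Rightarrow> nat" where
  "dp_chromatic \<D> D = (LEAST k. \<forall>X H. k_cover k D X H \<longrightarrow> (\<exists>T. transversal \<D> D X H T))"

definition dp_crit :: "'a pair_pre_digraph set \<Rightarrow> nat \<Rightarrow> 'a pair_pre_digraph set" where
  "dp_crit \<D> k =
     {D. pair_digraph D \<and> dp_chromatic \<D> D = k \<and>
         (\<forall>E::'a pair_pre_digraph. induced_subgraph (with_proj E) (with_proj D) \<and> E \<noteq> D \<longrightarrow>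
            dp_chromatic \<D> E < dp_chromatic \<D> D)}"

end

theory Submission
  imports Defs
begin

text \<open>
  A digraph outside \<open>\<D>\<close> contains a member of \<open>CR \<D>\<close>, so a transversal lies in \<open>\<D>\<close> as soon as
  every nonempty part of it has a vertex of out-degree below \<open>p = d_out \<D>\<close> or of in-degree below
  \<open>q = d_in \<D>\<close> (it is degenerate). If a \<open>k\<close>-cover has no degenerate transversal, then colouring
  greedily towards any chosen vertex \<open>v\<close> leaves only \<open>v\<close> uncoloured, and counting at \<open>v\<close> shows that
  every colour of \<open>v\<close> has exactly \<open>p\<close> out- and \<open>q\<close> in-neighbours; hence \<open>p = q = r\<close> and \<open>D\<close> is
  \<open>k r\<close>-diregular. For \<open>k = 1\<close> this is case (i).

  For \<open>k \<ge> 2\<close>, colour all vertices so that the only obstruction to degeneracy is one \<open>r\<close>-diregular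
  component \<open>K\<close>. Recolouring a vertex of \<open>K\<close> destroys \<open>K\<close> and creates a new such component that
  meets \<open>K\<close> in that vertex only. When the number of components is minimal, recolouring non-cut
  vertices produces a chain of components; a longest chain has to return to itself, and where it
  does, the component is a complete digraph on \<open>r + 1\<close> vertices. If \<open>r \<ge> 2\<close>, counting neighbours at
  the end of the chain gives \<open>r\<close> vertices with a common closed neighbourhood of \<open>k r + 1\<close> vertices,
  which turns out to be complete. If \<open>r = 1\<close>, the chain closes up to a cycle of digons containing a
  vertex without neighbours outside; then the cycle is Hamiltonian, and for \<open>k \<ge> 3\<close> any two
  consecutive vertices of a Hamiltonian cycle of digons can be exchanged, so that \<open>D\<close> is complete.
\<close>

section \<open>Linked sets and degenerate colourings\<close>

text \<open>All exact counts come from one chain of inequalities at an uncoloured vertex: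
  \<open>p * card (X v)\<close> \<le> number of coloured out-neighbours \<le> out-degree \<le>
  \<open>k * p\<close> \<le> \<open>p * card (X v)\<close>. It is tight throughout, so bad
  components are \<open>r\<close>-regular in both directions and can be compared by counting. This
  comparison drives the proof: if two bad components differ in one vertex only, the two colours at
  which they differ have the same neighbours in the common part (\<open>twins\<close>), and
  regularity then forces the component to be complete. The obstacle is to produce such a pair,
  because a recoloured vertex might join several old components at once and be a cut vertex of the
  new one; minimising the number of components excludes this. Components in the middle of the chain
  are not hit by the last recolouring. They are reached by walking the chain in the opposite
  direction, which enters each of them from a vertex other than its original entry. Reversing all
  arcs of the digraph and of the cover exchanges \<open>p\<close> and \<open>q\<close>, so every
  statement on out-neighbours yields one on in-neighbours.\<close>

text \<open>Connectedness through cuts instead of paths: greedy colouring asks for an edge that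
  leaves a proper part, and a proper part without such an edge is refuted at once. The empty set
  counts as linked.\<close>

definition linked :: "('v \<Rightarrow> 'v \<Rightarrow> bool) \<Rightarrow> 'v set \<Rightarrow> bool" where
  "linked R W \<longleftrightarrow> (\<forall>Z. Z \<noteq> {} \<and> Z \<subset> W \<longrightarrow> (\<exists>u\<in>Z. \<exists>w\<in>W - Z. R u w))"

lemma linkedD:
  assumes "linked R W" "Z \<subseteq> W" "Z \<noteq> {}" "Z \<noteq> W"
  obtains u w where "u \<in> Z" "w \<in> W" "w \<notin> Z" "R u w"
  using assms unfolding linked_def by blast

lemma linked_singleton: "linked R {v}"
  unfolding linked_def by auto

lemma linked_insert:
  assumes "symp R" "linked R W" "w \<in> W" "R u w"
  shows "linked R (insert u W)"
  unfolding linked_def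
proof (intro allI impI, elim conjE)
  fix Z assume Z: "Z \<noteq> {}" "Z \<subset> insert u W"
  have wu: "R w u" using assms by (auto dest: sympD)
  show "\<exists>u'\<in>Z. \<exists>w'\<in>insert u W - Z. R u' w'"
  proof (cases "Z \<inter> W = {}")
    case True
    then have "Z = {u}" using Z by auto
    moreover have "w \<noteq> u" using True \<open>Z = {u}\<close> assms(3) by auto
    ultimately show ?thesis using assms(3,4) by auto
  next
    case False
    show ?thesis
    proof (cases "W \<subseteq> Z")
      case True
      then have "u \<notin> Z" using Z by auto
      then show ?thesis using wu True assms(3) by auto
    next
      case nsub: False
      obtain a b where "a \<in> Z \<inter> W" "b \<in> W" "b \<notin> Z \<inter> W" "R a b"
        using linkedD[OF assms(2), of "Z \<inter> W"] False nsub by blast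
      then show ?thesis by blast
    qed
  qed
qed

lemma linked_cong:
  assumes "\<And>u w. u \<in> W \<Longrightarrow> w \<in> W \<Longrightarrow> R u w \<longleftrightarrow> R' u w"
  shows "linked R W \<longleftrightarrow> linked R' W"
  unfolding linked_def using assms by (intro all_cong) (meson DiffD1 psubsetD)

lemma linked_clique:
  assumes "\<And>u w. u \<in> W \<Longrightarrow> w \<in> W \<Longrightarrow> u \<noteq> w \<Longrightarrow> R u w"
  shows "linked R W"
  unfolding linked_def using assms by blast

text \<open>A maximal linked proper subset containing \<open>W\<close> misses one vertex only, since
  an edge leaving it would enlarge it. With \<open>W = {v}\<close> this yields a non-cut vertex
  other than \<open>v\<close>.\<close>

lemma linked_non_cut:
  assumes "finite K" "symp R" "linked R K" "linked R W" "W \<subset> K" "W \<noteq> {}"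
  obtains w where "w \<in> K - W" "linked R (K - {w})"
proof -
  define F where "F = {U. W \<subseteq> U \<and> U \<subset> K \<and> linked R U}"
  have finF: "finite F" unfolding F_def using assms(1) by (auto intro: finite_subset[of _ "Pow K"])
  have "F \<noteq> {}" unfolding F_def using assms by auto
  then obtain U where U: "U \<in> F" and Umax: "\<And>U'. U' \<in> F \<Longrightarrow> \<not> U \<subset> U'"
    using finite_has_maximal[OF finF] by (metis less_le)
  have Uprops: "W \<subseteq> U" "U \<subset> K" "linked R U" using U unfolding F_def by auto
  obtain u w where uw: "u \<in> U" "w \<in> K" "w \<notin> U" "R u w"
    using linkedD[OF assms(3), of U] Uprops assms(6) by blast
  have "linked R (insert w U)"
    using linked_insert[OF assms(2) Uprops(3) uw(1)] uw(4) assms(2) by (auto dest: sympD)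
  then have "insert w U = K"
    using Umax[of "insert w U"] uw Uprops unfolding F_def by auto
  then have "U = K - {w}" using uw by auto
  then show thesis using that[of w] uw Uprops by auto
qed

text \<open>Neighbours of the colour \<open>x\<close> are recorded as vertices, so that
  neighbourhoods under different colourings can be compared; \<open>x\<close> itself need not be
  chosen by \<open>\<phi>\<close>. In-neighbours arise with \<open>E\<inverse>\<close>.\<close>

definition nbs :: "('c \<times> 'c) set \<Rightarrow> ('v \<Rightarrow> 'c) \<Rightarrow> 'c \<Rightarrow> 'v set \<Rightarrow> 'v set" where
  "nbs E \<phi> x S = {u \<in> S. (x, \<phi> u) \<in> E}"

lemma nbs_iff [simp]: "u \<in> nbs E \<phi> x S \<longleftrightarrow> u \<in> S \<and> (x, \<phi> u) \<in> E"
  by (simp add: nbs_def)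

lemma finite_nbs [simp]: "finite S \<Longrightarrow> finite (nbs E \<phi> x S)"
  by (simp add: nbs_def)

lemma nbs_mono: "S \<subseteq> S' \<Longrightarrow> nbs E \<phi> x S \<subseteq> nbs E \<phi> x S'"
  by auto

lemma card_nbs_mono: "finite S' \<Longrightarrow> S \<subseteq> S' \<Longrightarrow> card (nbs E \<phi> x S) \<le> card (nbs E \<phi> x S')"
  by (intro card_mono finite_nbs nbs_mono)

lemma nbs_cong: "(\<And>u. u \<in> S \<Longrightarrow> \<phi> u = \<psi> u) \<Longrightarrow> nbs E \<phi> x S = nbs E \<psi> x S"
  by auto

lemma card_nbs_insert:
  assumes "finite S" "v \<notin> S"
  shows "card (nbs E \<phi> x (insert v S)) = card (nbs E \<phi> x S) + (if (x, \<phi> v) \<in> E then 1 else 0)"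
proof -
  have "nbs E \<phi> x (insert v S) = (if (x, \<phi> v) \<in> E then insert v (nbs E \<phi> x S) else nbs E \<phi> x S)"
    by auto
  then show ?thesis using assms by auto
qed

lemma nbs_remove: "v \<notin> S \<Longrightarrow> nbs E (\<phi>(v := c)) x S = nbs E \<phi> x S"
  by (intro nbs_cong) auto

text \<open>Pulled back to vertices, this is degeneracy of the part of the cover chosen by
  \<open>\<phi>\<close>: no nonempty subset has all out-degrees at least \<open>p\<close> and all
  in-degrees at least \<open>q\<close>, as a member of \<open>CR \<D>\<close> would.\<close>

definition degen :: "('c \<times> 'c) set \<Rightarrow> nat \<Rightarrow> nat \<Rightarrow> ('v \<Rightarrow> 'c) \<Rightarrow> 'v set \<Rightarrow> bool" where
  "degen E p q \<phi> S \<longleftrightarrow> (\<forall>U. U \<subseteq> S \<and> U \<noteq> {} \<longrightarrow>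
     (\<exists>v\<in>U. card (nbs E \<phi> (\<phi> v) U) < p \<or> card (nbs (E\<inverse>) \<phi> (\<phi> v) U) < q))"

lemma degen_converse: "degen (E\<inverse>) q p \<phi> S \<longleftrightarrow> degen E p q \<phi> S"
  unfolding degen_def by (auto simp: disj_commute)

lemma degen_cong:
  assumes "\<And>u. u \<in> S \<Longrightarrow> \<phi> u = \<psi> u"
  shows "degen E p q \<phi> S \<longleftrightarrow> degen E p q \<psi> S"
proof -
  have "nbs E' \<phi> (\<phi> v) U = nbs E' \<psi> (\<psi> v) U" if "U \<subseteq> S" "v \<in> U" for U v E'
  proof -
    have "\<phi> v = \<psi> v" using assms that by auto
    then show ?thesis using nbs_cong[of U \<phi> \<psi>] assms that by (metis subsetD)
  qed
  then show ?thesis unfolding degen_def by (metis (no_types, lifting))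
qed

text \<open>A cover seen from the vertices: colourings are functions on \<open>V\<close> rather than
  transversals. \<open>E_out\<close> and \<open>E_in\<close> are the matching condition, split by
  the end at which two arcs would meet.\<close>

locale colour_cover =
  fixes V :: "'v set" and A :: "('v \<times> 'v) set" and X :: "'v \<Rightarrow> 'c set" and E :: "('c \<times> 'c) set"
    and k p q :: nat
  assumes finV: "finite V"
    and A_sub: "A \<subseteq> V \<times> V"
    and A_irrefl: "(v, v) \<notin> A"
    and finX: "v \<in> V \<Longrightarrow> finite (X v)"
    and cardX: "v \<in> V \<Longrightarrow> k \<le> card (X v)"
    and E_arc: "u \<in> V \<Longrightarrow> v \<in> V \<Longrightarrow> x \<in> X u \<Longrightarrow> y \<in> X v \<Longrightarrow> (x, y) \<in> E \<Longrightarrow> (u, v) \<in> A"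
    and E_out: "u \<in> V \<Longrightarrow> v \<in> V \<Longrightarrow> x \<in> X u \<Longrightarrow> y \<in> X v \<Longrightarrow> y' \<in> X v \<Longrightarrow> (x, y) \<in> E \<Longrightarrow>
      (x, y') \<in> E \<Longrightarrow> y = y'"
    and E_in: "u \<in> V \<Longrightarrow> v \<in> V \<Longrightarrow> x \<in> X u \<Longrightarrow> x' \<in> X u \<Longrightarrow> y \<in> X v \<Longrightarrow> (x, y) \<in> E \<Longrightarrow>
      (x', y) \<in> E \<Longrightarrow> x = x'"
begin

lemma converse: "colour_cover V (A\<inverse>) X (E\<inverse>) k"
proof
  show "finite V" "A\<inverse> \<subseteq> V \<times> V" "\<And>v. (v, v) \<notin> A\<inverse>" "\<And>v. v \<in> V \<Longrightarrow> finite (X v)"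
    "\<And>v. v \<in> V \<Longrightarrow> k \<le> card (X v)"
    using finV A_sub A_irrefl finX cardX by auto
qed (use E_arc E_out E_in in blast)+

abbreviation "out \<equiv> nbs E"
abbreviation "inn \<equiv> nbs (E\<inverse>)"
abbreviation "dgn \<equiv> degen E p q"

definition col :: "('v \<Rightarrow> 'c) \<Rightarrow> 'v set \<Rightarrow> bool" where
  "col \<phi> S \<longleftrightarrow> (\<forall>v\<in>S. \<phi> v \<in> X v)"

definition good :: "('v \<Rightarrow> 'c) \<Rightarrow> 'v set \<Rightarrow> bool" where
  "good \<phi> S \<longleftrightarrow> col \<phi> S \<and> dgn \<phi> S"

lemma finite_sub: "S \<subseteq> V \<Longrightarrow> finite S"
  using finV finite_subset by blast

lemma no_loop: "v \<in> V \<Longrightarrow> x \<in> X v \<Longrightarrow> y \<in> X v \<Longrightarrow> (x, y) \<notin> E"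
  using E_arc A_irrefl by blast

lemma good_cong: "(\<And>u. u \<in> S \<Longrightarrow> \<phi> u = \<psi> u) \<Longrightarrow> good \<phi> S \<longleftrightarrow> good \<psi> S"
  unfolding good_def col_def using degen_cong[of S \<phi> \<psi>] by auto

text \<open>In a subset containing \<open>v\<close>, the vertex \<open>v\<close> itself has low
  degree, because its degree there is at most its degree into \<open>S\<close>; all other subsets
  lie in \<open>S\<close>.\<close>

lemma good_extend:
  assumes "good \<phi> S" "S \<subseteq> V" "v \<in> V" "v \<notin> S" "x \<in> X v"
    and "card (out \<phi> x S) < p \<or> card (inn \<phi> x S) < q"
  shows "good (\<phi>(v := x)) (insert v S)"
proof -
  let ?\<psi> = "\<phi>(v := x)"
  have finS: "finite S" using assms(2) finV finite_subset by auto
  have "\<exists>u\<in>U. card (out ?\<psi> (?\<psi> u) U) < p \<or> card (inn ?\<psi> (?\<psi> u) U) < q"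
    if U: "U \<subseteq> insert v S" "U \<noteq> {}" for U
  proof (cases "v \<in> U")
    case False
    then have "U \<subseteq> S" using U by auto
    moreover have "dgn ?\<psi> S \<longleftrightarrow> dgn \<phi> S"
      by (rule degen_cong) (use assms(4) in auto)
    then have "dgn ?\<psi> S" using assms(1) by (simp add: good_def)
    ultimately show ?thesis using U unfolding degen_def by auto
  next
    case True
    have "(x, x) \<notin> E" using no_loop assms by auto
    then have "out ?\<psi> x U \<subseteq> out \<phi> x S" "inn ?\<psi> x U \<subseteq> inn \<phi> x S" using U by (auto split: if_splits)
    then have "card (out ?\<psi> x U) \<le> card (out \<phi> x S)" "card (inn ?\<psi> x U) \<le> card (inn \<phi> x S)"
      using finS by (auto intro: card_mono)
    then show ?thesis using True assms(6) by (intro bexI[of _ v]) auto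
  qed
  then show ?thesis using assms unfolding good_def degen_def col_def by auto
qed

lemma out_union: "v \<in> V \<Longrightarrow> S \<subseteq> V \<Longrightarrow> col \<phi> S \<Longrightarrow> (\<Union>x\<in>X v. out \<phi> x S) \<subseteq> {u \<in> S. (v, u) \<in> A}"
  unfolding col_def using E_arc by fastforce

text \<open>A coloured vertex is met by at most one colour of \<open>v\<close>, by
  \<open>E_in\<close>, so the neighbourhoods are disjoint.\<close>

lemma sum_out_eq:
  assumes "v \<in> V" "S \<subseteq> V" "col \<phi> S"
  shows "(\<Sum>x\<in>X v. card (out \<phi> x S)) = card (\<Union>x\<in>X v. out \<phi> x S)"
proof (rule card_UN_disjoint[symmetric])
  show "finite (X v)" "\<forall>i\<in>X v. finite (out \<phi> i S)" using finX assms finite_sub by auto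
  show "\<forall>i\<in>X v. \<forall>j\<in>X v. i \<noteq> j \<longrightarrow> out \<phi> i S \<inter> out \<phi> j S = {}"
    using E_in assms unfolding col_def by fastforce
qed

lemma sum_out_le:
  assumes "v \<in> V" "S \<subseteq> V" "col \<phi> S"
  shows "(\<Sum>x\<in>X v. card (out \<phi> x S)) \<le> card {u \<in> S. (v, u) \<in> A}"
  unfolding sum_out_eq[OF assms] using out_union[OF assms] finite_sub[OF assms(2)]
  by (intro card_mono) auto

lemma sum_inn_le:
  assumes "v \<in> V" "S \<subseteq> V" "col \<phi> S"
  shows "(\<Sum>x\<in>X v. card (inn \<phi> x S)) \<le> card {u \<in> S. (u, v) \<in> A}"
proof -
  interpret d: colour_cover V "A\<inverse>" X "E\<inverse>" k q p by (rule converse)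
  show ?thesis using d.sum_out_le[of v S \<phi>] assms by (auto simp: d.col_def col_def)
qed

text \<open>Pigeonhole: if each of the at least \<open>k\<close> colours met \<open>p\<close>
  vertices, \<open>v\<close> would have \<open>k * p\<close> out-neighbours in
  \<open>S\<close>.\<close>

lemma colour_out:
  assumes "v \<in> V" "S \<subseteq> V" "col \<phi> S" "card {u \<in> S. (v, u) \<in> A} < k * p"
  shows "\<exists>x\<in>X v. card (out \<phi> x S) < p"
proof (rule ccontr)
  assume "\<not> ?thesis"
  then have "(\<Sum>x\<in>X v. p) \<le> (\<Sum>x\<in>X v. card (out \<phi> x S))" by (intro sum_mono) auto
  then have "card (X v) * p \<le> card {u \<in> S. (v, u) \<in> A}" using sum_out_le[OF assms(1-3)] by simp
  moreover have "k * p \<le> card (X v) * p" using cardX assms(1) by simp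
  ultimately show False using assms(4) by simp
qed

lemma colour_inn:
  assumes "v \<in> V" "S \<subseteq> V" "col \<phi> S" "card {u \<in> S. (u, v) \<in> A} < k * q"
  shows "\<exists>x\<in>X v. card (inn \<phi> x S) < q"
proof -
  interpret d: colour_cover V "A\<inverse>" X "E\<inverse>" k q p by (rule converse)
  show ?thesis using d.colour_out[of v S \<phi>] assms by (auto simp: d.col_def col_def)
qed

lemma colour_exists:
  assumes "v \<in> V" "S \<subseteq> V" "col \<phi> S"
    and "card {u \<in> S. (v, u) \<in> A} < k * p \<or> card {u \<in> S. (u, v) \<in> A} < k * q"
  obtains x where "x \<in> X v" "card (out \<phi> x S) < p \<or> card (inn \<phi> x S) < q"
  using assms(4) colour_out[OF assms(1-3)] colour_inn[OF assms(1-3)] by auto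

text \<open>The vertex supplied for the whole of \<open>S - S0\<close> is coloured last; the
  condition on all subsets then supplies the last vertex of the remaining set, and so on.\<close>

lemma greedy:
  assumes "S0 \<subseteq> S" "S \<subseteq> V" "good \<phi> S0"
    and "\<And>U. U \<subseteq> S - S0 \<Longrightarrow> U \<noteq> {} \<Longrightarrow>
      \<exists>u\<in>U. card {w \<in> S0 \<union> U. (u, w) \<in> A} < k * p \<or> card {w \<in> S0 \<union> U. (w, u) \<in> A} < k * q"
  shows "\<exists>\<psi>. (\<forall>u\<in>S0. \<psi> u = \<phi> u) \<and> good \<psi> S"
  using assms(1,2,4)
proof (induction "card (S - S0)" arbitrary: S)
  case 0
  then have "S = S0" using finV finite_subset by (metis Diff_eq_empty_iff card_0_eq finite_Diff subset_antisym)
  then show ?case using assms(3) by auto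
next
  case (Suc n)
  have finS: "finite S" using Suc finite_sub by auto
  have ne: "S - S0 \<noteq> {}" using Suc(2) by (metis card.empty nat.distinct(1))
  obtain u where u: "u \<in> S - S0" and du:
    "card {w \<in> S0 \<union> (S - S0). (u, w) \<in> A} < k * p \<or> card {w \<in> S0 \<union> (S - S0). (w, u) \<in> A} < k * q"
    using Suc.prems(3)[OF subset_refl ne] by blast
  have SS: "S0 \<union> (S - S0) = S" using Suc by auto
  let ?S = "S - {u}"
  have S': "S0 \<subseteq> ?S" "?S \<subseteq> V" "?S - S0 = (S - S0) - {u}" using Suc u by auto
  have "card (S - S0) = Suc (card (?S - S0))"
    unfolding S'(3) using u finS by (intro card.remove) auto
  then have n: "n = card (?S - S0)" using Suc(2) by linarith
  have sl: "\<exists>u\<in>U. card {w \<in> S0 \<union> U. (u, w) \<in> A} < k * p \<or> card {w \<in> S0 \<union> U. (w, u) \<in> A} < k * q"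
    if "U \<subseteq> ?S - S0" "U \<noteq> {}" for U
    using Suc.prems(3)[OF _ that(2)] that(1) by auto
  have "\<exists>\<psi>. (\<forall>u\<in>S0. \<psi> u = \<phi> u) \<and> good \<psi> ?S"
    by (rule Suc.hyps(1)[OF n S'(1,2)]) (rule sl)
  then obtain \<psi> where \<psi>: "\<forall>u\<in>S0. \<psi> u = \<phi> u" "good \<psi> ?S" by blast
  have "card {w \<in> ?S. (u, w) \<in> A} \<le> card {w \<in> S. (u, w) \<in> A}"
    "card {w \<in> ?S. (w, u) \<in> A} \<le> card {w \<in> S. (w, u) \<in> A}"
    using finS by (auto intro!: card_mono)
  then have "card {w \<in> ?S. (u, w) \<in> A} < k * p \<or> card {w \<in> ?S. (w, u) \<in> A} < k * q"
    using du unfolding SS by linarith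
  note deg = this
  have uV: "u \<in> V" and colS: "col \<psi> ?S" using u Suc.prems(2) \<psi>(2) by (auto simp: good_def)
  obtain x where x: "x \<in> X u" "card (out \<psi> x ?S) < p \<or> card (inn \<psi> x ?S) < q"
    by (rule colour_exists[OF uV S'(2) colS deg])
  have "good (\<psi>(u := x)) (insert u ?S)"
    by (rule good_extend[OF \<psi>(2) S'(2) uV _ x]) simp
  moreover have "insert u ?S = S" using u by auto
  moreover have "\<forall>w\<in>S0. (\<psi>(u := x)) w = \<phi> w" using \<psi>(1) u by auto
  ultimately show ?case by (intro exI[of _ "\<psi>(u := x)"]) simp
qed

end

section \<open>Covers without a degenerate transversal\<close>

text \<open>\<open>hard\<close> speaks of degenerate colourings only, so digraph properties stay out
  of the argument until covers are translated back.\<close>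

locale hard_cover = colour_cover V A X E k p q
  for V :: "'v set" and A and X :: "'v \<Rightarrow> 'c set" and E and k p q :: nat +
  assumes V_ne: "V \<noteq> {}"
    and p_pos: "1 \<le> p" and q_pos: "1 \<le> q" and k_pos: "1 \<le> k"
    and out_deg: "v \<in> V \<Longrightarrow> card {w \<in> V. (v, w) \<in> A} \<le> k * p"
    and in_deg: "v \<in> V \<Longrightarrow> card {w \<in> V. (w, v) \<in> A} \<le> k * q"
    and conn: "linked (\<lambda>u v. (u, v) \<in> A \<or> (v, u) \<in> A) V"
    and hard: "\<not> good \<phi> V"
begin

abbreviation adj :: "'v \<Rightarrow> 'v \<Rightarrow> bool" where
  "adj u v \<equiv> (u, v) \<in> A \<or> (v, u) \<in> A"

lemma good_dual: "colour_cover.good X (E\<inverse>) q p = good"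
proof -
  interpret d: colour_cover V "A\<inverse>" X "E\<inverse>" k q p by (rule converse)
  show ?thesis
    by (auto simp: fun_eq_iff d.good_def good_def d.col_def col_def degen_converse)
qed

lemma dual: "hard_cover V (A\<inverse>) X (E\<inverse>) k q p"
proof -
  interpret d: colour_cover V "A\<inverse>" X "E\<inverse>" k q p by (rule converse)
  have l: "linked (\<lambda>u v. (u, v) \<in> A\<inverse> \<or> (v, u) \<in> A\<inverse>) V"
    using conn by (simp add: disj_commute)
  show ?thesis
    by unfold_locales (use V_ne p_pos q_pos k_pos out_deg in_deg l hard good_dual in auto)
qed

text \<open>A nonempty part \<open>U\<close> of \<open>W - Z\<close> is a proper part of
  \<open>W\<close>, hence has a neighbour in \<open>W\<close> outside \<open>U\<close>. That
  neighbour is still uncoloured when \<open>U\<close> is, which pushes one degree strictly below its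
  bound.\<close>

lemma linked_greedy:
  assumes "W \<subseteq> V" "linked adj W" "Z \<subseteq> W" "Z \<noteq> {}" "good \<phi> (V - W)"
  obtains \<psi> where "\<And>u. u \<in> V - W \<Longrightarrow> \<psi> u = \<phi> u" "good \<psi> (V - Z)"
proof -
  have "\<exists>\<psi>. (\<forall>u\<in>V - W. \<psi> u = \<phi> u) \<and> good \<psi> (V - Z)"
  proof (rule greedy)
    show "V - W \<subseteq> V - Z" "V - Z \<subseteq> V" using assms(3) by auto
    show "good \<phi> (V - W)" by fact
    fix U assume U: "U \<subseteq> V - Z - (V - W)" "U \<noteq> {}"
    have UW: "U \<subseteq> W" "U \<noteq> W" using U assms(3,4) by auto
    obtain u w where uw: "u \<in> U" "w \<in> W" "w \<notin> U" "adj u w"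
      by (rule linkedD[OF assms(2) UW(1) U(2) UW(2)])
    have uV: "u \<in> V" and wV: "w \<in> V" using uw UW assms(1) by auto
    let ?S = "V - W \<union> U"
    have "card {x \<in> ?S. (u, x) \<in> A} < k * p" if "(u, w) \<in> A"
    proof -
      have "{x \<in> ?S. (u, x) \<in> A} \<subset> {x \<in> V. (u, x) \<in> A}" using that uw UW assms(1) by auto
      then have "card {x \<in> ?S. (u, x) \<in> A} < card {x \<in> V. (u, x) \<in> A}"
        using finV by (intro psubset_card_mono) auto
      then show ?thesis using out_deg[OF uV] by linarith
    qed
    moreover have "card {x \<in> ?S. (x, u) \<in> A} < k * q" if "(w, u) \<in> A"
    proof -
      have "{x \<in> ?S. (x, u) \<in> A} \<subset> {x \<in> V. (x, u) \<in> A}" using that uw UW assms(1) by auto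
      then have "card {x \<in> ?S. (x, u) \<in> A} < card {x \<in> V. (x, u) \<in> A}"
        using finV by (intro psubset_card_mono) auto
      then show ?thesis using in_deg[OF uV] by linarith
    qed
    ultimately show "\<exists>u\<in>U. card {w \<in> ?S. (u, w) \<in> A} < k * p \<or> card {w \<in> ?S. (w, u) \<in> A} < k * q"
      using uw by (intro bexI[of _ u]) auto
  qed
  then show thesis using that by blast
qed

lemma good_empty: "good \<phi> {}"
  by (simp add: good_def col_def degen_def)

lemma hole_exists:
  assumes "v \<in> V"
  obtains \<psi> where "good \<psi> (V - {v})"
proof -
  have e: "good \<phi> (V - V)" for \<phi> by (simp add: good_empty)
  show thesis
    by (rule linked_greedy[OF subset_refl conn _ _ e, of "{v}"]) (use assms that in auto)
qed

lemma hole_ge: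
  assumes "good \<phi> (V - {v})" "v \<in> V" "x \<in> X v"
  shows "p \<le> card (out \<phi> x (V - {v}))"
proof (rule ccontr)
  assume "\<not> ?thesis"
  then have "good (\<phi>(v := x)) (insert v (V - {v}))"
    using assms by (intro good_extend) auto
  then show False using hard assms(2) by (simp add: insert_absorb)
qed

text \<open>No colour can be given to \<open>v\<close>, so each one meets at least \<open>p\<close>
  coloured out-neighbours. Summing over \<open>X v\<close> and comparing with the degree bound
  leaves no slack; equality of the last sum says that every out-neighbour is met by some colour of
  \<open>v\<close>.\<close>

lemma hole_out:
  assumes "good \<phi> (V - {v})" "v \<in> V"
  shows "card {w \<in> V. (v, w) \<in> A} = k * p" (is ?reg)
    and "card (X v) = k" (is ?size)
    and "x \<in> X v \<Longrightarrow> card (out \<phi> x (V - {v})) = p"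
    and "(v, u) \<in> A \<Longrightarrow> \<exists>x\<in>X v. (x, \<phi> u) \<in> E"
proof -
  let ?O = "V - {v}"
  have c: "col \<phi> ?O" using assms(1) by (simp add: good_def)
  have nv: "{w \<in> ?O. (v, w) \<in> A} = {w \<in> V. (v, w) \<in> A}" using A_irrefl by auto
  have 1: "(\<Sum>x\<in>X v. p) \<le> (\<Sum>x\<in>X v. card (out \<phi> x ?O))"
    using hole_ge[OF assms] by (intro sum_mono) auto
  have 2: "(\<Sum>x\<in>X v. card (out \<phi> x ?O)) \<le> card {w \<in> V. (v, w) \<in> A}"
    using sum_out_le[of v ?O \<phi>] assms(2) c unfolding nv by auto
  have 3: "k * p \<le> card (X v) * p" using cardX[OF assms(2)] by simp
  have 4: "card {w \<in> V. (v, w) \<in> A} \<le> k * p" using out_deg assms(2) by auto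
  have c1: "(\<Sum>x\<in>X v. p) = card (X v) * p" by simp
  show ?reg using 1 2 3 4 c1 by linarith
  have "card (X v) * p = k * p" using 1 2 3 4 c1 by linarith
  then show ?size using p_pos by simp
  have eq: "(\<Sum>x\<in>X v. p) = (\<Sum>x\<in>X v. card (out \<phi> x ?O))" using 1 2 3 4 c1 by linarith
  show "card (out \<phi> x ?O) = p" if "x \<in> X v"
  proof (rule ccontr)
    assume "\<not> ?thesis"
    then have lt: "p < card (out \<phi> x ?O)" using hole_ge[OF assms that] by auto
    have "(\<Sum>x\<in>X v. p) < (\<Sum>x\<in>X v. card (out \<phi> x ?O))"
    proof (rule sum_strict_mono_ex1)
      show "finite (X v)" using finX assms(2) by auto
      show "\<forall>x\<in>X v. p \<le> card (out \<phi> x ?O)" using hole_ge[OF assms] by auto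
      show "\<exists>a\<in>X v. p < card (out \<phi> a ?O)" using lt that by auto
    qed
    then show False using eq by simp
  qed
  have un: "(\<Union>x\<in>X v. out \<phi> x ?O) = {w \<in> ?O. (v, w) \<in> A}"
  proof (rule card_subset_eq)
    show "finite {w \<in> ?O. (v, w) \<in> A}" using finV by auto
    show sub: "(\<Union>x\<in>X v. out \<phi> x ?O) \<subseteq> {w \<in> ?O. (v, w) \<in> A}"
      using out_union[OF assms(2) _ c] by auto
    have "card (\<Union>x\<in>X v. out \<phi> x ?O) = (\<Sum>x\<in>X v. card (out \<phi> x ?O))"
      using sum_out_eq[OF assms(2) _ c] by auto
    then show "card (\<Union>x\<in>X v. out \<phi> x ?O) = card {w \<in> ?O. (v, w) \<in> A}"
      unfolding nv using 1 2 3 4 c1 by linarith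
  qed
  show "\<exists>x\<in>X v. (x, \<phi> u) \<in> E" if vu: "(v, u) \<in> A"
  proof -
    have "u \<in> V" "u \<noteq> v" using vu A_sub A_irrefl by auto
    then have "u \<in> (\<Union>x\<in>X v. out \<phi> x ?O)" using vu by (simp add: un)
    then show ?thesis by auto
  qed
qed

lemma hole_in:
  assumes "good \<phi> (V - {v})" "v \<in> V"
  shows "card {w \<in> V. (w, v) \<in> A} = k * q"
    and "x \<in> X v \<Longrightarrow> card (inn \<phi> x (V - {v})) = q"
    and "(u, v) \<in> A \<Longrightarrow> \<exists>x\<in>X v. (\<phi> u, x) \<in> E"
proof -
  interpret d: hard_cover V "A\<inverse>" X "E\<inverse>" k q p by (rule dual)
  have "d.good \<phi> (V - {v})" using assms(1) unfolding good_dual .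
  note h = d.hole_out[OF this assms(2)]
  show "card {w \<in> V. (w, v) \<in> A} = k * q"
    and "x \<in> X v \<Longrightarrow> card (inn \<phi> x (V - {v})) = q"
    and "(u, v) \<in> A \<Longrightarrow> \<exists>x\<in>X v. (\<phi> u, x) \<in> E"
    using h(1,3) h(4)[of u] by auto
qed

lemma regular:
  assumes "v \<in> V"
  shows "card {w \<in> V. (v, w) \<in> A} = k * p" "card {w \<in> V. (w, v) \<in> A} = k * q" "card (X v) = k"
proof -
  obtain \<phi> where "good \<phi> (V - {v})" using hole_exists[OF assms] .
  then show "card {w \<in> V. (v, w) \<in> A} = k * p" "card {w \<in> V. (w, v) \<in> A} = k * q" "card (X v) = k"
    using hole_out(1,2) hole_in(1) assms by auto
qed

text \<open>The arcs are counted by tails and by heads, using the exact degrees.\<close>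

lemma p_eq_q: "p = q"
proof -
  have "(\<Sum>v\<in>V. card {w \<in> V. (v, w) \<in> A}) = card (SIGMA v:V. {w \<in> V. (v, w) \<in> A})"
    using finV by (intro card_SigmaI[symmetric]) auto
  also have "(SIGMA v:V. {w \<in> V. (v, w) \<in> A}) = A" using A_sub by auto
  finally have o: "card V * (k * p) = card A" using regular(1) by simp
  have "(\<Sum>v\<in>V. card {w \<in> V. (w, v) \<in> A}) = card (SIGMA v:V. {w \<in> V. (w, v) \<in> A})"
    using finV by (intro card_SigmaI[symmetric]) auto
  also have "(SIGMA v:V. {w \<in> V. (w, v) \<in> A}) = A\<inverse>" using A_sub by auto
  finally have i: "card V * (k * q) = card A" using regular(2) by simp
  have "card V * k * p = card V * k * q" using o i by (simp add: mult.assoc)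
  moreover have "card V * k \<noteq> 0" using k_pos V_ne finV by auto
  ultimately show ?thesis by simp
qed

end

section \<open>The bad component of a colouring\<close>

lemma not_linkedE:
  assumes "\<not> linked R W"
  obtains Z where "Z \<noteq> {}" "Z \<subset> W" "\<forall>u\<in>Z. \<forall>w\<in>W - Z. \<not> R u w"
  using assms unfolding linked_def by blast

locale regular_hard_cover = hard_cover V A X E k r r
  for V :: "'v set" and A and X :: "'v \<Rightarrow> 'c set" and E and k r :: nat +
  assumes k_ge2: "2 \<le> k"
begin

lemma rdual: "regular_hard_cover V (A\<inverse>) X (E\<inverse>) k r"
  using dual k_ge2 by (simp add: regular_hard_cover_def regular_hard_cover_axioms_def)

abbreviation full :: "('v \<Rightarrow> 'c) \<Rightarrow> bool" where
  "full \<phi> \<equiv> col \<phi> V"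

definition gadj :: "('v \<Rightarrow> 'c) \<Rightarrow> 'v \<Rightarrow> 'v \<Rightarrow> bool" where
  "gadj \<phi> u w \<longleftrightarrow> (\<phi> u, \<phi> w) \<in> E \<or> (\<phi> w, \<phi> u) \<in> E"

text \<open>For a full colouring this set, if nonempty, is the one \<open>r\<close>-diregular
  component: the lemmas below show that it is closed, linked and has all degrees \<open>r\<close>.
  Defining it by removal makes it insensitive to the colour of the removed vertex, whence
  \<open>bad_move\<close>.\<close>

definition bad :: "('v \<Rightarrow> 'c) \<Rightarrow> 'v set" where
  "bad \<phi> = {v \<in> V. good \<phi> (V - {v})}"

definition closed :: "('v \<Rightarrow> 'c) \<Rightarrow> 'v set \<Rightarrow> bool" where
  "closed \<phi> Y \<longleftrightarrow> (\<forall>u\<in>Y. \<forall>w\<in>V. gadj \<phi> u w \<longrightarrow> w \<in> Y)"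

lemma gadj_sym: "gadj \<phi> u w \<Longrightarrow> gadj \<phi> w u"
  by (auto simp: gadj_def)

lemma symp_gadj: "symp (gadj \<phi>)"
  by (auto simp: symp_def gadj_def)

lemma gadj_cong: "\<phi> u = \<psi> u \<Longrightarrow> \<phi> w = \<psi> w \<Longrightarrow> gadj \<phi> u w \<longleftrightarrow> gadj \<psi> u w"
  by (simp add: gadj_def)

lemma full_upd: "full \<phi> \<Longrightarrow> z \<in> X v \<Longrightarrow> full (\<phi>(v := z))"
  by (auto simp: col_def)

lemma full_in: "full \<phi> \<Longrightarrow> u \<in> V \<Longrightarrow> \<phi> u \<in> X u"
  by (auto simp: col_def)

lemma bad_V: "v \<in> bad \<phi> \<Longrightarrow> v \<in> V"
  by (auto simp: bad_def)

lemma bad_sub: "bad \<phi> \<subseteq> V"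
  by (auto simp: bad_def)

lemma finite_bad: "finite (bad \<phi>)"
  using finite_sub bad_sub by blast

lemma bad_hole:
  assumes "v \<in> bad \<phi>" "x \<in> X v"
  shows "card (out \<phi> x (V - {v})) = r" "card (inn \<phi> x (V - {v})) = r"
  using assms hole_out(3)[of \<phi> v x] hole_in(2)[of \<phi> v x] by (auto simp: bad_def)

lemma bad_meets:
  assumes "v \<in> bad \<phi>"
  shows "(v, u) \<in> A \<Longrightarrow> \<exists>x\<in>X v. (x, \<phi> u) \<in> E" "(u, v) \<in> A \<Longrightarrow> \<exists>x\<in>X v. (\<phi> u, x) \<in> E"
  using assms hole_out(4)[of \<phi> v u] hole_in(3)[of \<phi> v u] by (auto simp: bad_def)

lemma not_gadj_self: "full \<phi> \<Longrightarrow> v \<in> V \<Longrightarrow> \<not> gadj \<phi> v v"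
  using no_loop by (auto simp: gadj_def col_def)

lemma card_bad:
  assumes "full \<phi>" "v \<in> bad \<phi>"
  shows "card (out \<phi> (\<phi> v) V) = r" "card (inn \<phi> (\<phi> v) V) = r"
proof -
  have v: "v \<in> V" "\<phi> v \<in> X v" using assms bad_V full_in by auto
  then have "(\<phi> v, \<phi> v) \<notin> E" using no_loop by auto
  then have "out \<phi> (\<phi> v) V = out \<phi> (\<phi> v) (V - {v})" "inn \<phi> (\<phi> v) V = inn \<phi> (\<phi> v) (V - {v})"
    by auto
  then show "card (out \<phi> (\<phi> v) V) = r" "card (inn \<phi> (\<phi> v) V) = r"
    using bad_hole[OF assms(2) v(2)] by auto
qed

text \<open>Let \<open>u\<close> be a neighbour of the bad vertex \<open>v\<close>. A subset of
  \<open>V - {u}\<close> avoiding \<open>v\<close> has a low vertex because \<open>V - {v}\<close>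
  is good; in a subset containing \<open>v\<close>, the vertex \<open>v\<close> has lost
  \<open>u\<close> and drops below \<open>r\<close>.\<close>

lemma bad_closed: 
  assumes "full \<phi>"
  shows "closed \<phi> (bad \<phi>)"
  unfolding closed_def
proof (intro ballI impI)
  fix v u assume v: "v \<in> bad \<phi>" and u: "u \<in> V" and g: "gadj \<phi> v u"
  have vV: "v \<in> V" using v bad_V by auto
  have uv: "u \<noteq> v" using g not_gadj_self assms vV by auto
  have "\<exists>a\<in>U. card (out \<phi> (\<phi> a) U) < r \<or> card (inn \<phi> (\<phi> a) U) < r"
    if U: "U \<subseteq> V - {u}" "U \<noteq> {}" for U
  proof (cases "v \<in> U")
    case False
    then have "U \<subseteq> V - {v}" using U by auto
    then show ?thesis using v U unfolding bad_def good_def degen_def by auto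
  next
    case True
    have "card (out \<phi> (\<phi> v) U) < r" if "(\<phi> v, \<phi> u) \<in> E"
    proof -
      have "out \<phi> (\<phi> v) U \<subseteq> out \<phi> (\<phi> v) V" "u \<in> out \<phi> (\<phi> v) V" "u \<notin> out \<phi> (\<phi> v) U"
        using that u U by auto
      then have "out \<phi> (\<phi> v) U \<subset> out \<phi> (\<phi> v) V" by blast
      then have "card (out \<phi> (\<phi> v) U) < card (out \<phi> (\<phi> v) V)"
        using finV by (intro psubset_card_mono) auto
      then show ?thesis using card_bad[OF assms v] by simp
    qed
    moreover have "card (inn \<phi> (\<phi> v) U) < r" if "(\<phi> u, \<phi> v) \<in> E"
    proof -
      have "inn \<phi> (\<phi> v) U \<subseteq> inn \<phi> (\<phi> v) V" "u \<in> inn \<phi> (\<phi> v) V" "u \<notin> inn \<phi> (\<phi> v) U"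
        using that u U by auto
      then have "inn \<phi> (\<phi> v) U \<subset> inn \<phi> (\<phi> v) V" by blast
      then have "card (inn \<phi> (\<phi> v) U) < card (inn \<phi> (\<phi> v) V)"
        using finV by (intro psubset_card_mono) auto
      then show ?thesis using card_bad[OF assms v] by simp
    qed
    ultimately show ?thesis using g True by (auto simp: gadj_def)
  qed
  then have "dgn \<phi> (V - {u})" unfolding degen_def by blast
  then show "u \<in> bad \<phi>" using u assms by (auto simp: bad_def good_def col_def)
qed

lemma bad_step: "full \<phi> \<Longrightarrow> v \<in> bad \<phi> \<Longrightarrow> u \<in> V \<Longrightarrow> gadj \<phi> v u \<Longrightarrow> u \<in> bad \<phi>"
  using bad_closed[of \<phi>] by (simp add: closed_def)

lemma nbs_closed:
  assumes "closed \<phi> Y" "v \<in> Y" "Y \<subseteq> V"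
  shows "out \<phi> (\<phi> v) Y = out \<phi> (\<phi> v) V" "inn \<phi> (\<phi> v) Y = inn \<phi> (\<phi> v) V"
proof -
  have "w \<in> Y" if "w \<in> V" "gadj \<phi> v w" for w
    using assms(1,2) that by (simp add: closed_def)
  then show "out \<phi> (\<phi> v) Y = out \<phi> (\<phi> v) V" "inn \<phi> (\<phi> v) Y = inn \<phi> (\<phi> v) V"
    using assms(3) by (auto simp: gadj_def)
qed

lemma card_bad_in:
  assumes "full \<phi>" "v \<in> bad \<phi>"
  shows "card (out \<phi> (\<phi> v) (bad \<phi>)) = r" "card (inn \<phi> (\<phi> v) (bad \<phi>)) = r"
  using card_bad[OF assms] nbs_closed[OF bad_closed[OF assms(1)] assms(2) bad_sub] by auto

text \<open>A proper part without edges to the rest would keep degree \<open>r\<close> at all its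
  vertices; but it avoids some bad \<open>v\<close>, so goodness of \<open>V - {v}\<close> gives it
  a low vertex.\<close>

lemma linked_bad:
  assumes "full \<phi>"
  shows "linked (gadj \<phi>) (bad \<phi>)"
  unfolding linked_def
proof (intro allI impI, elim conjE, rule ccontr)
  fix Z assume Z: "Z \<noteq> {}" "Z \<subset> bad \<phi>"
    and no: "\<not> (\<exists>u\<in>Z. \<exists>w\<in>bad \<phi> - Z. gadj \<phi> u w)"
  obtain v where v: "v \<in> bad \<phi>" "v \<notin> Z" using Z by auto
  have ZV: "Z \<subseteq> V" using Z bad_sub by auto
  have cl: "closed \<phi> Z" unfolding closed_def
  proof (intro ballI impI)
    fix u w assume "u \<in> Z" "w \<in> V" "gadj \<phi> u w"
    then show "w \<in> Z" using no bad_step[OF assms, of u w] Z by blast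
  qed
  have "dgn \<phi> (V - {v})" using v by (auto simp: bad_def good_def)
  then obtain a where a: "a \<in> Z" "card (out \<phi> (\<phi> a) Z) < r \<or> card (inn \<phi> (\<phi> a) Z) < r"
    using Z(1) v(2) ZV unfolding degen_def by (auto dest!: spec[of _ Z])
  then show False using card_bad[OF assms, of a] nbs_closed[OF cl a(1) ZV] Z by auto
qed

lemma bad_nbr:
  assumes "full \<phi>" "v \<in> bad \<phi>"
  obtains u where "u \<in> bad \<phi>" "u \<noteq> v" "(\<phi> v, \<phi> u) \<in> E"
proof -
  have "card (out \<phi> (\<phi> v) (bad \<phi>)) \<noteq> 0" using card_bad_in[OF assms] p_pos by simp
  then have "out \<phi> (\<phi> v) (bad \<phi>) \<noteq> {}" by (metis card.empty)
  then obtain u where u: "u \<in> bad \<phi>" "(\<phi> v, \<phi> u) \<in> E" by auto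
  have "u \<noteq> v" using u not_gadj_self[OF assms(1), of v] bad_V by (auto simp: gadj_def)
  then show thesis by (rule that[OF u(1) _ u(2)])
qed

lemma bad_move:
  assumes "v \<in> bad \<phi>"
  shows "v \<in> bad (\<phi>(v := z))"
proof -
  have "good (\<phi>(v := z)) (V - {v}) \<longleftrightarrow> good \<phi> (V - {v})"
    by (rule good_cong) auto
  then show ?thesis using assms by (simp add: bad_def)
qed

lemma gadj_upd: "u \<noteq> v \<Longrightarrow> w \<noteq> v \<Longrightarrow> gadj (\<phi>(v := z)) u w \<longleftrightarrow> gadj \<phi> u w"
  by (simp add: gadj_def)

text \<open>A vertex in both bad components would have the same number of neighbours of either
  colour at \<open>v\<close>, which contradicts that colours are matched.\<close>

lemma bad_disjoint:
  assumes full: "full \<phi>" and v: "v \<in> bad \<phi>" and z: "z \<in> X v" "z \<noteq> \<phi> v"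
  shows "bad \<phi> \<inter> bad (\<phi>(v := z)) = {v}"
proof (rule ccontr)
  let ?\<psi> = "\<phi>(v := z)"
  assume ne: "bad \<phi> \<inter> bad ?\<psi> \<noteq> {v}"
  define Q where "Q = bad \<phi> \<inter> bad ?\<psi> - {v}"
  have vV: "v \<in> V" using v bad_V by auto
  have full': "full ?\<psi>" using full z by (intro full_upd)
  have v': "v \<in> bad ?\<psi>" using v by (rule bad_move)
  have Qne: "Q \<noteq> {}" using ne v v' unfolding Q_def by auto
  have nadj: "\<not> gadj \<phi> u v" if u: "u \<in> Q" for u
  proof
    assume g: "gadj \<phi> u v"
    have uB: "u \<in> bad \<phi>" "u \<in> bad ?\<psi>" "u \<noteq> v" "u \<in> V" using u bad_V unfolding Q_def by auto
    have uX: "\<phi> u \<in> X u" "\<phi> v \<in> X v" using full full_in uB vV by auto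
    have insV: "V = insert v (V - {v})" using vV by auto
    have fin: "finite (V - {v})" using finV by auto
    have same: "nbs E' ?\<psi> x (V - {v}) = nbs E' \<phi> x (V - {v})" for E' x
      by (rule nbs_remove) auto
    have "(\<phi> u, \<phi> v) \<in> E \<longleftrightarrow> (\<phi> u, z) \<in> E"
      using card_bad(1)[OF full uB(1)] card_bad(1)[OF full' uB(2)] uB(3)
        card_nbs_insert[OF fin, of v E \<phi> "\<phi> u"] card_nbs_insert[OF fin, of v E ?\<psi> "\<phi> u"]
      unfolding same insV[symmetric] by (auto split: if_splits)
    moreover have "(\<phi> v, \<phi> u) \<in> E \<longleftrightarrow> (z, \<phi> u) \<in> E"
      using card_bad(2)[OF full uB(1)] card_bad(2)[OF full' uB(2)] uB(3)
        card_nbs_insert[OF fin, of v "E\<inverse>" \<phi> "\<phi> u"] card_nbs_insert[OF fin, of v "E\<inverse>" ?\<psi> "\<phi> u"]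
      unfolding same insV[symmetric] by (auto split: if_splits)
    ultimately show False
      using g z E_out[OF uB(4) vV uX z(1)] E_in[OF vV uB(4) uX(2) z(1) uX(1)]
      unfolding gadj_def by metis
  qed
  have Qs: "Q \<subseteq> bad \<phi>" "Q \<noteq> bad \<phi>" using v unfolding Q_def by auto
  \<comment> \<open>Vertices of \<open>Q\<close> are not adjacent to \<open>v\<close>, so this edge
    avoids \<open>v\<close> and survives the recolouring; its end \<open>w\<close> is then common to
    both components as well.\<close>
  obtain u w where uw: "u \<in> Q" "w \<in> bad \<phi>" "w \<notin> Q" "gadj \<phi> u w"
    by (rule linkedD[OF linked_bad[OF full] Qs(1) Qne Qs(2)])
  have "w \<noteq> v" using nadj uw by auto
  moreover have "u \<noteq> v" using uw(1) by (auto simp: Q_def)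
  ultimately have "gadj ?\<psi> u w" using uw(4) gadj_upd by auto
  moreover have "u \<in> bad ?\<psi>" using uw(1) by (auto simp: Q_def)
  ultimately have "w \<in> bad ?\<psi>" using bad_step[OF full'] uw(2) bad_V by blast
  then show False using uw \<open>w \<noteq> v\<close> by (auto simp: Q_def)
qed

lemma closed_update:
  assumes "full \<psi>" "closed \<phi> Y" "Y \<subseteq> V" "v \<notin> Y" "\<psi> = \<phi>(v := z)" "v \<in> bad \<psi>" "bad \<psi> \<inter> Y = {}"
  shows "closed \<psi> Y"
  unfolding closed_def
proof (intro ballI impI)
  fix u w assume u: "u \<in> Y" and w: "w \<in> V" and g: "gadj \<psi> u w"
  have "w \<noteq> v"
  proof
    assume "w = v"
    then have "u \<in> bad \<psi>" using bad_step[OF assms(1,6), of u] g gadj_sym u assms(3) by auto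
    then show False using assms(7) u by auto
  qed
  moreover have "u \<noteq> v" using u assms(4) by auto
  ultimately have "gadj \<phi> u w" using g assms(5) gadj_upd by auto
  then show "w \<in> Y" using assms(2) u w unfolding closed_def by auto
qed

text \<open>The closed sets are the unions of components, so minimising their number minimises the
  number of components.\<close>

definition pot :: "('v \<Rightarrow> 'c) \<Rightarrow> nat" where
  "pot \<phi> = card {Y. Y \<subseteq> V \<and> closed \<phi> Y}"

definition mini :: "('v \<Rightarrow> 'c) \<Rightarrow> bool" where
  "mini \<phi> \<longleftrightarrow> full \<phi> \<and> bad \<phi> \<noteq> {} \<and> (\<forall>\<psi>. full \<psi> \<and> bad \<psi> \<noteq> {} \<longrightarrow> pot \<phi> \<le> pot \<psi>)"

text \<open>As \<open>r\<close> is positive, \<open>v\<close> has a neighbour in its component, and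
  a closed set contains \<open>v\<close> exactly when it contains that neighbour. So deleting
  \<open>v\<close> loses no information.\<close>

lemma closed_restrict:
  assumes "full \<chi>" "v \<in> bad \<chi>"
  shows "inj_on (\<lambda>Y. Y - {v}) {Y. Y \<subseteq> V \<and> closed \<chi> Y}"
proof (rule inj_onI)
  fix Y Y' assume Y: "Y \<in> {Y. Y \<subseteq> V \<and> closed \<chi> Y}" "Y' \<in> {Y. Y \<subseteq> V \<and> closed \<chi> Y}"
    and eq: "Y - {v} = Y' - {v}"
  obtain u where u: "u \<in> bad \<chi>" "u \<noteq> v" "(\<chi> v, \<chi> u) \<in> E"
    by (rule bad_nbr[OF assms])
  have g: "gadj \<chi> v u" "gadj \<chi> u v" using u by (auto simp: gadj_def)
  have uV: "u \<in> V" "v \<in> V" using u assms bad_V by auto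
  have "v \<in> Z \<longleftrightarrow> u \<in> Z" if "closed \<chi> Z" for Z
    using that g uV unfolding closed_def by blast
  moreover have "u \<in> Y \<longleftrightarrow> u \<in> Y'" using eq u by blast
  ultimately have "v \<in> Y \<longleftrightarrow> v \<in> Y'" using Y by blast
  then show "Y = Y'" using eq by blast
qed

text \<open>Both numbers are compared with the closed sets of the common colouring of
  \<open>V - {v}\<close>. Deleting the non-cut vertex \<open>v\<close> splits nothing, so these are
  at most \<open>pot \<phi>\<close> many; adding \<open>v\<close> with its new colour can only merge
  components, and merges some if \<open>v\<close> is a cut vertex of the new one.\<close>

lemma pot_move:
  assumes full: "full \<phi>" and v: "v \<in> bad \<phi>" and nc: "linked (gadj \<phi>) (bad \<phi> - {v})"
    and z: "z \<in> X v" and psi: "\<psi> = \<phi>(v := z)"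
  shows "pot \<psi> \<le> pot \<phi>" (is ?le)
    and "\<not> linked (gadj \<psi>) (bad \<psi> - {v}) \<Longrightarrow> pot \<psi> < pot \<phi>"
proof -
  let ?O = "V - {v}"
  define cl where "cl = {Y. Y \<subseteq> ?O \<and> (\<forall>u\<in>Y. \<forall>w\<in>?O. gadj \<phi> u w \<longrightarrow> w \<in> Y)}"
  let ?f = "\<lambda>Y. Y - {v}"
  let ?C = "\<lambda>\<chi>. {Y. Y \<subseteq> V \<and> closed \<chi> Y}"
  have full': "full \<psi>" using full z psi full_upd by auto
  have v': "v \<in> bad \<psi>" using v psi bad_move by auto
  have vV: "v \<in> V" using v bad_V by auto
  have fincl: "finite cl" unfolding cl_def using finV by auto
  have sub: "?f ` ?C \<psi> \<subseteq> cl"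
  proof
    fix Z assume "Z \<in> ?f ` ?C \<psi>"
    then obtain Y where Y: "Z = Y - {v}" "Y \<subseteq> V" "closed \<psi> Y" by auto
    have "w \<in> Z" if "u \<in> Z" "w \<in> ?O" "gadj \<phi> u w" for u w
    proof -
      have "gadj \<psi> u w" using that Y(1) psi gadj_upd by auto
      then show ?thesis using Y that unfolding closed_def by auto
    qed
    then show "Z \<in> cl" using Y(1,2) unfolding cl_def by auto
  qed
  have sub2: "cl \<subseteq> ?f ` ?C \<phi>"
  proof
    fix Y assume Y: "Y \<in> cl"
    have YO: "Y \<subseteq> ?O" and Ycl: "\<And>u w. u \<in> Y \<Longrightarrow> w \<in> ?O \<Longrightarrow> gadj \<phi> u w \<Longrightarrow> w \<in> Y"
      using Y unfolding cl_def by auto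
    show "Y \<in> ?f ` ?C \<phi>"
    proof (cases "(bad \<phi> - {v}) \<inter> Y = {}")
      case True
      have "closed \<phi> Y" unfolding closed_def
      proof (intro ballI impI)
        fix u w assume u: "u \<in> Y" and w: "w \<in> V" and g: "gadj \<phi> u w"
        have "w \<noteq> v"
        proof
          assume "w = v"
          then have "u \<in> bad \<phi>" using bad_step[OF full v, of u] g gadj_sym u YO by auto
          then show False using True u YO by auto
        qed
        then show "w \<in> Y" using Ycl[OF u _ g] w by auto
      qed
      then show ?thesis using YO by (intro image_eqI[of _ _ Y]) auto
    next
      case False
      have sb: "bad \<phi> - {v} \<subseteq> Y"
      proof (rule ccontr)
        assume "\<not> ?thesis"
        then have neq: "(bad \<phi> - {v}) \<inter> Y \<noteq> bad \<phi> - {v}" by auto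
        obtain u w where "u \<in> (bad \<phi> - {v}) \<inter> Y" "w \<in> bad \<phi> - {v}"
          "w \<notin> (bad \<phi> - {v}) \<inter> Y" "gadj \<phi> u w"
          by (rule linkedD[OF nc Int_lower1 False neq])
        then show False using Ycl[of u w] bad_sub by auto
      qed
      have "closed \<phi> (insert v Y)" unfolding closed_def
      proof (intro ballI impI)
        fix u w assume u: "u \<in> insert v Y" and w: "w \<in> V" and g: "gadj \<phi> u w"
        show "w \<in> insert v Y"
        proof (cases "u = v \<or> w = v")
          case True
          then show ?thesis using bad_step[OF full v w] g sb by auto
        next
          case False
          then show ?thesis using Ycl[of u w] u w g by auto
        qed
      qed
      then show ?thesis using YO vV by (intro image_eqI[of _ _ "insert v Y"]) auto
    qed
  qed
  have fC: "finite (?C \<chi>)" for \<chi> using finV by auto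
  have "card cl \<le> card (?f ` ?C \<phi>)" using sub2 fC by (intro card_mono) auto
  also have "\<dots> \<le> pot \<phi>" unfolding pot_def using fC by (intro card_image_le)
  finally have 1: "card cl \<le> pot \<phi>" .
  have 2: "pot \<psi> = card (?f ` ?C \<psi>)"
    unfolding pot_def using closed_restrict[OF full' v'] by (simp add: card_image)
  also have "\<dots> \<le> card cl" using sub fincl by (intro card_mono) auto
  finally show ?le using 1 by simp
  assume nl: "\<not> linked (gadj \<psi>) (bad \<psi> - {v})"
  obtain Z where Z: "Z \<noteq> {}" "Z \<subset> bad \<psi> - {v}"
    and no: "\<forall>u\<in>Z. \<forall>w\<in>bad \<psi> - {v} - Z. \<not> gadj \<psi> u w"
    by (rule not_linkedE[OF nl])
  \<comment> \<open>A piece \<open>Z\<close> cut off by \<open>v\<close> is closed on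
    \<open>V - {v}\<close>, but it is the trace of no closed set of \<open>\<psi>\<close>, since
    that set would split the new component.\<close>
  have "Z \<in> cl"
  proof -
    have "w \<in> Z" if u: "u \<in> Z" and w: "w \<in> ?O" and g: "gadj \<phi> u w" for u w
    proof -
      have "u \<noteq> v" "u \<in> bad \<psi>" using u Z by auto
      moreover have g': "gadj \<psi> u w" using g w \<open>u \<noteq> v\<close> psi gadj_upd by auto
      ultimately have "w \<in> bad \<psi>" using bad_step[OF full'] w by auto
      then show ?thesis using no u w g' by auto
    qed
    moreover have "Z \<subseteq> ?O" using Z bad_sub by auto
    ultimately show ?thesis unfolding cl_def by auto
  qed
  moreover have "Z \<notin> ?f ` ?C \<psi>"
  proof
    assume "Z \<in> ?f ` ?C \<psi>"
    then obtain Y where Y: "Z = Y - {v}" "Y \<subseteq> V" "closed \<psi> Y" by auto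
    have a: "Y \<inter> bad \<psi> \<noteq> {}" "Y \<inter> bad \<psi> \<noteq> bad \<psi>" using Z Y(1) by auto
    obtain u w where "u \<in> Y \<inter> bad \<psi>" "w \<in> bad \<psi>" "w \<notin> Y \<inter> bad \<psi>" "gadj \<psi> u w"
      by (rule linkedD[OF linked_bad[OF full'] Int_lower2 a])
    then show False using Y(3) bad_V[of w \<psi>] unfolding closed_def by auto
  qed
  ultimately have "?f ` ?C \<psi> \<subset> cl" using sub by auto
  then have "card (?f ` ?C \<psi>) < card cl" using fincl by (intro psubset_card_mono)
  then show "pot \<psi> < pot \<phi>" using 1 2 by simp
qed

lemma mini_exists: obtains \<phi> where "mini \<phi>"
proof -
  let ?P = "\<lambda>\<phi>. full \<phi> \<and> bad \<phi> \<noteq> {}"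
  obtain v where v: "v \<in> V" using V_ne by auto
  obtain \<psi> where psi: "good \<psi> (V - {v})" using hole_exists[OF v] .
  have "card (X v) \<noteq> 0" using cardX[OF v] k_ge2 by auto
  then obtain z where z: "z \<in> X v" by (metis card.empty all_not_in_conv)
  have "good (\<psi>(v := z)) (V - {v}) \<longleftrightarrow> good \<psi> (V - {v})" by (rule good_cong) auto
  then have "v \<in> bad (\<psi>(v := z))" using psi v by (auto simp: bad_def)
  moreover have "full (\<psi>(v := z))" using psi z by (auto simp: good_def col_def)
  ultimately have "?P (\<psi>(v := z))" by auto
  then have "\<exists>\<phi>. ?P \<phi> \<and> (\<forall>\<psi>. ?P \<psi> \<longrightarrow> pot \<phi> \<le> pot \<psi>)"
    by (rule ex_has_least_nat[where P = ?P and m = pot])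
  then show thesis using that unfolding mini_def by blast
qed

lemma mini_full: "mini \<phi> \<Longrightarrow> full \<phi>"
  by (simp add: mini_def)

text \<open>The second claim is the purpose of minimality: the component that \<open>v\<close> joins
  stays connected without \<open>v\<close>, so it is \<open>v\<close> together with a single old
  component.\<close>

lemma mini_move:
  assumes "mini \<phi>" "v \<in> bad \<phi>" "linked (gadj \<phi>) (bad \<phi> - {v})" "z \<in> X v"
  shows "mini (\<phi>(v := z))" "linked (gadj (\<phi>(v := z))) (bad (\<phi>(v := z)) - {v})"
proof -
  let ?\<psi> = "\<phi>(v := z)"
  have full: "full \<phi>" using assms(1) mini_full by auto
  note pm = pot_move[OF full assms(2,3,4) refl]
  have full': "full ?\<psi>" using full assms(4) full_upd by auto
  have ne: "bad ?\<psi> \<noteq> {}" using bad_move[OF assms(2), of z] by blast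
  have le: "pot \<phi> \<le> pot \<chi>" if "full \<chi>" "bad \<chi> \<noteq> {}" for \<chi>
    using assms(1) that unfolding mini_def by blast
  show "mini ?\<psi>" unfolding mini_def
    using full' ne pm(1) le by (meson order_trans)
  show "linked (gadj ?\<psi>) (bad ?\<psi> - {v})"
    using pm(2) le[OF full' ne] by linarith
qed

end

section \<open>Twins of a vertex of the bad component\<close>

context regular_hard_cover begin

abbreviation dig :: "'v \<Rightarrow> 'v \<Rightarrow> bool" where
  "dig u w \<equiv> (u, w) \<in> A \<and> (w, u) \<in> A"

definition twins :: "('v \<Rightarrow> 'c) \<Rightarrow> 'v set \<Rightarrow> 'c \<Rightarrow> 'c \<Rightarrow> bool" where
  "twins \<phi> Y x y \<longleftrightarrow>
     (\<forall>u\<in>Y. ((\<phi> u, x) \<in> E \<longleftrightarrow> (\<phi> u, y) \<in> E) \<and> ((x, \<phi> u) \<in> E \<longleftrightarrow> (y, \<phi> u) \<in> E))"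

definition complete :: "('v \<Rightarrow> 'c) \<Rightarrow> 'v set \<Rightarrow> bool" where
  "complete \<phi> S \<longleftrightarrow> card S = Suc r \<and> (\<forall>u\<in>S. \<forall>w\<in>S. u \<noteq> w \<longrightarrow> (\<phi> u, \<phi> w) \<in> E)"

lemma twinsD:
  assumes "twins \<phi> Y x y" "u \<in> Y"
  shows "(\<phi> u, x) \<in> E \<longleftrightarrow> (\<phi> u, y) \<in> E" "(x, \<phi> u) \<in> E \<longleftrightarrow> (y, \<phi> u) \<in> E"
  using assms by (auto simp: twins_def)

lemma completeD: "complete \<phi> S \<Longrightarrow> u \<in> S \<Longrightarrow> w \<in> S \<Longrightarrow> u \<noteq> w \<Longrightarrow> (\<phi> u, \<phi> w) \<in> E"
  by (simp add: complete_def)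

text \<open>A vertex of \<open>Y\<close> has degree \<open>r\<close> in both components and the same
  neighbours inside \<open>Y\<close>, so \<open>\<phi> a\<close> and \<open>\<psi> w\<close>
  contribute equally to its degree.\<close>

lemma twins_of_bad:
  assumes f: "full \<phi>" "full \<psi>" and B: "bad \<phi> = insert a Y" "bad \<psi> = insert w Y"
    and Y: "a \<notin> Y" "w \<notin> Y" and eq: "\<And>u. u \<in> Y \<Longrightarrow> \<psi> u = \<phi> u"
  shows "twins \<phi> Y (\<phi> a) (\<psi> w)"
  unfolding twins_def
proof
  fix u assume u: "u \<in> Y"
  have fin: "finite Y" using finite_bad[of \<phi>] B by simp
  have uB: "u \<in> bad \<phi>" "u \<in> bad \<psi>" using u B by auto
  have same: "nbs E' \<psi> x Y = nbs E' \<phi> x Y" for E' x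
    using eq by (intro nbs_cong) auto
  have "(\<phi> u, \<phi> a) \<in> E \<longleftrightarrow> (\<phi> u, \<psi> w) \<in> E"
    using card_bad_in(1)[OF f(1) uB(1)] card_bad_in(1)[OF f(2) uB(2)]
    unfolding B card_nbs_insert[OF fin Y(1)] card_nbs_insert[OF fin Y(2)] same eq[OF u]
    by (auto split: if_splits)
  moreover have "(\<phi> a, \<phi> u) \<in> E \<longleftrightarrow> (\<psi> w, \<phi> u) \<in> E"
    using card_bad_in(2)[OF f(1) uB(1)] card_bad_in(2)[OF f(2) uB(2)]
    unfolding B card_nbs_insert[OF fin Y(1)] card_nbs_insert[OF fin Y(2)] same eq[OF u]
    by (auto split: if_splits)
  ultimately show "((\<phi> u, \<phi> a) \<in> E \<longleftrightarrow> (\<phi> u, \<psi> w) \<in> E) \<and> ((\<phi> a, \<phi> u) \<in> E \<longleftrightarrow> (\<psi> w, \<phi> u) \<in> E)"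
    by simp
qed

text \<open>Recolour \<open>c\<close> so that it meets the colour of \<open>w\<close>, then give \<open>w\<close> the colour \<open>t\<close>. The new bad
  component contains \<open>a\<close> and \<open>b\<close> again, and comparing its degrees with the old ones shows that
  \<open>t\<close> has replaced \<open>c\<close>.\<close>

lemma twin_nbr:
  assumes full: "full \<phi>" and a: "a \<in> bad \<phi>" and w: "w \<in> V" "w \<notin> bad \<phi>" and t: "t \<in> X w"
    and tw: "twins \<phi> (bad \<phi> - {a}) (\<phi> a) t"
    and c: "c \<in> bad \<phi>" "c \<noteq> a" "gadj \<phi> a c"
    and b: "b \<in> bad \<phi>" "b \<noteq> a" "b \<noteq> c" "gadj \<phi> a b"
  shows "(\<phi> a, \<phi> c) \<in> E" "(\<phi> c, \<phi> a) \<in> E" "(t, \<phi> a) \<in> E" "(\<phi> a, t) \<in> E"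
    and "twins \<phi> (bad \<phi> - {a, c}) (\<phi> a) (\<phi> c)"
proof -
  let ?K = "bad \<phi>"
  have cV: "c \<in> V" "\<phi> c \<in> X c" using c bad_V full_in[OF full] by auto
  have wK: "\<not> gadj \<phi> u w" if "u \<in> ?K" for u
    using bad_step[OF full that w(1)] w(2) by auto
  have "(t, \<phi> c) \<in> E \<or> (\<phi> c, t) \<in> E"
    using c(3) twinsD[OF tw, of c] c by (auto simp: gadj_def)
  then have "adj w c"
    using E_arc[OF w(1) cV(1) t cV(2)] E_arc[OF cV(1) w(1) cV(2) t] by auto
  then obtain c' where c': "c' \<in> X c" "(\<phi> w, c') \<in> E \<or> (c', \<phi> w) \<in> E"
    using bad_meets[OF c(1), of w] by auto
  have c'ne: "c' \<noteq> \<phi> c" using c'(2) wK[OF c(1)] by (auto simp: gadj_def)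
  define \<psi> where "\<psi> = \<phi>(c := c')"
  define \<chi> where "\<chi> = \<psi>(w := t)"
  have wc: "w \<noteq> c" using w c by auto
  have full1: "full \<psi>" unfolding \<psi>_def using full c'(1) by (rule full_upd)
  have full2: "full \<chi>" unfolding \<chi>_def using full1 t by (rule full_upd)
  have cB: "c \<in> bad \<psi>" unfolding \<psi>_def using c(1) by (rule bad_move)
  have disj: "?K \<inter> bad \<psi> = {c}" unfolding \<psi>_def by (rule bad_disjoint[OF full c(1) c'(1) c'ne])
  have "gadj \<psi> c w" using c'(2) wc by (auto simp: gadj_def \<psi>_def)
  then have "w \<in> bad \<psi>" using bad_step[OF full1 cB w(1)] by auto
  then have wB: "w \<in> bad \<chi>" unfolding \<chi>_def by (rule bad_move)
  have chi: "\<chi> u = \<phi> u" if "u \<in> ?K" "u \<noteq> c" for u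
    using that w(2) by (auto simp: \<chi>_def \<psi>_def)
  \<comment> \<open>As a twin of \<open>\<phi> a\<close>, the colour \<open>t\<close> meets
    \<open>\<phi> b\<close>; this leads the new bad component back to \<open>b\<close>, and from
    there to \<open>a\<close>.\<close>
  have "(t, \<phi> b) \<in> E \<or> (\<phi> b, t) \<in> E"
    using b(4) twinsD[OF tw, of b] b by (auto simp: gadj_def)
  then have "gadj \<chi> w b" using chi[OF b(1) b(3)] by (auto simp: gadj_def \<chi>_def)
  then have bB: "b \<in> bad \<chi>" using bad_step[OF full2 wB] b bad_V by auto
  have "gadj \<chi> b a" using b(4) chi[OF b(1) b(3)] chi[OF a] c(2) by (auto simp: gadj_def)
  then have aB: "a \<in> bad \<chi>" using bad_step[OF full2 bB] a bad_V by auto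
  \<comment> \<open>The part of the old component, apart from \<open>a\<close> and \<open>c\<close>,
    that the new one reaches again. It contains all neighbours of \<open>a\<close> other than
    \<open>c\<close>.\<close>
  define R where "R = (?K - {a, c}) \<inter> bad \<chi>"
  have aR: "a \<notin> R" "c \<notin> insert a R" using c(2) by (auto simp: R_def)
  have finR: "finite R" using finite_bad[of \<phi>] by (auto simp: R_def)
  have nbR: "u \<in> insert c R" if u: "u \<in> V" "gadj \<phi> a u" for u
  proof (cases "u = c")
    case False
    have uK: "u \<in> ?K" using bad_step[OF full a] u by auto
    then have "gadj \<chi> a u" using u False chi[OF uK False] chi[OF a] c(2) by (auto simp: gadj_def)
    then have "u \<in> bad \<chi>" using bad_step[OF full2 aB] u by auto
    moreover have "u \<noteq> a" using u not_gadj_self[OF full] by auto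
    ultimately show ?thesis using uK False by (auto simp: R_def)
  qed auto
  \<comment> \<open>The degree of \<open>u\<close> is \<open>r\<close> before and after. Only
    \<open>c\<close> and \<open>w\<close> changed colour, and \<open>u\<close> meets neither the old
    colour of \<open>w\<close> nor \<open>c'\<close>; so \<open>\<phi> c\<close> and
    \<open>t\<close> must balance.\<close>
  have twc: "((\<phi> u, \<phi> c) \<in> E \<longleftrightarrow> (\<phi> u, t) \<in> E) \<and> ((\<phi> c, \<phi> u) \<in> E \<longleftrightarrow> (t, \<phi> u) \<in> E)"
    if u: "u \<in> insert a R" for u
  proof -
    have uK: "u \<in> ?K" "u \<noteq> c" "u \<in> bad \<chi>" "u \<noteq> w" "u \<in> V"
      using u a aB c(2) w(2) bad_V by (auto simp: R_def)
    let ?O = "V - {c, w}"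
    have V2: "V = insert c (insert w ?O)" using cV w by auto
    have fin: "finite ?O" "finite (insert w ?O)" using finV by auto
    have nin: "w \<notin> ?O" "c \<notin> insert w ?O" using wc by auto
    have same: "nbs E' \<chi> x ?O = nbs E' \<phi> x ?O" for E' x
      by (intro nbs_cong) (auto simp: \<chi>_def \<psi>_def)
    have chv: "\<chi> u = \<phi> u" "\<chi> c = c'" "\<chi> w = t" using chi uK wc by (auto simp: \<chi>_def \<psi>_def)
    have nw: "(\<phi> u, \<phi> w) \<notin> E" "(\<phi> w, \<phi> u) \<notin> E" using wK[OF uK(1)] by (auto simp: gadj_def)
    have "\<not> gadj \<psi> c u" using bad_step[OF full1 cB uK(5)] disj uK by auto
    then have nc: "(\<phi> u, c') \<notin> E" "(c', \<phi> u) \<notin> E" using uK by (auto simp: gadj_def \<psi>_def)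
    have deg: "card (nbs E' \<phi> (\<phi> u) V) = card (nbs E' \<phi> (\<phi> u) ?O)
        + (if (\<phi> u, \<phi> w) \<in> E' then 1 else 0) + (if (\<phi> u, \<phi> c) \<in> E' then 1 else 0)"
      "card (nbs E' \<chi> (\<chi> u) V) = card (nbs E' \<phi> (\<phi> u) ?O)
        + (if (\<phi> u, t) \<in> E' then 1 else 0) + (if (\<phi> u, c') \<in> E' then 1 else 0)" for E'
      by (subst V2, simp only: card_nbs_insert[OF fin(2) nin(2)] card_nbs_insert[OF fin(1) nin(1)] same chv)+
    show ?thesis
      using card_bad[OF full uK(1)] card_bad[OF full2 uK(3)] nw nc
      unfolding deg by (auto split: if_splits)
  qed
  have twR: "((\<phi> u, \<phi> c) \<in> E \<longleftrightarrow> (\<phi> u, \<phi> a) \<in> E) \<and> ((\<phi> c, \<phi> u) \<in> E \<longleftrightarrow> (\<phi> a, \<phi> u) \<in> E)"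
    if u: "u \<in> R" for u
    using twc[of u] twinsD[OF tw, of u] u by (auto simp: R_def)
  have subK: "insert a R \<subseteq> ?K" using a by (auto simp: R_def)
  have selfa: "(\<phi> a, \<phi> a) \<notin> E" using not_gadj_self[OF full bad_V[OF a]] by (auto simp: gadj_def)
  \<comment> \<open>On \<open>R\<close> the colours of \<open>a\<close> and \<open>c\<close> agree,
    and \<open>a\<close> has all its neighbours in \<open>R\<close> or at \<open>c\<close>. Since
    \<open>c\<close> has degree \<open>r\<close> as well, an arc between \<open>a\<close> and
    \<open>c\<close> in one direction forces the reverse arc.\<close>
  have cnt: "card (nbs E' \<phi> (\<phi> c) (insert a R)) + (if (\<phi> a, \<phi> c) \<in> E' then 1 else 0)
      = r + (if (\<phi> c, \<phi> a) \<in> E' then 1 else 0)" if E': "E' = E \<or> E' = E\<inverse>" for E'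
  proof -
    have aV: "nbs E' \<phi> (\<phi> a) V = nbs E' \<phi> (\<phi> a) (insert c R)"
    proof (intro set_eqI iffI)
      fix u assume "u \<in> nbs E' \<phi> (\<phi> a) V"
      then show "u \<in> nbs E' \<phi> (\<phi> a) (insert c R)" using nbR[of u] E' by (auto simp: gadj_def)
    next
      fix u assume "u \<in> nbs E' \<phi> (\<phi> a) (insert c R)"
      then show "u \<in> nbs E' \<phi> (\<phi> a) V" using cV bad_V by (auto simp: R_def)
    qed
    have "card (nbs E' \<phi> (\<phi> a) V) = r" using card_bad[OF full a] E' by auto
    then have 1: "card (nbs E' \<phi> (\<phi> a) R) + (if (\<phi> a, \<phi> c) \<in> E' then 1 else 0) = r"
      unfolding aV using card_nbs_insert[OF finR, of c E' \<phi> "\<phi> a"] aR by auto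
    have "nbs E' \<phi> (\<phi> c) R = nbs E' \<phi> (\<phi> a) R" using twR E' by auto
    then have "card (nbs E' \<phi> (\<phi> c) (insert a R)) = card (nbs E' \<phi> (\<phi> a) R) + (if (\<phi> c, \<phi> a) \<in> E' then 1 else 0)"
      using card_nbs_insert[OF finR aR(1), of E' \<phi> "\<phi> c"] by simp
    then show ?thesis using 1 by simp
  qed
  have le: "card (nbs E' \<phi> (\<phi> c) (insert a R)) \<le> card (nbs E' \<phi> (\<phi> c) ?K)" for E'
    using subK finite_bad by (intro card_nbs_mono)
  show ac: "(\<phi> a, \<phi> c) \<in> E" and ca: "(\<phi> c, \<phi> a) \<in> E"
    using cnt[of E] cnt[of "E\<inverse>"] le[of E] le[of "E\<inverse>"] card_bad_in[OF full c(1)] c(3)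
    by (auto simp: gadj_def split: if_splits)
  show "(t, \<phi> a) \<in> E" "(\<phi> a, t) \<in> E" using twc[of a] ac ca by auto
  \<comment> \<open>With the digon in place the count is exact: \<open>c\<close> has no neighbours
    in the component outside \<open>a\<close> and \<open>R\<close>, so it also agrees with
    \<open>a\<close> on the remaining vertices.\<close>
  have eqn: "nbs E' \<phi> (\<phi> c) (insert a R) = nbs E' \<phi> (\<phi> c) ?K" if E': "E' = E \<or> E' = E\<inverse>" for E'
  proof (rule card_subset_eq)
    show "finite (nbs E' \<phi> (\<phi> c) ?K)" using finite_bad by auto
    show "nbs E' \<phi> (\<phi> c) (insert a R) \<subseteq> nbs E' \<phi> (\<phi> c) ?K" using subK by (rule nbs_mono)
    show "card (nbs E' \<phi> (\<phi> c) (insert a R)) = card (nbs E' \<phi> (\<phi> c) ?K)"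
      using cnt[OF E'] card_bad_in[OF full c(1)] ac ca E' by auto
  qed
  show "twins \<phi> (?K - {a, c}) (\<phi> a) (\<phi> c)"
    unfolding twins_def
  proof
    fix u assume u: "u \<in> ?K - {a, c}"
    show "((\<phi> u, \<phi> a) \<in> E \<longleftrightarrow> (\<phi> u, \<phi> c) \<in> E) \<and> ((\<phi> a, \<phi> u) \<in> E \<longleftrightarrow> (\<phi> c, \<phi> u) \<in> E)"
    proof (cases "u \<in> R")
      case True
      then show ?thesis using twR by auto
    next
      case False
      then have "\<not> gadj \<phi> a u" using nbR[of u] u bad_V by auto
      moreover have "u \<notin> nbs E \<phi> (\<phi> c) ?K" "u \<notin> nbs (E\<inverse>) \<phi> (\<phi> c) ?K"
        using eqn[of E] eqn[of "E\<inverse>"] False u by auto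
      ultimately show ?thesis using u by (auto simp: gadj_def)
    qed
  qed
qed

lemma linked_closure:
  assumes "linked R K" "a \<in> S" "S \<subseteq> K" "\<And>u w. u \<in> S \<Longrightarrow> w \<in> K \<Longrightarrow> R u w \<Longrightarrow> w \<in> S"
  shows "S = K"
proof (rule ccontr)
  assume ne: "S \<noteq> K"
  have "S \<noteq> {}" using assms(2) by auto
  obtain u w where "u \<in> S" "w \<in> K" "w \<notin> S" "R u w"
    by (rule linkedD[OF assms(1,3) \<open>S \<noteq> {}\<close> ne])
  then show False using assms(4) by auto
qed

text \<open>If \<open>a\<close> has only one neighbour, then \<open>r = 1\<close> and the component
  is a digon. Otherwise each neighbour of \<open>a\<close> has a companion as required by
  \<open>twin_nbr\<close>; it is then joined to \<open>a\<close> by a digon and sees the same other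
  vertices as \<open>a\<close>. So \<open>a\<close> and its neighbours exhaust the component and are
  pairwise joined.\<close>

lemma twin_complete:
  assumes full: "full \<phi>" and a: "a \<in> bad \<phi>" and w: "w \<in> V" "w \<notin> bad \<phi>" and t: "t \<in> X w"
    and tw: "twins \<phi> (bad \<phi> - {a}) (\<phi> a) t"
  shows "complete \<phi> (bad \<phi>)" and "2 \<le> r \<Longrightarrow> (t, \<phi> a) \<in> E \<and> (\<phi> a, t) \<in> E"
proof -
  let ?K = "bad \<phi>"
  have selfno: "\<not> gadj \<phi> u u" if "u \<in> ?K" for u using not_gadj_self[OF full] bad_V that by auto
  note tn = twin_nbr[OF full a w t tw]
  define N where "N = {u \<in> ?K. gadj \<phi> a u}"
  have finN: "finite N" using finite_bad[of \<phi>] by (simp add: N_def)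
  have aN: "a \<notin> N" using selfno[OF a] by (simp add: N_def)
  have outN: "out \<phi> (\<phi> a) ?K \<subseteq> N" "inn \<phi> (\<phi> a) ?K \<subseteq> N" by (auto simp: N_def gadj_def)
  show big: "(t, \<phi> a) \<in> E \<and> (\<phi> a, t) \<in> E" if "2 \<le> r"
  proof -
    have "2 \<le> card (out \<phi> (\<phi> a) ?K)" using card_bad_in(1)[OF full a] that by simp
    also have "\<dots> \<le> card N" using outN finN by (intro card_mono)
    finally obtain b c where "b \<in> N" "c \<in> N" "b \<noteq> c"
      by (metis One_nat_def Suc_1 Suc_le_eq card_le_Suc0_iff_eq finN not_less)
    then show ?thesis using tn(3,4)[of c b] aN by (auto simp: N_def)
  qed
  have "\<exists>c. N \<subseteq> {c} \<or> (\<forall>c\<in>N. \<exists>b\<in>N. b \<noteq> c)" by blast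
  then consider (one) c where "N \<subseteq> {c}" | (more) "\<forall>c\<in>N. \<exists>b\<in>N. b \<noteq> c" by blast
  then show "complete \<phi> ?K"
  proof cases
    case one
    have "1 \<le> card (out \<phi> (\<phi> a) ?K)" "1 \<le> card (inn \<phi> (\<phi> a) ?K)"
      using card_bad_in[OF full a] p_pos by auto
    then have "out \<phi> (\<phi> a) ?K \<noteq> {}" "inn \<phi> (\<phi> a) ?K \<noteq> {}"
      by (metis card.empty not_one_le_zero)+
    then have oc: "out \<phi> (\<phi> a) ?K = {c}" "inn \<phi> (\<phi> a) ?K = {c}" using outN one by blast+
    then have r1: "r = 1" using card_bad_in(1)[OF full a] by simp
    have cK: "c \<in> ?K" "(\<phi> a, \<phi> c) \<in> E" "(\<phi> c, \<phi> a) \<in> E" using oc by auto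
    have ca: "c \<noteq> a" using cK selfno[OF a] by (auto simp: gadj_def)
    have oc': "out \<phi> (\<phi> c) ?K = {a}" "inn \<phi> (\<phi> c) ?K = {a}"
    proof -
      have "a \<in> out \<phi> (\<phi> c) ?K" "a \<in> inn \<phi> (\<phi> c) ?K" using cK a by auto
      moreover have "card (out \<phi> (\<phi> c) ?K) = 1" "card (inn \<phi> (\<phi> c) ?K) = 1"
        using card_bad_in[OF full cK(1)] r1 by auto
      ultimately show "out \<phi> (\<phi> c) ?K = {a}" "inn \<phi> (\<phi> c) ?K = {a}"
        by (metis card_1_singletonE singletonD)+
    qed
    have "{a, c} = ?K"
    proof (rule linked_closure[OF linked_bad[OF full]])
      show "a \<in> {a, c}" "{a, c} \<subseteq> ?K" using a cK by auto
      fix u x assume "u \<in> {a, c}" and xK: "x \<in> ?K" "gadj \<phi> u x"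
      then consider "u = a" | "u = c" by auto
      then show "x \<in> {a, c}"
      proof cases
        case 1
        then have "x \<in> out \<phi> (\<phi> a) ?K \<or> x \<in> inn \<phi> (\<phi> a) ?K" using xK by (auto simp: gadj_def)
        then show ?thesis unfolding oc by auto
      next
        case 2
        then have "x \<in> out \<phi> (\<phi> c) ?K \<or> x \<in> inn \<phi> (\<phi> c) ?K" using xK by (auto simp: gadj_def)
        then show ?thesis unfolding oc' by auto
      qed
    qed
    then have K: "?K = {a, c}" by simp
    have "card {a, c} = Suc r" using r1 ca by simp
    moreover have "\<forall>u\<in>{a, c}. \<forall>w\<in>{a, c}. u \<noteq> w \<longrightarrow> (\<phi> u, \<phi> w) \<in> E" using cK(2,3) by blast
    ultimately show ?thesis unfolding complete_def K by blast
  next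
    case more
    have c1: "(\<phi> a, \<phi> c) \<in> E" "(\<phi> c, \<phi> a) \<in> E" "twins \<phi> (?K - {a, c}) (\<phi> a) (\<phi> c)" "c \<in> ?K" "c \<noteq> a"
      if cN: "c \<in> N" for c
    proof -
      obtain b where "b \<in> N" "b \<noteq> c" using more cN by auto
      then have "b \<in> ?K" "b \<noteq> a" "b \<noteq> c" "gadj \<phi> a b" "c \<in> ?K" "c \<noteq> a" "gadj \<phi> a c"
        using cN aN by (auto simp: N_def)
      then show "(\<phi> a, \<phi> c) \<in> E" "(\<phi> c, \<phi> a) \<in> E" "twins \<phi> (?K - {a, c}) (\<phi> a) (\<phi> c)" "c \<in> ?K" "c \<noteq> a"
        using tn[of c b] by auto
    qed
    have KN: "insert a N = ?K"
    proof (rule linked_closure[OF linked_bad[OF full]])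
      show "a \<in> insert a N" "insert a N \<subseteq> ?K" using a by (auto simp: N_def)
      fix u x assume u: "u \<in> insert a N" and x: "x \<in> ?K" "gadj \<phi> u x"
      show "x \<in> insert a N"
      proof (cases "u = a \<or> x = a")
        case True
        then show ?thesis using x by (auto simp: N_def)
      next
        case False
        then have uN: "u \<in> N" using u by auto
        have "x \<noteq> u" using x selfno by auto
        then have "x \<in> ?K - {a, u}" using x False by auto
        then have "gadj \<phi> a x" using twinsD[OF c1(3)[OF uN]] x by (auto simp: gadj_def)
        then show ?thesis using x by (auto simp: N_def)
      qed
    qed
    have "out \<phi> (\<phi> a) ?K = N"
      using c1(1,4) outN by auto
    then have "card N = r" using card_bad_in(1)[OF full a] by simp
    then have "card ?K = Suc r" using KN aN finN by (metis card_insert_disjoint)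
    moreover have "(\<phi> u, \<phi> x) \<in> E" if "u \<in> ?K" "x \<in> ?K" "u \<noteq> x" for u x
    proof (cases "u = a \<or> x = a")
      case True
      then have "u = a \<and> x \<in> N \<or> x = a \<and> u \<in> N" using that by (simp add: KN[symmetric]) blast
      then show ?thesis using c1(1,2) by auto
    next
      case False
      then have N: "u \<in> N" "x \<in> N" using that KN by auto
      then have "x \<in> ?K - {a, u}" using that False by auto
      then show ?thesis using twinsD(2)[OF c1(3)[OF N(1)]] c1(1)[OF N(2)] by auto
    qed
    ultimately show ?thesis unfolding complete_def by auto
  qed
qed

section \<open>Moving a vertex into a given component\<close>

text \<open>No edge leads from the common part of \<open>Y\<close> and
  \<open>bad \<psi> - {v}\<close> to a vertex in only one of them. Both are linked, so they coincide
  once they meet.\<close>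

lemma bad_eq_insert:
  assumes "full \<psi>" "v \<in> bad \<psi>" "linked (gadj \<psi>) (bad \<psi> - {v})"
    and "Y \<subseteq> V" "v \<notin> Y" "linked (gadj \<psi>) Y"
    and cl: "\<And>u w. u \<in> Y \<Longrightarrow> w \<in> V - {v} \<Longrightarrow> gadj \<psi> u w \<Longrightarrow> w \<in> Y"
    and ne: "Y \<inter> bad \<psi> \<noteq> {}"
  shows "bad \<psi> = insert v Y"
proof -
  obtain y where y: "y \<in> Y \<inter> bad \<psi>" using ne by auto
  have "Y \<inter> bad \<psi> = Y"
  proof (rule linked_closure[OF assms(6) y])
    fix u w assume "u \<in> Y \<inter> bad \<psi>" "w \<in> Y" "gadj \<psi> u w"
    then show "w \<in> Y \<inter> bad \<psi>" using bad_step[OF assms(1), of u w] assms(4) by auto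
  qed auto
  moreover have "Y \<inter> bad \<psi> = bad \<psi> - {v}"
  proof (rule linked_closure[OF assms(3) y])
    show "Y \<inter> bad \<psi> \<subseteq> bad \<psi> - {v}" using assms(5) by auto
    fix u w assume "u \<in> Y \<inter> bad \<psi>" "w \<in> bad \<psi> - {v}" "gadj \<psi> u w"
    then show "w \<in> Y \<inter> bad \<psi>" using cl[of u w] bad_V by auto
  qed
  ultimately show ?thesis using assms(2) by auto
qed

lemma bad_eq_move:
  assumes "mini \<phi>" "v \<in> bad \<phi>" "linked (gadj \<phi>) (bad \<phi> - {v})" "z \<in> X v"
    and Y: "Y \<subseteq> V" "v \<notin> Y" "linked (gadj \<phi>) Y" "closed \<phi> Y"
    and ne: "Y \<inter> bad (\<phi>(v := z)) \<noteq> {}"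
  shows "bad (\<phi>(v := z)) = insert v Y"
proof (rule bad_eq_insert[OF _ bad_move[OF assms(2)] mini_move(2)[OF assms(1-4)] Y(1,2) _ _ ne])
  show "full (\<phi>(v := z))" using mini_full[OF assms(1)] assms(4) by (rule full_upd)
  show "linked (gadj (\<phi>(v := z))) Y"
    using Y(3) linked_cong[of Y "gadj \<phi>" "gadj (\<phi>(v := z))"] gadj_upd Y(2) by metis
  fix u w assume u: "u \<in> Y" and w: "w \<in> V - {v}" and g: "gadj (\<phi>(v := z)) u w"
  have "u \<noteq> v" "w \<noteq> v" using u w Y(2) by auto
  then have "gadj \<phi> u w" using g by (simp add: gadj_upd)
  then show "w \<in> Y" using Y(4) u w unfolding closed_def by auto
qed

text \<open>Since \<open>v\<close> is bad, some colour of \<open>v\<close> meets the colour of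
  \<open>g\<close>; choosing it draws \<open>g\<close>, and with it all of \<open>Y\<close>, into
  the new component.\<close>

lemma jump:
  assumes m: "mini \<phi>" and v: "v \<in> bad \<phi>" "linked (gadj \<phi>) (bad \<phi> - {v})"
    and Y: "Y \<subseteq> V" "v \<notin> Y" "linked (gadj \<phi>) Y" "closed \<phi> Y"
    and g: "g \<in> Y" "g \<notin> bad \<phi>" "adj v g"
  obtains z where "z \<in> X v" "z \<noteq> \<phi> v" "mini (\<phi>(v := z))" "bad (\<phi>(v := z)) = insert v Y"
proof -
  have full: "full \<phi>" using m by (rule mini_full)
  have gV: "g \<in> V" using g Y by auto
  obtain z where z: "z \<in> X v" "(z, \<phi> g) \<in> E \<or> (\<phi> g, z) \<in> E"
    using bad_meets[OF v(1), of g] g(3) by auto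
  let ?\<psi> = "\<phi>(v := z)"
  have zne: "z \<noteq> \<phi> v"
    using z(2) bad_step[OF full v(1) gV] g(2) by (auto simp: gadj_def)
  have gv: "g \<noteq> v" using g Y by auto
  have "gadj ?\<psi> v g" using z(2) gv by (auto simp: gadj_def)
  then have "g \<in> bad ?\<psi>"
    using bad_step[OF full_upd[OF full z(1)] bad_move[OF v(1)] gV] by auto
  then have "Y \<inter> bad ?\<psi> \<noteq> {}" using g by auto
  then have "bad ?\<psi> = insert v Y" by (rule bad_eq_move[OF m v z(1) Y])
  then show thesis using that[OF z(1) zne mini_move(1)[OF m v z(1)]] by auto
qed

end

section \<open>Chains of bad components\<close>

text \<open>\<open>v (Suc i)\<close> is the vertex shared by the bad components of
  \<open>f i\<close> and \<open>f (Suc i)\<close>; \<open>v 0\<close> is any bad vertex, so that the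
  first component has an entry too. \<open>stuck\<close> says that every further move would violate
  \<open>fresh\<close>.\<close>

locale exhausted_chain = regular_hard_cover V A X E k r
  for V :: "'v set" and A and X :: "'v \<Rightarrow> 'c set" and E and k r :: nat +
  fixes l :: nat and f :: "nat \<Rightarrow> 'v \<Rightarrow> 'c" and v :: "nat \<Rightarrow> 'v"
  assumes min: "i \<le> l \<Longrightarrow> mini (f i)"
    and start: "v 0 \<in> bad (f 0)"
    and move: "i < l \<Longrightarrow> v (Suc i) \<in> bad (f i) \<and> v (Suc i) \<noteq> v i \<and>
      linked (gadj (f i)) (bad (f i) - {v (Suc i)}) \<and>
      (\<exists>z\<in>X (v (Suc i)). z \<noteq> f i (v (Suc i)) \<and> f (Suc i) = (f i)(v (Suc i) := z))"
    and fresh: "i < j \<Longrightarrow> j \<le> l \<Longrightarrow> bad (f j) \<inter> (bad (f i) - {v (Suc i)}) = {}"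
    and stuck: "w \<in> bad (f l) \<Longrightarrow> w \<noteq> v l \<Longrightarrow> linked (gadj (f l)) (bad (f l) - {w}) \<Longrightarrow>
      z \<in> X w \<Longrightarrow> z \<noteq> f l w \<Longrightarrow>
      \<exists>i<l. bad ((f l)(w := z)) \<inter> (bad (f i) - {v (Suc i)}) \<noteq> {}"

text \<open>Freshness makes the entries \<open>v i\<close> with \<open>i < l\<close> distinct, which
  bounds the length of a chain by \<open>card V\<close>. A longest chain is exhausted, since a move
  contradicting \<open>stuck\<close> would prolong it.\<close>

lemma (in regular_hard_cover) exhausted_chain_exists:
  "\<exists>l f v. exhausted_chain V A X E k r l f v"
proof -
  define ch where "ch l f v \<longleftrightarrow> (\<forall>i\<le>l. mini (f i)) \<and> v 0 \<in> bad (f 0) \<and>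
    (\<forall>i<l. v (Suc i) \<in> bad (f i) \<and> v (Suc i) \<noteq> v i \<and>
      linked (gadj (f i)) (bad (f i) - {v (Suc i)}) \<and>
      (\<exists>z\<in>X (v (Suc i)). z \<noteq> f i (v (Suc i)) \<and> f (Suc i) = (f i)(v (Suc i) := z))) \<and>
    (\<forall>i j. i < j \<and> j \<le> l \<longrightarrow> bad (f j) \<inter> (bad (f i) - {v (Suc i)}) = {})"
    for l :: nat and f :: "nat \<Rightarrow> 'v \<Rightarrow> 'c" and v :: "nat \<Rightarrow> 'v"
  obtain \<phi> where phi: "mini \<phi>" by (rule mini_exists)
  obtain u where u: "u \<in> bad \<phi>" using phi by (auto simp: mini_def)
  have ch0: "\<exists>f v. ch 0 f v"
    by (rule exI[of _ "\<lambda>_. \<phi>"], rule exI[of _ "\<lambda>_. u"]) (use phi u in \<open>auto simp: ch_def\<close>)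
  have bound: "l \<le> card V" if "ch l f v" for l f v
  proof -
    have vK: "v i \<in> bad (f i)" if "i \<le> l" for i
    proof (cases i)
      case 0
      then show ?thesis using \<open>ch l f v\<close> by (simp add: ch_def)
    next
      case (Suc j)
      then have "j < l" using that by auto
      then have "v (Suc j) \<in> bad (f j) \<and> (\<exists>z\<in>X (v (Suc j)). f (Suc j) = (f j)(v (Suc j) := z))"
        using \<open>ch l f v\<close> by (simp add: ch_def) blast
      then show ?thesis using Suc bad_move by metis
    qed
    have "inj_on v {..<l}"
    proof (rule linorder_inj_onI)
      fix i j assume ij: "i < j" "i \<in> {..<l}" "j \<in> {..<l}"
      have "bad (f j) \<inter> (bad (f i) - {v (Suc i)}) = {}" "v (Suc i) \<noteq> v i"
        using \<open>ch l f v\<close> ij unfolding ch_def by auto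
      then show "v i \<noteq> v j" using vK[of i] vK[of j] ij by auto
    qed auto
    moreover have "v ` {..<l} \<subseteq> V"
    proof (rule image_subsetI)
      fix i assume "i \<in> {..<l}"
      then show "v i \<in> V" using bad_V[OF vK[of i]] by simp
    qed
    ultimately have "card {..<l} \<le> card V" using finV by (rule card_inj_on_le)
    then show ?thesis by simp
  qed
  have "\<exists>l. (\<exists>f v. ch l f v) \<and> (\<forall>l'. (\<exists>f v. ch l' f v) \<longrightarrow> l' \<le> l)"
    by (rule ex_has_greatest_nat[where P = "\<lambda>l. \<exists>f v. ch l f v" and f = "\<lambda>l. l" and b = "Suc (card V)" and k = 0])
      (use ch0 bound in \<open>auto simp: less_Suc_eq_le\<close>)
  then obtain l f v where c: "ch l f v" and max: "\<And>f v. \<not> ch (Suc l) f v"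
    by (metis Suc_n_not_le_n)
  have c1: "\<And>i. i \<le> l \<Longrightarrow> mini (f i)" "v 0 \<in> bad (f 0)" using c by (auto simp: ch_def)
  have c2: "\<And>i. i < l \<Longrightarrow> v (Suc i) \<in> bad (f i) \<and> v (Suc i) \<noteq> v i \<and>
      linked (gadj (f i)) (bad (f i) - {v (Suc i)}) \<and>
      (\<exists>z\<in>X (v (Suc i)). z \<noteq> f i (v (Suc i)) \<and> f (Suc i) = (f i)(v (Suc i) := z))"
    using c by (simp add: ch_def)
  have c3: "\<And>i j. i < j \<Longrightarrow> j \<le> l \<Longrightarrow> bad (f j) \<inter> (bad (f i) - {v (Suc i)}) = {}"
    using c by (simp add: ch_def)
  have "exhausted_chain V A X E k r l f v"
  proof (unfold_locales)
    fix w z assume w: "w \<in> bad (f l)" "w \<noteq> v l" "linked (gadj (f l)) (bad (f l) - {w})"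
      and z: "z \<in> X w" "z \<noteq> f l w"
    show "\<exists>i<l. bad ((f l)(w := z)) \<inter> (bad (f i) - {v (Suc i)}) \<noteq> {}"
    proof (rule ccontr)
      assume no: "\<not> ?thesis"
      let ?g = "f(Suc l := (f l)(w := z))" and ?v = "v(Suc l := w)"
      have m: "mini ((f l)(w := z))" using mini_move(1)[OF c1(1)[of l] w(1,3) z(1)] by simp
      \<comment> \<open>Freshness against the last component is automatic by
        \<open>bad_disjoint\<close>; only earlier components can obstruct the prolongation.\<close>
      have d: "bad ((f l)(w := z)) \<inter> (bad (f l) - {w}) = {}"
        using bad_disjoint[OF mini_full[OF c1(1)[OF order_refl]] w(1) z] by blast
      have "ch (Suc l) ?g ?v"
        unfolding ch_def
      proof (intro conjI allI impI; (elim conjE)?)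
        show "mini (?g i)" if "i \<le> Suc l" for i using c1(1) m that by (auto simp: le_Suc_eq)
        show "?v 0 \<in> bad (?g 0)" using c1(2) by auto
        show "?v (Suc i) \<in> bad (?g i)" "?v (Suc i) \<noteq> ?v i"
          "linked (gadj (?g i)) (bad (?g i) - {?v (Suc i)})" if "i < Suc l" for i
          using that w c2[of i] by (auto simp: less_Suc_eq)
        show "\<exists>y\<in>X (?v (Suc i)). y \<noteq> ?g i (?v (Suc i)) \<and> ?g (Suc i) = (?g i)(?v (Suc i) := y)"
          if "i < Suc l" for i
          using that z c2[of i] by (auto simp: less_Suc_eq)
        show "bad (?g j) \<inter> (bad (?g i) - {?v (Suc i)}) = {}" if ij: "i < j" "j \<le> Suc l" for i j
        proof (cases "j = Suc l")
          case True
          then show ?thesis using no d ij by (cases "i = l") auto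
        next
          case False
          then show ?thesis using c3[of i j] ij by auto
        qed
      qed
      then show False using max by blast
    qed
  qed (use c1 c2 c3 in auto)
  then show ?thesis by blast
qed

context exhausted_chain begin

abbreviation "K i \<equiv> bad (f i)"
text \<open>What remains of the component after \<open>v (Suc i)\<close> has moved on;
  \<open>Y i\<close> is, for positive \<open>i\<close>, the part that \<open>v i\<close> has
  joined.\<close>

abbreviation "C i \<equiv> K i - {v (Suc i)}"
abbreviation "Y i \<equiv> K i - {v i}"

lemma fullf: "i \<le> l \<Longrightarrow> full (f i)"
  using min mini_full by blast

lemma v_next: "i < l \<Longrightarrow> v (Suc i) \<in> K i" "i < l \<Longrightarrow> v (Suc i) \<noteq> v i"
  using move by auto

lemma v_in_K: "i \<le> l \<Longrightarrow> v i \<in> K i"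
proof (cases i)
  case (Suc j)
  assume "i \<le> l"
  then obtain z where "f (Suc j) = (f j)(v (Suc j) := z)" "v (Suc j) \<in> K j"
    using move[of j] Suc by auto
  then show ?thesis using Suc bad_move by metis
qed (use start in simp)

lemma v_in_C: "i < l \<Longrightarrow> v i \<in> C i"
  using v_in_K[of i] v_next[of i] by auto

lemma v_notin_C: "i < m \<Longrightarrow> m \<le> l \<Longrightarrow> v m \<notin> C i"
  using fresh[of i m] v_in_K[of m] by auto

lemma v_inj: "i < j \<Longrightarrow> j \<le> l \<Longrightarrow> v i \<noteq> v j"
  using v_in_C[of i] v_notin_C[of i j] by auto

lemma f_eq:
  assumes "i \<le> j" "j \<le> l" "\<And>m. i < m \<Longrightarrow> m \<le> j \<Longrightarrow> u \<noteq> v m"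
  shows "f j u = f i u"
  using assms
proof (induction j rule: dec_induct)
  case base
  show ?case by simp
next
  case (step m)
  obtain z where "f (Suc m) = (f m)(v (Suc m) := z)" using move[of m] step by auto
  then show ?case using step by auto
qed

lemma f_eq_C: "i < j \<Longrightarrow> j \<le> l \<Longrightarrow> u \<in> C i \<Longrightarrow> f j u = f i u"
  using f_eq[of i j u] v_notin_C[of i] by fastforce

lemma C_disjoint: "i < j \<Longrightarrow> j \<le> l \<Longrightarrow> K j \<inter> C i = {}"
  using fresh .

text \<open>Later bad components avoid \<open>C i\<close>, so no later move attaches a vertex to
  it.\<close>

lemma closed_C:
  assumes "Suc i \<le> j" "j \<le> l"
  shows "closed (f j) (C i)"
  using assms
proof (induction j rule: dec_induct)
  case base
  obtain z where z: "f (Suc i) = (f i)(v (Suc i) := z)" using move[of i] base by auto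
  show ?case unfolding closed_def
  proof (intro ballI impI)
    fix u w assume u: "u \<in> C i" and w: "w \<in> V" and g: "gadj (f (Suc i)) u w"
    have full: "full (f (Suc i))" "full (f i)" using fullf base by auto
    have "w \<noteq> v (Suc i)"
    proof
      assume "w = v (Suc i)"
      then have "u \<in> K (Suc i)"
        using bad_step[OF full(1) v_in_K[OF base] _ gadj_sym] g u bad_V by auto
      then show False using C_disjoint[of i "Suc i"] base u by auto
    qed
    then have "gadj (f i) u w" using g u gadj_upd unfolding z by auto
    then show "w \<in> C i" using bad_step[OF full(2), of u w] u w \<open>w \<noteq> v (Suc i)\<close> by auto
  qed
next
  case (step m)
  obtain z where z: "f (Suc m) = (f m)(v (Suc m) := z)" using move[of m] step by auto
  show ?case
  proof (rule closed_update[OF _ _ _ _ z])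
    show "full (f (Suc m))" using fullf step by auto
    show "closed (f m) (C i)" using step by auto
    show "C i \<subseteq> V" using bad_V by auto
    show "v (Suc m) \<notin> C i" using v_notin_C[of i "Suc m"] step by auto
    show "v (Suc m) \<in> K (Suc m)" using v_in_K step by auto
    show "K (Suc m) \<inter> C i = {}" using C_disjoint[of i "Suc m"] step by auto
  qed
qed

lemma linked_C:
  assumes "i < j" "j \<le> l"
  shows "linked (gadj (f j)) (C i)"
proof -
  have "linked (gadj (f i)) (C i)" using move[of i] assms by auto
  moreover have "gadj (f i) u w \<longleftrightarrow> gadj (f j) u w" if "u \<in> C i" "w \<in> C i" for u w
    using f_eq_C[OF assms] that by (intro gadj_cong) auto
  ultimately show ?thesis using linked_cong[of "C i" "gadj (f i)" "gadj (f j)"] by auto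
qed

lemma v_notin_Y: "j \<le> m \<Longrightarrow> m \<le> l \<Longrightarrow> v j \<notin> Y m"
  using C_disjoint[of j m] v_in_C[of j] by (cases "j = m") auto

lemma Y_disjoint: "j < m \<Longrightarrow> m \<le> l \<Longrightarrow> Y m \<inter> K j = {}"
  using C_disjoint[of j m] v_notin_Y[of "Suc j" m] by auto

lemma f_eq_Y: "i \<le> m \<Longrightarrow> m \<le> l \<Longrightarrow> u \<in> Y m \<Longrightarrow> f i u = f m u"
  using f_eq[of i m u] v_notin_Y[of _ m] by fastforce

text \<open>The moves are undone one by one. Undoing a move is itself a recolouring, and the bad
  component that it restores is disjoint from \<open>Y (Suc m)\<close>.\<close>

lemma closed_Y:
  assumes "i \<le> m" "Suc m \<le> l"
  shows "closed (f i) (Y (Suc m))"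
  using assms(1)
proof (induction i rule: inc_induct)
  case base
  obtain z where z: "f (Suc m) = (f m)(v (Suc m) := z)" using move[of m] assms by auto
  show ?case unfolding closed_def
  proof (intro ballI impI)
    fix u w assume u: "u \<in> Y (Suc m)" and w: "w \<in> V" and g: "gadj (f m) u w"
    have full: "full (f (Suc m))" "full (f m)" using fullf assms by auto
    have "w \<noteq> v (Suc m)"
    proof
      assume "w = v (Suc m)"
      then have "u \<in> K m"
        using bad_step[OF full(2) _ _ gadj_sym] v_next(1)[of m] g u bad_V assms by auto
      then show False using Y_disjoint[of m "Suc m"] assms u by auto
    qed
    then have "gadj (f (Suc m)) u w" using g u gadj_upd unfolding z by auto
    then show "w \<in> Y (Suc m)" using bad_step[OF full(1), of u w] u w \<open>w \<noteq> v (Suc m)\<close> by auto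
  qed
next
  case (step n)
  obtain z where "f (Suc n) = (f n)(v (Suc n) := z)" using move[of n] step assms by auto
  then have z: "f n = (f (Suc n))(v (Suc n) := f n (v (Suc n)))" by auto
  show ?case
  proof (rule closed_update[OF _ _ _ _ z])
    show "full (f n)" using fullf step assms by auto
    show "closed (f (Suc n)) (Y (Suc m))" using step by auto
    show "Y (Suc m) \<subseteq> V" using bad_V by auto
    show "v (Suc n) \<notin> Y (Suc m)" using v_notin_Y[of "Suc n" "Suc m"] step assms by auto
    show "v (Suc n) \<in> K n" using v_next step assms by auto
    show "K n \<inter> Y (Suc m) = {}" using Y_disjoint[of n "Suc m"] step assms by auto
  qed
qed

lemma closed_Y': "i < m \<Longrightarrow> m \<le> l \<Longrightarrow> closed (f i) (Y m)"
  using closed_Y[of i "m - 1"] by (cases m) auto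

lemma linked_Y:
  assumes "0 < m" "m \<le> l"
  shows "linked (gadj (f m)) (Y m)"
proof -
  obtain n where n: "m = Suc n" using assms by (cases m) auto
  then obtain z where z: "z \<in> X (v m)" "f m = (f n)(v m := z)"
    and mv: "v m \<in> K n" "linked (gadj (f n)) (K n - {v m})"
    using move[of n] assms by auto
  show ?thesis using mini_move(2)[OF min mv z(1)] assms n z(2) by auto
qed

text \<open>What a return of \<open>w\<close> to \<open>C i\<close> leaves behind in the digraph.
  Adjacency to \<open>v (Suc i)\<close> is claimed for \<open>2 \<le> r\<close>, where twin colours
  are known to be joined.\<close>

definition target :: "'v \<Rightarrow> nat \<Rightarrow> bool" where
  "target w i \<longleftrightarrow> i < l \<and> complete (f i) (K i) \<and> (\<forall>u\<in>C i. dig u w) \<and>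
     (2 \<le> r \<longrightarrow> dig (v (Suc i)) w)"

text \<open>The chain being exhausted, the new component of \<open>w\<close> meets some
  \<open>C i\<close> and is therefore \<open>w\<close> together with \<open>C i\<close>. But
  \<open>K i\<close> was \<open>v (Suc i)\<close> together with the same \<open>C i\<close>: twins
  appear, and \<open>K i\<close> is complete.\<close>

lemma return:
  assumes w: "w \<in> K l" "w \<noteq> v l" "linked (gadj (f l)) (K l - {w})"
    and z: "z \<in> X w" "z \<noteq> f l w"
  obtains i where "target w i" "bad ((f l)(w := z)) = insert w (C i)"
proof -
  let ?\<psi> = "(f l)(w := z)"
  obtain i where i: "i < l" "bad ?\<psi> \<inter> C i \<noteq> {}"
    using stuck[OF w z] by auto
  let ?a = "v (Suc i)"
  have wC: "w \<notin> C i" using C_disjoint[of i l] i w by auto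
  have wV: "w \<in> V" using w bad_V by auto
  have CV: "C i \<subseteq> V" using bad_V by auto
  have ne: "C i \<inter> bad ?\<psi> \<noteq> {}" using i by auto
  have cC: "closed (f l) (C i)" using closed_C[of i l] i by auto
  have B: "bad ?\<psi> = insert w (C i)"
    by (rule bad_eq_move[OF min[OF order_refl] w(1,3) z(1) CV wC linked_C[OF i(1) order_refl] cC ne])
  have aK: "?a \<in> K i" "?a \<in> V" using v_next[of i] i bad_V by auto
  \<comment> \<open>The exclusion of the entry \<open>v l\<close> matters exactly when
    \<open>Suc i = l\<close>.\<close>
  have wa: "w \<noteq> ?a"
  proof (cases "Suc i = l")
    case False
    then show ?thesis using v_in_C[of "Suc i"] C_disjoint[of "Suc i" l] i w by auto
  qed (use w in auto)
  have wK: "w \<notin> K i" using wC wa by auto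
  have ful: "full (f i)" "full ?\<psi>" using fullf i full_upd[OF fullf z(1)] by auto
  have tw: "twins (f i) (C i) (f i ?a) (?\<psi> w)"
  proof (rule twins_of_bad[OF ful _ B])
    show "K i = insert ?a (C i)" using aK by auto
    show "?\<psi> u = f i u" if "u \<in> C i" for u
      using f_eq_C[of i l u] i that wC by auto
  qed (use wC in auto)
  then have tw': "twins (f i) (K i - {?a}) (f i ?a) z" by simp
  have cmp: "complete (f i) (K i)"
    and dig: "2 \<le> r \<Longrightarrow> (z, f i ?a) \<in> E \<and> (f i ?a, z) \<in> E"
    using twin_complete[OF ful(1) aK(1) wV wK z(1) tw'] by auto
  have dC: "dig u w" if u: "u \<in> C i" for u
  proof -
    have uK: "u \<in> K i" "u \<noteq> ?a" "u \<in> V" using u bad_V by auto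
    have "(f i u, z) \<in> E" "(z, f i u) \<in> E"
      using twinsD[OF tw' u] completeD[OF cmp] uK aK by auto
    then show ?thesis
      using E_arc[of u w "f i u" z] E_arc[of w u z "f i u"] uK wV z(1) full_in[OF ful(1)] by auto
  qed
  have "dig ?a w" if "2 \<le> r"
    using dig[OF that] E_arc[of ?a w "f i ?a" z] E_arc[of w ?a z "f i ?a"] aK(2) wV z(1)
      full_in[OF ful(1)] by auto
  then have "target w i" unfolding target_def using i(1) cmp dC by auto
  then show thesis using B by (rule that)
qed

text \<open>The chain can be run backwards from its end: \<open>turned i m\<close> says that some colouring has the bad
  component \<open>Y m\<close> entered from elsewhere, while the components between \<open>i\<close> and \<open>m\<close> are untouched.\<close>

definition turned :: "nat \<Rightarrow> nat \<Rightarrow> bool" where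
  "turned i m \<longleftrightarrow> (\<exists>\<psi> x. mini \<psi> \<and> x \<notin> K m \<and> bad \<psi> = insert x (Y m) \<and>
     (\<forall>n. i < n \<and> n \<le> m \<longrightarrow> (\<forall>u\<in>Y n. \<psi> u = f n u)) \<and>
     (\<forall>n. i < n \<and> n < m \<longrightarrow> closed \<psi> (Y n)))"

text \<open>A \<open>jump\<close> of \<open>x\<close> to \<open>g\<close> makes \<open>x\<close> a
  new entry of \<open>Y m\<close>. The sets \<open>Y n\<close> in between stay closed because the
  new bad component is disjoint from them.\<close>

lemma turn:
  assumes m: "i < m" "m \<le> l" and psi: "mini \<psi>" "x \<in> bad \<psi>" "linked (gadj \<psi>) (bad \<psi> - {x})"
    and g: "g \<in> Y m" "g \<notin> bad \<psi>" "adj x g" and x: "x \<notin> K m" "\<And>n. i < n \<Longrightarrow> n \<le> m \<Longrightarrow> x \<notin> Y n"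
    and eq: "\<And>n u. i < n \<Longrightarrow> n \<le> m \<Longrightarrow> u \<in> Y n \<Longrightarrow> \<psi> u = f n u"
    and cl: "\<And>n. i < n \<Longrightarrow> n \<le> m \<Longrightarrow> closed \<psi> (Y n)"
  shows "turned i m"
proof -
  have YV: "Y n \<subseteq> V" for n using bad_V by auto
  have "gadj (f m) u w \<longleftrightarrow> gadj \<psi> u w" if "u \<in> Y m" "w \<in> Y m" for u w
    using eq[of m] that m by (intro gadj_cong) auto
  then have lY: "linked (gadj \<psi>) (Y m)"
    using linked_Y[of m] m linked_cong[of "Y m" "gadj (f m)" "gadj \<psi>"] by auto
  obtain z where z: "z \<in> X x" "mini (\<psi>(x := z))" "bad (\<psi>(x := z)) = insert x (Y m)"
    using jump[OF psi YV x(2)[OF m(1) order_refl] lY cl[OF m(1) order_refl] g] by metis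
  have "closed (\<psi>(x := z)) (Y n)" if n: "i < n" "n < m" for n
  proof (rule closed_update[OF mini_full[OF z(2)] cl YV _ refl])
    show "i < n" "n \<le> m" "x \<notin> Y n" using n x by auto
    show "x \<in> bad (\<psi>(x := z))" using z(3) by auto
    show "bad (\<psi>(x := z)) \<inter> Y n = {}"
      unfolding z(3) using Y_disjoint[of n m] n m \<open>x \<notin> Y n\<close> by auto
  qed
  moreover have "(\<psi>(x := z)) u = f n u" if "i < n" "n \<le> m" "u \<in> Y n" for n u
    using eq[OF that] x(2)[OF that(1,2)] that(3) by auto
  ultimately show ?thesis unfolding turned_def using z x(1) by blast
qed

text \<open>\<open>Y m\<close> is extended to a bad component both by \<open>v m\<close> and by a
  vertex outside \<open>K m\<close>, whose colours are therefore twins.\<close>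

lemma turned_complete:
  assumes "turned i m" "i < m" "m \<le> l"
  shows "complete (f m) (K m)"
proof -
  obtain \<psi> x where psi: "mini \<psi>" "x \<notin> K m" "bad \<psi> = insert x (Y m)"
    and eq: "\<And>u. u \<in> Y m \<Longrightarrow> \<psi> u = f m u"
    using assms(1,2) unfolding turned_def by blast
  have vK: "v m \<in> K m" using v_in_K assms by auto
  have Km: "K m = insert (v m) (Y m)" using vK by auto
  have xV: "x \<in> V" using psi(3) bad_V by auto
  have "twins (f m) (Y m) (f m (v m)) (\<psi> x)"
    by (rule twins_of_bad[OF fullf[OF assms(3)] mini_full[OF psi(1)] Km psi(3)]) (use psi(2) eq in auto)
  then show ?thesis
    using twin_complete(1)[OF fullf[OF assms(3)] vK xV psi(2)] full_in[OF mini_full[OF psi(1)] xV] by auto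
qed

text \<open>Descent on \<open>m\<close>. From the colouring \<open>f i\<close>, the vertex
  \<open>c\<close> is moved to meet \<open>w\<close>, which enters \<open>Y l\<close> from outside.
  Once component \<open>Suc m\<close> is known to be complete, any \<open>p\<close> in
  \<open>Y (Suc m)\<close> is adjacent to \<open>v (Suc m)\<close>; the latter still has its old
  colour and belongs to \<open>Y m\<close>, so moving \<open>p\<close> enters
  \<open>Y m\<close>.\<close>

lemma turned_all:
  assumes i: "i < l" "complete (f i) (K i)"
    and w: "w \<in> Y l" "c \<in> C i" "adj c w"
    and m: "i < m" "m \<le> l"
  shows "turned i m"
proof -
  have "m \<ge> Suc i" using m by auto
  then show ?thesis
    using m(2)
  proof (induction "l - m" arbitrary: m)
    case 0
    then have ml: "m = l" by auto
    have cK: "c \<in> K i" using w by auto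
    have "turned i l"
    proof (rule turn[OF i(1) order_refl min[of i] cK _ w(1)])
      show "i \<le> l" using i by auto
      show "linked (gadj (f i)) (K i - {c})"
        by (rule linked_clique) (use completeD[OF i(2)] in \<open>auto simp: gadj_def\<close>)
      show "w \<notin> K i" using Y_disjoint[of i l] i w by auto
      show "adj c w" by fact
      show "c \<notin> K l" using C_disjoint[of i l] i w by auto
      show "c \<notin> Y n" if "i < n" "n \<le> l" for n using Y_disjoint[of i n] that cK by auto
      show "f i u = f n u" if "i < n" "n \<le> l" "u \<in> Y n" for n u using f_eq_Y[of i n u] that by auto
      show "closed (f i) (Y n)" if "i < n" "n \<le> l" for n using closed_Y'[of i n] that by auto
    qed
    then show ?case using ml by simp
  next
    case (Suc d)
    then have ml: "m < l" "d = l - Suc m" "Suc i \<le> Suc m" "Suc m \<le> l" by auto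
    then have t: "turned i (Suc m)" using Suc.hyps(1) by auto
    have cmp: "complete (f (Suc m)) (K (Suc m))" using turned_complete[OF t] Suc.prems ml by auto
    obtain \<psi> x where psi: "mini \<psi>" "x \<notin> K (Suc m)" "bad \<psi> = insert x (Y (Suc m))"
      and eq: "\<And>n u. i < n \<Longrightarrow> n \<le> Suc m \<Longrightarrow> u \<in> Y n \<Longrightarrow> \<psi> u = f n u"
      and cl: "\<And>n. i < n \<Longrightarrow> n < Suc m \<Longrightarrow> closed \<psi> (Y n)"
      using t unfolding turned_def by blast
    have vK: "v (Suc m) \<in> K (Suc m)" using v_in_K ml by auto
    have Km: "K (Suc m) = insert (v (Suc m)) (Y (Suc m))" using vK by auto
    have "card (K (Suc m)) = Suc r" using cmp by (simp add: complete_def)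
    then have "Y (Suc m) \<noteq> {}" using Km p_pos by (metis card_1_singleton_iff not_one_le_zero old.nat.inject One_nat_def)
    then obtain p where p: "p \<in> Y (Suc m)" by auto
    have eqm: "\<And>u. u \<in> Y (Suc m) \<Longrightarrow> \<psi> u = f (Suc m) u" using eq[of "Suc m"] Suc.prems by auto
    have tw: "twins (f (Suc m)) (Y (Suc m)) (f (Suc m) (v (Suc m))) (\<psi> x)"
      by (rule twins_of_bad[OF fullf[OF ml(4)] mini_full[OF psi(1)] Km psi(3)]) (use psi(2) eqm in auto)
    have xy: "gadj \<psi> x u" "gadj \<psi> u x" if u: "u \<in> Y (Suc m)" for u
      using twinsD[OF tw u] completeD[OF cmp _ vK, of u] u eqm[OF u] by (auto simp: gadj_def)
    have yy: "gadj \<psi> u u'" if "u \<in> Y (Suc m)" "u' \<in> Y (Suc m)" "u \<noteq> u'" for u u'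
      using completeD[OF cmp, of u u'] that eqm by (auto simp: gadj_def)
    have pK: "p \<in> K (Suc m)" "p \<noteq> v (Suc m)" "p \<in> V" using p bad_V by auto
    show "turned i m"
    proof (rule turn[OF _ _ psi(1)])
      show "i < m" "m \<le> l" using Suc.prems ml by auto
      show "p \<in> bad \<psi>" using p psi(3) by auto
      show "linked (gadj \<psi>) (bad \<psi> - {p})"
        unfolding psi(3) by (rule linked_clique) (use xy yy in auto)
      show "v (Suc m) \<in> Y m" using v_next[of m] ml by auto
      show "v (Suc m) \<notin> bad \<psi>" using psi(2,3) vK by auto
      show "adj p (v (Suc m))"
        using completeD[OF cmp pK(1) vK pK(2)] E_arc[OF pK(3) bad_V[OF vK]]
          full_in[OF fullf[OF ml(4)]] pK bad_V[OF vK] by blast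
      show "p \<notin> K m" using Y_disjoint[of m "Suc m"] ml p by auto
      show "p \<notin> Y n" if "i < n" "n \<le> m" for n using Y_disjoint[of n "Suc m"] that ml p by auto
      show "\<psi> u = f n u" if "i < n" "n \<le> m" "u \<in> Y n" for n u using eq that by auto
      show "closed \<psi> (Y n)" if "i < n" "n \<le> m" for n using cl that by auto
    qed
  qed
qed

end

section \<open>Vertices with a common closed neighbourhood\<close>

text \<open>\<open>L\<close> stands for \<open>Y l\<close> at the end of an exhausted chain, and
  \<open>M\<close> for the common closed neighbourhood of its vertices.\<close>

locale hub_cover = regular_hard_cover V A X E k r
  for V :: "'v set" and A and X :: "'v \<Rightarrow> 'c set" and E and k r :: nat +
  fixes L M :: "'v set"
  assumes r_ge2: "2 \<le> r" and LM: "L \<subseteq> M" and MV: "M \<subseteq> V" and cardL: "card L = r"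
    and hub_out: "y \<in> L \<Longrightarrow> (y, u) \<in> A \<longleftrightarrow> u \<in> M \<and> u \<noteq> y"
    and hub_in: "y \<in> L \<Longrightarrow> (u, y) \<in> A \<longleftrightarrow> u \<in> M \<and> u \<noteq> y"
begin

lemma hub_dual: "hub_cover V (A\<inverse>) X (E\<inverse>) k r L M"
  using rdual r_ge2 LM MV cardL hub_out hub_in
  by (simp add: hub_cover_def hub_cover_axioms_def)

lemma finL: "finite L"
  using finite_sub LM MV by blast

text \<open>Two colourings differing at \<open>w\<close> only are extended in parallel. As
  \<open>x\<close> does not see \<open>w\<close>, regularity at \<open>x\<close> forces the same
  colour of \<open>y\<close> in both; then regularity at \<open>y\<close> makes one colour of
  \<open>y\<close> meet both \<open>w1\<close> and \<open>w2\<close>.\<close>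

lemma two_choices:
  assumes x: "x \<in> M - L" and w: "w \<in> M - L" and xw: "x \<noteq> w" "(x, w) \<notin> A"
    and w1: "w1 \<in> X w" and w2: "w2 \<in> X w"
    and g1: "good (\<phi>(w := w1)) (V - insert x L)" and g2: "good (\<phi>(w := w2)) (V - insert x L)"
  shows "w1 = w2"
proof -
  have xV: "x \<in> V" and wV: "w \<in> V" using x w MV by auto
  obtain y where y: "y \<in> L" using cardL r_ge2 by (metis card.empty not_numeral_le_zero ex_in_conv)
  have yV: "y \<in> V" "y \<in> M" using y LM MV by auto
  have yxw: "y \<noteq> x" "y \<noteq> w" using y x w by auto
  have arcs: "(y, x) \<in> A" "(y, w) \<in> A" "(x, y) \<in> A" using hub_out[OF y] hub_in[OF y] x w yxw by auto
  have "\<exists>\<psi>. good (\<psi>(w := w1)) ((V - insert x L) \<union> J) \<and> good (\<psi>(w := w2)) ((V - insert x L) \<union> J)"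
    if "finite J" "J \<subseteq> L - {y}" for J
    using that
  proof (induction J rule: finite_induct)
    case empty
    show ?case using g1 g2 by (intro exI[of _ \<phi>] conjI) (simp_all only: Un_empty_right)
  next
    case (insert u J)
    let ?T = "(V - insert x L) \<union> J"
    have "J \<subseteq> L - {y}" using insert.prems by auto
    from insert.IH[OF this]
    obtain \<psi> where psi: "good (\<psi>(w := w1)) ?T" "good (\<psi>(w := w2)) ?T"
      by (elim exE conjE)
    have u: "u \<in> L" "u \<noteq> y" "u \<notin> J" "u \<in> V" "u \<in> M" using insert LM MV by auto
    have uxw: "u \<noteq> x" "u \<noteq> w" "w \<notin> J" "x \<notin> J" "y \<notin> J" using u x w insert by auto
    have TV: "?T \<subseteq> V" "u \<notin> ?T" "w \<in> ?T" using insert LM MV u w wV xw by auto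
    let ?S = "?T - {w}"
    have SV: "?S \<subseteq> V" using TV by auto
    have Tins: "?T = insert w ?S" using TV by auto
    have fS: "finite ?S" by (rule finite_sub[OF SV])
    have colS: "col \<psi> ?S" unfolding col_def
    proof
      fix a assume a: "a \<in> ?S"
      then have "(\<psi>(w := w1)) a \<in> X a" using psi(1) unfolding good_def col_def by blast
      then show "\<psi> a \<in> X a" using a by auto
    qed
    \<comment> \<open>Three of the \<open>k * r\<close> out-neighbours of \<open>u\<close> are
      missing in \<open>?S\<close>: \<open>x\<close> and \<open>y\<close> are uncoloured,
      \<open>w\<close> is set aside. Allowing for both candidates at \<open>w\<close> adds at most
      2, so the total stays below \<open>k * r\<close> and one colour \<open>c\<close> suits both
      colourings.\<close>
    have sub: "{v \<in> ?S. (u, v) \<in> A} \<subseteq> {v \<in> V. (u, v) \<in> A} - {x, w, y}" using SV y uxw by auto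
    have "{x, w, y} \<subseteq> {v \<in> V. (u, v) \<in> A}"
      using hub_out[OF u(1)] x w y yV u(2) uxw xV wV by auto
    then have "card ({v \<in> V. (u, v) \<in> A} - {x, w, y}) = k * r - card {x, w, y}"
      using regular(1)[OF u(4)] by (simp add: card_Diff_subset)
    moreover have "card {x, w, y} = 3" using xw yxw by auto
    moreover have "card {v \<in> ?S. (u, v) \<in> A} \<le> card ({v \<in> V. (u, v) \<in> A} - {x, w, y})"
      using sub finV by (intro card_mono) auto
    ultimately have "card {v \<in> ?S. (u, v) \<in> A} \<le> k * r - 3" by simp
    then have s1: "(\<Sum>c\<in>X u. card (out \<psi> c ?S)) \<le> k * r - 3"
      using sum_out_le[OF u(4) SV colS] by linarith
    have kr: "4 \<le> k * r" using mult_le_mono[OF k_ge2 r_ge2] by simp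
    have one: "(\<Sum>c\<in>X u. if (c, w') \<in> E then 1 else 0) \<le> (1::nat)" if "w' \<in> X w" for w'
    proof -
      have "(\<Sum>c\<in>X u. if (c, w') \<in> E then 1 else 0) = card {c \<in> X u. (c, w') \<in> E}"
        using finX[OF u(4)] by (simp add: sum.If_cases Int_def)
      also have "\<dots> \<le> 1"
        using E_in[OF u(4) wV _ _ that] finX[OF u(4)] by (subst One_nat_def, subst card_le_Suc0_iff_eq) auto
      finally show ?thesis .
    qed
    have "\<exists>c\<in>X u. card (out \<psi> c ?S) + (if (c, w1) \<in> E then 1 else 0) + (if (c, w2) \<in> E then 1 else 0) < r"
    proof (rule ccontr)
      assume "\<not> ?thesis"
      then have "(\<Sum>c\<in>X u. r) \<le> (\<Sum>c\<in>X u. card (out \<psi> c ?S) + (if (c, w1) \<in> E then 1 else 0) + (if (c, w2) \<in> E then 1 else 0))"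
        by (intro sum_mono) auto
      also have "\<dots> \<le> (k * r - 3) + 1 + 1"
        unfolding sum.distrib using s1 one[OF w1] one[OF w2] by linarith
      finally show False using regular(3)[OF u(4)] kr by simp
    qed
    then obtain c where c: "c \<in> X u"
      "card (out \<psi> c ?S) + (if (c, w1) \<in> E then 1 else 0) + (if (c, w2) \<in> E then 1 else 0) < r" by blast
    have ext: "good (\<psi>(u := c, w := w')) (insert u ?T)" if "good (\<psi>(w := w')) ?T" "w' = w1 \<or> w' = w2" for w'
    proof -
      have "card (out (\<psi>(w := w')) c ?T) = card (out \<psi> c ?S) + (if (c, w') \<in> E then 1 else 0)"
        by (subst Tins, subst card_nbs_insert[OF fS]) (auto simp: nbs_remove)
      then have "card (out (\<psi>(w := w')) c ?T) < r" using c(2) that(2) by auto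
      then have "good (\<psi>(w := w', u := c)) (insert u ?T)"
        using good_extend[OF that(1) TV(1) u(4) TV(2) c(1)] by auto
      then show ?thesis using uxw(2) by (simp add: fun_upd_twist)
    qed
    have "(V - insert x L) \<union> insert u J = insert u ?T" by auto
    then show ?case using ext psi by metis
  qed
  then obtain \<psi> where psi: "good (\<psi>(w := w1)) ((V - insert x L) \<union> (L - {y}))"
      "good (\<psi>(w := w2)) ((V - insert x L) \<union> (L - {y}))"
    using finL by (metis finite_Diff order_refl)
  have V2: "(V - insert x L) \<union> (L - {y}) = V - {x, y}" using y x LM MV by auto
  let ?S = "V - {x, y, w}"
  have fS: "finite ?S" using finV by auto
  have same: "nbs E' (\<psi>(w := a, y := b)) c ?S = nbs E' \<psi> c ?S"
    "nbs E' (\<psi>(w := a, y := b, x := d)) c ?S = nbs E' \<psi> c ?S" for E' a b c d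
    by (intro nbs_cong; auto)+
  have ycol: "\<exists>b\<in>X y. good (\<psi>(w := w', y := b)) (V - {x})" if g: "good (\<psi>(w := w')) (V - {x, y})" for w'
  proof -
    have "{u \<in> V - {x, y}. (y, u) \<in> A} \<subset> {u \<in> V. (y, u) \<in> A}" using arcs xV by auto
    then have "card {u \<in> V - {x, y}. (y, u) \<in> A} < card {u \<in> V. (y, u) \<in> A}"
      using finV by (intro psubset_card_mono) auto
    then have "card {u \<in> V - {x, y}. (y, u) \<in> A} < k * r" using regular(1)[OF yV(1)] by simp
    then obtain b where b: "b \<in> X y" "card (out (\<psi>(w := w')) b (V - {x, y})) < r"
      using colour_out[OF yV(1), of "V - {x, y}" "\<psi>(w := w')"] g by (auto simp: good_def)
    have "good (\<psi>(w := w', y := b)) (insert y (V - {x, y}))"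
      by (rule good_extend[OF g _ yV(1) _ b(1)]) (use b in auto)
    moreover have "insert y (V - {x, y}) = V - {x}" using yV yxw by auto
    ultimately show ?thesis using b by auto
  qed
  obtain b1 where b1: "b1 \<in> X y" "good (\<psi>(w := w1, y := b1)) (V - {x})" using ycol psi(1) V2 by auto
  obtain b2 where b2: "b2 \<in> X y" "good (\<psi>(w := w2, y := b2)) (V - {x})" using ycol psi(2) V2 by auto
  \<comment> \<open>Since \<open>(x, w)\<close> is no arc, the colour of \<open>w\<close> drops out
    of the degree of \<open>c\<close>.\<close>
  have degx: "r = card (out \<psi> c ?S) + (if (c, b) \<in> E then 1 else 0)"
    if g: "good (\<psi>(w := w', y := b)) (V - {x})" and c: "c \<in> X x" and w': "w' \<in> X w" for w' b c
  proof -
    have ins: "V - {x} = insert y (insert w ?S)" using yV wV xw yxw by auto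
    have "(c, w') \<notin> E" using E_arc[OF xV wV c w'] xw by auto
    then have "card (out (\<psi>(w := w', y := b)) c (V - {x})) = card (out \<psi> c ?S) + (if (c, b) \<in> E then 1 else 0)"
      unfolding ins using fS yxw
      by (subst card_nbs_insert, simp, simp, subst card_nbs_insert) (auto simp: same)
    then show ?thesis using hole_out(3)[OF g xV c] by simp
  qed
  obtain c where c: "c \<in> X x" "(c, b1) \<in> E"
    using hole_out(4)[OF b1(2) xV arcs(3)] by auto
  have cb2: "(c, b2) \<in> E" using degx[OF b1(2) c(1) w1] degx[OF b2(2) c(1) w2] c(2) by (auto split: if_splits)
  then have bb: "b2 = b1" using E_out[OF xV yV(1) c(1) b1(1) b2(1) c(2)] by simp
  \<comment> \<open>The hole moves from \<open>x\<close> to \<open>y\<close>: giving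
    \<open>x\<close> the colour \<open>c\<close>, which meets \<open>b1\<close>, places
    \<open>y\<close> in the bad component for either colour of \<open>w\<close>.\<close>
  let ?\<chi> = "\<lambda>w'. \<psi>(w := w', y := b1, x := c)"
  have ybad: "y \<in> bad (?\<chi> w')" if w': "w' \<in> X w" and g: "good (\<psi>(w := w', y := b1)) (V - {x})" for w'
  proof -
    have full: "full (?\<chi> w')" using g c(1) unfolding good_def col_def by auto
    have "good (?\<chi> w') (V - {x}) \<longleftrightarrow> good (\<psi>(w := w', y := b1)) (V - {x})" by (rule good_cong) auto
    then have "x \<in> bad (?\<chi> w')" using g xV by (auto simp: bad_def)
    moreover have "gadj (?\<chi> w') x y" using c(2) yxw by (auto simp: gadj_def)
    ultimately show ?thesis using bad_step[OF full] yV by auto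
  qed
  have y1: "y \<in> bad (?\<chi> w1)" and y2: "y \<in> bad (?\<chi> w2)" using ybad w1 w2 b1 b2 bb by auto
  have degy: "r = card (out \<psi> d ?S) + (if (d, w') \<in> E then 1 else 0) + (if (d, c) \<in> E then 1 else 0)"
    if "y \<in> bad (?\<chi> w')" "d \<in> X y" for w' d
  proof -
    have ins: "V - {y} = insert x (insert w ?S)" using xV wV xw yxw by auto
    have "card (out (?\<chi> w') d (V - {y})) = card (out \<psi> d ?S) + (if (d, w') \<in> E then 1 else 0) + (if (d, c) \<in> E then 1 else 0)"
      unfolding ins using fS yxw xw
      by (subst card_nbs_insert, simp, simp, subst card_nbs_insert) (auto simp: same)
    then show ?thesis using bad_hole(1)[OF that] by simp
  qed
  have "?\<chi> w1 w = w1" using xw yxw by auto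
  then obtain d where d: "d \<in> X y" "(d, w1) \<in> E"
    using bad_meets(1)[OF y1 arcs(2)] by auto
  then have "(d, w2) \<in> E" using degy[OF y1 d(1)] degy[OF y2 d(1)] by (auto split: if_splits)
  then show "w1 = w2" using E_out[OF yV(1) wV d(1) w1 w2 d(2)] by auto
qed

text \<open>As \<open>w\<close> sees the \<open>r\<close> uncoloured vertices of \<open>L\<close>, having just one admissible colour forces
  the coloured neighbours of \<open>w\<close> into the other \<open>k - 1\<close> colours.\<close>

lemma saturated:
  assumes w: "w \<in> M - L" and x: "x \<in> V" "x \<noteq> w"
    and g: "good \<phi> (V - insert w (insert x L))"
    and uniq: "\<And>w1 w2. w1 \<in> X w \<Longrightarrow> w2 \<in> X w \<Longrightarrow> good (\<phi>(w := w1)) (V - insert x L) \<Longrightarrow>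
      good (\<phi>(w := w2)) (V - insert x L) \<Longrightarrow> w1 = w2"
    and c: "c \<in> X w"
  shows "card (out \<phi> c (V - insert w (insert x L))) \<in> {0, r}"
proof -
  let ?Z = "V - insert w (insert x L)"
  have wV: "w \<in> V" using w MV by auto
  have ins: "insert w ?Z = V - insert x L" using w x wV by auto
  define al where "al = {c \<in> X w. card (out \<phi> c ?Z) < r \<or> card (inn \<phi> c ?Z) < r}"
  have al_uniq: "c1 = c2" if "c1 \<in> al" "c2 \<in> al" for c1 c2
  proof -
    have "good (\<phi>(w := d)) (V - insert x L)" if "d \<in> al" for d
      using good_extend[OF g _ wV, of d] that unfolding ins al_def by auto
    then show ?thesis using uniq[of c1 c2] that by (auto simp: al_def)
  qed
  have colZ: "col \<phi> ?Z" using g by (simp add: good_def)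
  have "{u \<in> ?Z. (w, u) \<in> A} \<subseteq> {u \<in> V. (w, u) \<in> A} - L" by auto
  then have "card {u \<in> ?Z. (w, u) \<in> A} \<le> card ({u \<in> V. (w, u) \<in> A} - L)"
    using finV by (intro card_mono) auto
  also have "\<dots> = k * r - r"
  proof -
    have "L \<subseteq> {u \<in> V. (w, u) \<in> A}" using hub_in w LM MV by auto
    then show ?thesis using regular(1)[OF wV] cardL finL by (simp add: card_Diff_subset)
  qed
  finally have sle: "(\<Sum>c\<in>X w. card (out \<phi> c ?Z)) \<le> k * r - r"
    using sum_out_le[OF wV _ colZ] by auto
  have fX: "finite (X w)" and cX: "card (X w) = k" using finX regular(3) wV by auto
  have r0: "r < k * r" using k_ge2 r_ge2 by simp
  have "al \<noteq> {}"
  proof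
    assume "al = {}"
    then have "(\<Sum>c\<in>X w. r) \<le> (\<Sum>c\<in>X w. card (out \<phi> c ?Z))"
      by (intro sum_mono) (auto simp: al_def)
    then show False using sle cX r0 r_ge2 by simp
  qed
  then obtain d where d: "d \<in> al" by auto
  have dX: "d \<in> X w" using d by (auto simp: al_def)
  let ?R = "X w - {d}"
  have split: "(\<Sum>c\<in>X w. card (out \<phi> c ?Z)) = card (out \<phi> d ?Z) + (\<Sum>c\<in>?R. card (out \<phi> c ?Z))"
    using sum.remove[OF fX dX] by simp
  have ge: "r \<le> card (out \<phi> c ?Z)" if "c \<in> ?R" for c
  proof (rule ccontr)
    assume "\<not> ?thesis"
    then have "c \<in> al" using that by (auto simp: al_def)
    then show False using al_uniq[OF d] that by auto
  qed
  have cR: "(\<Sum>c\<in>?R. r) = k * r - r" using cX dX fX by (simp add: card_Diff_singleton diff_mult_distrib)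
  have "(\<Sum>c\<in>?R. r) \<le> (\<Sum>c\<in>?R. card (out \<phi> c ?Z))" using ge by (intro sum_mono)
  then have d0: "card (out \<phi> d ?Z) = 0" and eq: "(\<Sum>c\<in>?R. r) = (\<Sum>c\<in>?R. card (out \<phi> c ?Z))"
    using sle split cR by linarith+
  show ?thesis
  proof (cases "c = d")
    case False
    then have "r = card (out \<phi> c ?Z)"
      using sum_mono_inv[OF eq ge _] c fX by auto
    then show ?thesis by simp
  qed (use d0 in simp)
qed

text \<open>The vertex \<open>s\<close> has two admissible colours, and some colour \<open>c\<close>
  of \<open>w\<close> meets the first and hence not the second. By \<open>saturated\<close> the
  out-degree of \<open>c\<close> is 0 or \<open>r\<close> in both cases; but the two values differ
  by 1, and \<open>r\<close> is at least 2.\<close>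

lemma no_second_choice:
  assumes w: "w \<in> M - L" and x: "x \<in> M - L" and s: "s \<in> M - L" and ne: "x \<noteq> w" "s \<noteq> w" "s \<noteq> x"
    and ws: "(w, s) \<in> A"
    and uniq: "\<And>\<phi> w1 w2. w1 \<in> X w \<Longrightarrow> w2 \<in> X w \<Longrightarrow> good (\<phi>(w := w1)) (V - insert x L) \<Longrightarrow>
      good (\<phi>(w := w2)) (V - insert x L) \<Longrightarrow> w1 = w2"
  shows False
proof -
  let ?Z = "V - insert w (insert x L)"
  let ?S = "?Z - {s}"
  have V: "w \<in> V" "x \<in> V" "s \<in> V" using w x s MV by auto
  have Zins: "?Z = insert s ?S" using V ne s by auto
  have e: "good \<phi> (V - V)" for \<phi> by (simp add: good_empty)
  let ?W = "insert s (insert w (insert x L))"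
  have WV: "?W \<subseteq> V" using V LM MV by auto
  obtain \<phi> where g0: "good \<phi> (V - ?W)"
    by (rule linked_greedy[OF subset_refl conn WV _ e]) auto
  have S: "V - ?W = ?S" by auto
  have g: "good \<phi> ?S" using g0 S by simp
  have SV: "?S \<subseteq> V" by auto
  have colS: "col \<phi> ?S" using g by (simp add: good_def)
  have fX: "finite (X s)" and cX: "card (X s) = k" using finX regular(3) V by auto
  \<comment> \<open>\<open>w\<close> and the \<open>r\<close> vertices of \<open>L\<close> are
    uncoloured in-neighbours of \<open>s\<close>. Blocking all colours but one takes
    \<open>(k - 1) * r\<close> coloured in-neighbours, one more than can be present.\<close>
  have "{u \<in> ?S. (u, s) \<in> A} \<subseteq> {u \<in> V. (u, s) \<in> A} - insert w L" by auto
  then have "card {u \<in> ?S. (u, s) \<in> A} \<le> card ({u \<in> V. (u, s) \<in> A} - insert w L)"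
    using finV by (intro card_mono) auto
  also have "\<dots> = k * r - Suc r"
  proof -
    have "insert w L \<subseteq> {u \<in> V. (u, s) \<in> A}" using hub_out s LM MV ws V by auto
    then show ?thesis using regular(2)[OF V(3)] cardL finL w by (simp add: card_Diff_subset)
  qed
  finally have sle: "(\<Sum>c\<in>X s. card (inn \<phi> c ?S)) \<le> k * r - Suc r"
    using sum_inn_le[OF V(3) SV colS] by linarith
  have "2 * r \<le> k * r" using k_ge2 by simp
  then have r0: "Suc r < k * r" using r_ge2 by linarith
  have "\<exists>s1\<in>X s. \<exists>s2\<in>X s. s1 \<noteq> s2 \<and> card (inn \<phi> s1 ?S) < r \<and> card (inn \<phi> s2 ?S) < r"
  proof (rule ccontr)
    assume no: "\<not> ?thesis"
    obtain d where d: "d \<in> X s" "\<And>c. c \<in> X s - {d} \<Longrightarrow> r \<le> card (inn \<phi> c ?S)"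
    proof (cases "\<exists>d\<in>X s. card (inn \<phi> d ?S) < r")
      case True
      then show thesis using that no by (metis DiffE not_less singletonI)
    next
      case False
      moreover have "X s \<noteq> {}" using cX k_ge2 by auto
      ultimately show thesis using that by (metis DiffE ex_in_conv not_less)
    qed
    have "(\<Sum>c\<in>X s - {d}. r) \<le> (\<Sum>c\<in>X s - {d}. card (inn \<phi> c ?S))"
      using d(2) by (intro sum_mono)
    also have "\<dots> \<le> (\<Sum>c\<in>X s. card (inn \<phi> c ?S))" using fX by (intro sum_mono2) auto
    also have "\<dots> \<le> k * r - Suc r" by (rule sle)
    finally have "(k - 1) * r \<le> k * r - Suc r"
      using cX d(1) fX by simp
    moreover have "(k - 1) * r = k * r - r" by (simp add: diff_mult_distrib)
    ultimately show False using r0 by linarith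
  qed
  then obtain s1 where s1: "s1 \<in> X s"
    and ex: "\<exists>s2\<in>X s. s1 \<noteq> s2 \<and> card (inn \<phi> s1 ?S) < r \<and> card (inn \<phi> s2 ?S) < r" by (rule bexE)
  from ex obtain s2 where s2: "s2 \<in> X s"
    and cj: "s1 \<noteq> s2 \<and> card (inn \<phi> s1 ?S) < r \<and> card (inn \<phi> s2 ?S) < r" by (rule bexE)
  note s12 = s1 s2 conjunct1[OF cj]
  note sl = conjunct1[OF conjunct2[OF cj]] conjunct2[OF conjunct2[OF cj]]
  have gs: "good (\<phi>(s := d)) ?Z" if "d \<in> X s" "card (inn \<phi> d ?S) < r" for d
    by (subst Zins, rule good_extend[OF g SV V(3) _ that(1)]) (use that(2) in auto)
  have pat: "card (out (\<phi>(s := d)) c ?Z) \<in> {0, r}" if "d \<in> X s" "card (inn \<phi> d ?S) < r" "c \<in> X w" for d c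
    by (rule saturated[OF w V(2) ne(1) gs[OF that(1,2)] uniq that(3)])
  have cnt: "card (out (\<phi>(s := d)) c ?Z) = card (out \<phi> c ?S) + (if (c, d) \<in> E then 1 else 0)" for d c
  proof -
    have "card (out (\<phi>(s := d)) c ?Z) = card (out (\<phi>(s := d)) c (insert s ?S))"
      by (rule arg_cong[OF Zins])
    also have "\<dots> = card (out \<phi> c ?S) + (if (c, d) \<in> E then 1 else 0)"
      using finV by (subst card_nbs_insert) (auto simp: nbs_remove)
    finally show ?thesis .
  qed
  have sZ: "s \<in> ?Z" using V ne s by auto
  obtain y where y: "y \<in> L" using cardL r_ge2 by (metis card.empty not_numeral_le_zero ex_in_conv)
  have sym: "symp adj" by (auto simp: symp_def)
  have "linked adj L" by (rule linked_clique) (use hub_out LM in auto)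
  then have "linked adj (insert x L)"
    using linked_insert[OF sym _ y, of x] hub_out[OF y] x y by auto
  then have lW: "linked adj (insert w (insert x L))"
    using linked_insert[OF sym, of "insert x L" y w] hub_out[OF y] w y by auto
  have WV': "insert w (insert x L) \<subseteq> V" using WV by auto
  have wsub: "{w} \<subseteq> insert w (insert x L)" by auto
  \<comment> \<open>The hole is moved to \<open>w\<close> only to obtain a colour of
    \<open>w\<close> that meets \<open>s1\<close>.\<close>
  obtain \<psi> where psi: "\<And>u. u \<in> ?Z \<Longrightarrow> \<psi> u = (\<phi>(s := s1)) u" "good \<psi> (V - {w})"
    by (rule linked_greedy[OF WV' lW wsub _ gs[OF s12(1) sl(1)]]) auto
  obtain c where c: "c \<in> X w" "(c, \<psi> s) \<in> E" using hole_out(4)[OF psi(2) V(1) ws] by auto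
  have cs1: "(c, s1) \<in> E" using c(2) psi(1)[OF sZ] by simp
  have "(c, s2) \<notin> E" using E_out[OF V(1,3) c(1) s12(1,2) cs1] s12(3) by auto
  then have "card (out \<phi> c ?S) + 1 \<in> {0, r}" "card (out \<phi> c ?S) \<in> {0, r}"
    using pat[OF s12(1) sl(1) c(1)] pat[OF s12(2) sl(2) c(1)] cs1 unfolding cnt by auto
  then show False using r_ge2 by auto
qed

lemma uniq_choice:
  assumes "x \<in> M - L" "w \<in> M - L" "x \<noteq> w" "(x, w) \<notin> A \<or> (w, x) \<notin> A"
    and "w1 \<in> X w" "w2 \<in> X w" "good (\<phi>(w := w1)) (V - insert x L)" "good (\<phi>(w := w2)) (V - insert x L)"
  shows "w1 = w2"
proof -
  interpret d: hub_cover V "A\<inverse>" X "E\<inverse>" k r L M by (rule hub_dual)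
  show ?thesis
    using two_choices[OF assms(1,2,3) _ assms(5-8)]
      d.two_choices[OF assms(1,2,3) _ assms(5,6)] assms(4,7,8)
    unfolding good_dual by auto
qed

text \<open>A missing arc between \<open>x\<close> and \<open>w\<close> makes the admissible colour
  of \<open>w\<close> unique, by \<open>two_choices\<close> or its dual; the further neighbour
  \<open>s\<close> of \<open>w\<close> contradicts this, by \<open>no_second_choice\<close> or its
  dual.\<close>

lemma hub_adjacent:
  assumes "x \<in> M - L" "w \<in> M - L" "s \<in> M - L" "x \<noteq> w" "s \<noteq> w" "s \<noteq> x" "adj s w"
  shows "(x, w) \<in> A \<and> (w, x) \<in> A"
proof (rule ccontr)
  assume "\<not> ?thesis"
  then have no: "(x, w) \<notin> A \<or> (w, x) \<notin> A" by auto
  interpret d: hub_cover V "A\<inverse>" X "E\<inverse>" k r L M by (rule hub_dual)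
  note u = uniq_choice[OF assms(1,2,4) no]
  show False
  proof (cases "(w, s) \<in> A")
    case True
    show False by (rule no_second_choice[OF assms(2,1,3,4,5,6) True u])
  next
    case False
    then have sw: "(w, s) \<in> A\<inverse>" using assms(7) by auto
    have u': "w1 = w2" if "w1 \<in> X w" "w2 \<in> X w" "d.good (\<phi>(w := w1)) (V - insert x L)"
      "d.good (\<phi>(w := w2)) (V - insert x L)" for \<phi> w1 w2
      by (rule u[OF that(1,2) that(3,4)[unfolded good_dual]])
    show False
      by (rule d.no_second_choice[OF assms(2,1,3,4,5,6) sw u'])
  qed
qed

end

section \<open>The end of a longest chain\<close>

context regular_hard_cover begin

lemma symp_adj: "symp adj"
  by (auto simp: symp_def)

lemma other_colour:
  assumes "w \<in> V"
  obtains z where "z \<in> X w" "z \<noteq> z0"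
proof -
  have "card (X w) = k" "finite (X w)" using regular(3) finX assms by auto
  then have "\<not> X w \<subseteq> {z0}" using k_ge2 by (metis card_mono card.empty card_insert_disjoint
    finite.intros empty_iff Suc_1 not_less_eq_eq le_trans One_nat_def)
  then show thesis using that by auto
qed

lemma complete_dig:
  assumes "full \<phi>" "complete \<phi> S" "S \<subseteq> V" "u \<in> S" "w \<in> S" "u \<noteq> w"
  shows "dig u w"
proof -
  have "u \<in> V" "w \<in> V" "\<phi> u \<in> X u" "\<phi> w \<in> X w" using assms full_in by auto
  then show ?thesis
    using E_arc[of u w "\<phi> u" "\<phi> w"] E_arc[of w u "\<phi> w" "\<phi> u"]
      completeD[OF assms(2,4,5)] completeD[OF assms(2,5,4)] assms(6) by auto
qed

text \<open>Each vertex of \<open>M\<close> has its \<open>k * r\<close> out- and in-neighbours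
  inside \<open>M\<close> already, so connectedness leaves nothing outside.\<close>

lemma all_of_complete:
  assumes "M \<subseteq> V" "M \<noteq> {}" "card M = k * r + 1"
    and "\<And>u w. u \<in> M \<Longrightarrow> w \<in> M \<Longrightarrow> u \<noteq> w \<Longrightarrow> dig u w"
  shows "M = V"
proof -
  obtain a where a: "a \<in> M" using assms(2) by auto
  have finM: "finite M" using finite_sub assms(1) by auto
  show ?thesis
  proof (rule linked_closure[OF conn a assms(1)])
    fix u w assume u: "u \<in> M" and w: "w \<in> V" and uw: "adj u w"
    have uV: "u \<in> V" using u assms(1) by auto
    have cM: "card (M - {u}) = k * r" using assms(3) u finM by simp
    have "M - {u} = {w \<in> V. (u, w) \<in> A}"
      by (rule card_subset_eq) (use finV assms(1,4) u cM regular(1)[OF uV] in auto)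
    moreover have "M - {u} = {w \<in> V. (w, u) \<in> A}"
      by (rule card_subset_eq) (use finV assms(1,4) u cM regular(2)[OF uV] in auto)
    ultimately show "w \<in> M" using uw w by auto
  qed
qed

end

context exhausted_chain begin

lemma KV: "K i \<subseteq> V"
  by (rule bad_sub)

lemma card_C:
  assumes "i < l" "complete (f i) (K i)"
  shows "card (C i) = r"
  using assms v_next(1)[OF assms(1)] finite_bad[of "f i"] by (simp add: complete_def)

text \<open>A non-cut vertex \<open>w\<close> other than the entry \<open>v l\<close> returns to
  some \<open>C i\<close>. The resulting arcs between \<open>C i\<close> and \<open>w\<close> allow
  \<open>Y l\<close> to be entered otherwise than through \<open>v l\<close>.\<close>

lemma end_complete: "complete (f l) (K l)"
proof -
  have full: "full (f l)" using fullf by auto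
  have vK: "v l \<in> K l" using v_in_K by auto
  obtain u where u: "u \<in> K l" "u \<noteq> v l" by (rule bad_nbr[OF full vK])
  have sub: "{v l} \<subset> K l" "{v l} \<noteq> {}" using vK u by auto
  obtain w where w: "w \<in> K l - {v l}" "linked (gadj (f l)) (K l - {w})"
    by (rule linked_non_cut[OF finite_bad symp_gadj linked_bad[OF full] linked_singleton sub])
  have wV: "w \<in> V" using w bad_V by auto
  obtain z where z: "z \<in> X w" "z \<noteq> f l w" by (rule other_colour[OF wV])
  have w': "w \<in> K l" "w \<noteq> v l" using w by auto
  obtain j where "target w j" by (rule return[OF w' w(2) z])
  then obtain i where i: "i < l" "complete (f i) (K i)" and d: "\<And>u. u \<in> C i \<Longrightarrow> dig u w"
    unfolding target_def by blast
  have "card (C i) \<noteq> 0" using card_C[OF i] p_pos by simp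
  then obtain c where c: "c \<in> C i" by (metis card.empty ex_in_conv)
  have cw: "adj c w" using d[OF c] by auto
  show ?thesis
    by (rule turned_complete[OF turned_all[OF i w(1) c cw i(1) order_refl] i(1) order_refl])
qed

lemma end_non_cut: "linked (gadj (f l)) (K l - {w})"
  by (rule linked_clique) (use completeD[OF end_complete] in \<open>auto simp: gadj_def\<close>)

lemma return_target:
  assumes w: "w \<in> Y l" and z: "z \<in> X w" "z \<noteq> f l w"
  obtains i where "target w i" "bad ((f l)(w := z)) = insert w (C i)"
proof -
  have w': "w \<in> K l" "w \<noteq> v l" using w by auto
  show thesis by (rule return[OF w' end_non_cut z]) (rule that)
qed

text \<open>Some colour of \<open>w\<close> meets the colour of \<open>u\<close>. If it is the
  present one, \<open>u\<close> lies in \<open>K l\<close>; otherwise choosing it makes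
  \<open>w\<close> return to a \<open>C i\<close> containing \<open>u\<close>.\<close>

lemma end_nbr:
  assumes w: "w \<in> Y l" and u: "adj w u"
  shows "u \<in> K l \<or> (\<exists>i. target w i \<and> u \<in> C i)"
proof -
  have full: "full (f l)" using fullf by auto
  have wK: "w \<in> K l" using w by auto
  have uV: "u \<in> V" "u \<noteq> w" using u A_sub A_irrefl by auto
  obtain x where x: "x \<in> X w" "(x, f l u) \<in> E \<or> (f l u, x) \<in> E"
    using bad_meets[OF wK, of u] u by auto
  show ?thesis
  proof (cases "x = f l w")
    case True
    then have "gadj (f l) w u" using x(2) by (auto simp: gadj_def)
    then show ?thesis using bad_step[OF full wK uV(1)] by auto
  next
    case False
    obtain i where i: "target w i" "bad ((f l)(w := x)) = insert w (C i)"
      by (rule return_target[OF w x(1) False])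
    have "gadj ((f l)(w := x)) w u" using x(2) uV(2) by (auto simp: gadj_def)
    then have "u \<in> bad ((f l)(w := x))"
      using bad_step[OF full_upd[OF full x(1)] bad_move[OF wK] uV(1)] by auto
    then show ?thesis using i uV(2) by auto
  qed
qed

lemma Y_nonempty: "Y l \<noteq> {}"
proof -
  have "card (Y l) = r"
    using end_complete v_in_K[of l] finite_bad[of "f l"] by (simp add: complete_def)
  then show ?thesis using p_pos by (metis card.empty not_one_le_zero)
qed

lemma CC_disjoint: "i < l \<Longrightarrow> j < l \<Longrightarrow> i \<noteq> j \<Longrightarrow> C i \<inter> C j = {}"
  using C_disjoint[of i j] C_disjoint[of j i] by (cases i j rule: linorder_cases) auto

text \<open>The neighbourhood of \<open>w\<close> splits into \<open>K l - {w}\<close> and the sets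
  \<open>C i\<close> of its targets, all of size \<open>r\<close>; so there are \<open>k - 1\<close>
  targets. A target \<open>i\<close> makes \<open>w\<close> adjacent to \<open>v (Suc i)\<close>,
  which lies in \<open>C (Suc i)\<close> if \<open>Suc i < l\<close>, so \<open>Suc i\<close> is a
  target too. Hence the targets are the last \<open>k - 1\<close> indices, the same for every
  \<open>w\<close>.\<close>

lemma end_nbrs:
  assumes r2: "2 \<le> r" and w: "w \<in> Y l"
  shows "{i. target w i} = {l - (k - 1)..<l}"
    and "{u \<in> V. (w, u) \<in> A} = (K l \<union> (\<Union>i\<in>{l - (k - 1)..<l}. C i)) - {w}"
    and "{u \<in> V. (u, w) \<in> A} = (K l \<union> (\<Union>i\<in>{l - (k - 1)..<l}. C i)) - {w}"
proof -
  let ?I = "{i. target w i}"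
  have full: "full (f l)" using fullf by auto
  have wK: "w \<in> K l" "w \<in> V" using w bad_V by auto
  have Il: "?I \<subseteq> {..<l}" by (auto simp: target_def)
  then have finI: "finite ?I" using finite_subset by blast
  have CV: "C i \<subseteq> V" for i using bad_V by auto
  have dK: "dig w u" if "u \<in> K l" "u \<noteq> w" for u
    using complete_dig[OF full end_complete KV wK(1) that(1)] that by auto
  have wC: "w \<notin> C i" if "i < l" for i using C_disjoint[OF that order_refl] wK by auto
  define B where "B = (K l - {w}) \<union> (\<Union>i\<in>?I. C i)"
  have toB: "u \<in> B" if "adj w u" for u
    using end_nbr[OF w that] that A_irrefl by (auto simp: B_def)
  have ofB: "dig w u \<and> u \<in> V" if u: "u \<in> B" for u
  proof -
    consider "u \<in> K l" "u \<noteq> w" | i where "target w i" "u \<in> C i" using u by (auto simp: B_def)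
    then show ?thesis using dK KV CV by cases (auto simp: target_def)
  qed
  have Nout: "{u \<in> V. (w, u) \<in> A} = B" and Nin: "{u \<in> V. (u, w) \<in> A} = B"
    using toB ofB by blast+
  have "card (\<Union>i\<in>?I. C i) = (\<Sum>i\<in>?I. card (C i))"
  proof (rule card_UN_disjoint[OF finI])
    show "\<forall>i\<in>?I. finite (C i)" using finite_bad by auto
    show "\<forall>i\<in>?I. \<forall>j\<in>?I. i \<noteq> j \<longrightarrow> C i \<inter> C j = {}"
      using CC_disjoint Il by blast
  qed
  also have "\<dots> = (\<Sum>i\<in>?I. r)" using card_C by (intro sum.cong) (auto simp: target_def)
  finally have cU: "card (\<Union>i\<in>?I. C i) = card ?I * r" by simp
  have cK: "card (K l - {w}) = r"
    using end_complete wK finite_bad[of "f l"] by (simp add: complete_def)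
  have "(K l - {w}) \<inter> (\<Union>i\<in>?I. C i) = {}"
    using C_disjoint[of _ l] Il by auto
  then have "k * r = r + card ?I * r"
    using regular(1)[OF wK(2)] cU cK card_Un_disjoint[of "K l - {w}" "\<Union>i\<in>?I. C i"]
      finite_bad finI unfolding Nout B_def by auto
  then have "k * r = (1 + card ?I) * r" by simp
  then have cI: "card ?I = k - 1" using p_pos by (metis mult_right_cancel not_one_le_zero add_diff_cancel_left')
  have up: "Suc i \<in> ?I" if i: "i \<in> ?I" "Suc i < l" for i
  proof -
    have "(w, v (Suc i)) \<in> A" using i r2 by (auto simp: target_def)
    then have "v (Suc i) \<in> (K l - {w}) \<union> (\<Union>i\<in>?I. C i)"
      using toB[of "v (Suc i)"] by (simp add: B_def)
    moreover have vC: "v (Suc i) \<in> C (Suc i)" using v_in_C i by auto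
    moreover have "v (Suc i) \<notin> K l" using vC C_disjoint[of "Suc i" l] i by auto
    ultimately obtain j where j: "j \<in> ?I" "v (Suc i) \<in> C j" by blast
    then have "j = Suc i" using CC_disjoint[of j "Suc i"] vC i Il by auto
    then show ?thesis using j by auto
  qed
  have Ine: "?I \<noteq> {}" using cI k_ge2 by (metis card.empty diff_is_0_eq not_less_eq_eq numeral_2_eq_2 One_nat_def)
  define m where "m = Min ?I"
  have mI: "m \<in> ?I" unfolding m_def using finI Ine by (rule Min_in)
  have ge_m: "i \<in> ?I" if "m \<le> i" "i < l" for i
    using that
  proof (induction i rule: dec_induct)
    case base
    show ?case by (rule mI)
  next
    case (step n)
    show ?case by (rule up) (use step in simp_all)
  qed
  have Ieq: "?I = {m..<l}"
  proof (intro subset_antisym subsetI)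
    fix i assume i: "i \<in> ?I"
    have "m \<le> i" unfolding m_def using finI i by (rule Min_le)
    moreover have "i < l" using i Il by blast
    ultimately show "i \<in> {m..<l}" by simp
  next
    fix i assume "i \<in> {m..<l}"
    then show "i \<in> ?I" by (intro ge_m) auto
  qed
  have ml: "m < l" using mI Il by blast
  have "l - m = k - 1" using cI unfolding Ieq by simp
  then have "m = l - (k - 1)" using ml by linarith
  then show I: "?I = {l - (k - 1)..<l}" using Ieq by simp
  have nw: "w \<notin> (\<Union>i\<in>{l - (k - 1)..<l}. C i)" using wC by auto
  show "{u \<in> V. (w, u) \<in> A} = (K l \<union> (\<Union>i\<in>{l - (k - 1)..<l}. C i)) - {w}"
    and "{u \<in> V. (u, w) \<in> A} = (K l \<union> (\<Union>i\<in>{l - (k - 1)..<l}. C i)) - {w}"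
    unfolding Nout Nin B_def I using nw by auto
qed

text \<open>By \<open>end_nbrs\<close> the vertices of \<open>Y l\<close> have one common closed
  neighbourhood and form a hub. For two other vertices \<open>x\<close> and \<open>w\<close> of it,
  the third vertex for \<open>hub_adjacent\<close> is found in a complete \<open>K i\<close>
  containing \<open>w\<close>, which has \<open>r + 1\<close>, so at least 3, vertices.\<close>

lemma complete_ge2:
  assumes r2: "2 \<le> r"
  shows "card V = k * r + 1" "u \<in> V \<Longrightarrow> w \<in> V \<Longrightarrow> u \<noteq> w \<Longrightarrow> dig u w"
proof -
  define J where "J = {l - (k - 1)..<l}"
  define M where "M = K l \<union> (\<Union>i\<in>J. C i)"
  let ?L = "Y l"
  obtain y where y: "y \<in> ?L" using Y_nonempty by auto
  note en = end_nbrs[OF r2, folded J_def, folded M_def]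
  have cK: "complete (f i) (K i)" if "i \<in> J" for i
    using en(1)[OF y] that by (auto simp: target_def)
  have Jl: "i < l" if "i \<in> J" for i using that by (auto simp: J_def)
  have MV: "M \<subseteq> V" unfolding M_def using bad_V by auto
  have LM: "?L \<subseteq> M" unfolding M_def by auto
  have cardL: "card ?L = r"
    using end_complete v_in_K[of l] finite_bad[of "f l"] by (simp add: complete_def)
  interpret hub_cover V A X E k r ?L M
  proof
    show "2 \<le> r" "?L \<subseteq> M" "M \<subseteq> V" "card ?L = r" by fact+
    fix w u assume w: "w \<in> ?L"
    have "u \<in> {u \<in> V. (w, u) \<in> A} \<longleftrightarrow> u \<in> M - {w}" "u \<in> {u \<in> V. (u, w) \<in> A} \<longleftrightarrow> u \<in> M - {w}"
      unfolding en(2)[OF w] en(3)[OF w] by auto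
    then show "(w, u) \<in> A \<longleftrightarrow> u \<in> M \<and> u \<noteq> w" "(u, w) \<in> A \<longleftrightarrow> u \<in> M \<and> u \<noteq> w"
      using A_sub MV by auto
  qed
  have yV: "y \<in> V" "y \<in> M" using y LM MV by auto
  have finM: "finite M" using finite_sub MV by auto
  have "card (M - {y}) = k * r" using regular(1)[OF yV(1)] en(2)[OF y] by simp
  then have cM: "card M = k * r + 1" using yV finM by (metis Suc_eq_plus1 card_Suc_Diff1)
  have l0: "0 < l" "l - 1 \<in> J"
  proof -
    have "target y i \<Longrightarrow> 0 < l" for i by (auto simp: target_def)
    moreover have "\<exists>i. target y i"
    proof -
      obtain z where "z \<in> X y" "z \<noteq> f l y" by (rule other_colour[OF yV(1)])
      then show ?thesis using return_target[OF y] by metis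
    qed
    ultimately show "0 < l" by auto
    then show "l - 1 \<in> J" using k_ge2 by (auto simp: J_def)
  qed
  have KM: "K i \<subseteq> M - ?L" if i: "i \<in> J" for i
  proof -
    have "C i \<inter> K l = {}" using C_disjoint[OF Jl[OF i] order_refl] by auto
    then have "C i \<subseteq> M - ?L" using i by (auto simp: M_def)
    moreover have "v (Suc i) \<in> M - ?L"
    proof (cases "Suc i = l")
      case True
      then show ?thesis using v_in_K[of l] by (auto simp: M_def)
    next
      case False
      then have S: "Suc i < l" "Suc i \<in> J" using i Jl[OF i] by (auto simp: J_def)
      have "v (Suc i) \<in> C (Suc i)" using v_in_C S by auto
      moreover have "v (Suc i) \<notin> K l" using calculation C_disjoint[OF S(1) order_refl] by auto
      ultimately show ?thesis using S(2) unfolding M_def by blast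
    qed
    ultimately show ?thesis by auto
  qed
  have inK: "\<exists>i\<in>J. w \<in> K i" if w: "w \<in> M - ?L" for w
  proof (cases "w \<in> K l")
    case True
    then have "w = v l" using w by auto
    then show ?thesis using v_next(1)[of "l - 1"] l0 by (intro bexI[of _ "l - 1"]) auto
  next
    case False
    then show ?thesis using w unfolding M_def by auto
  qed
  have rest: "dig x w" if xw: "x \<in> M - ?L" "w \<in> M - ?L" "x \<noteq> w" for x w
  proof -
    obtain i where i: "i \<in> J" "w \<in> K i" using inK xw by auto
    have "card {w, x} < card (K i)" using cK[OF i(1)] r2 xw(3) by (simp add: complete_def)
    then have "\<not> K i \<subseteq> {w, x}" using card_mono[of "{w, x}" "K i"] by auto
    then obtain s where s: "s \<in> K i" "s \<noteq> w" "s \<noteq> x" by auto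
    have "adj s w"
      using complete_dig[OF fullf cK[OF i(1)] KV s(1) i(2) s(2)] Jl[OF i(1)] by auto
    moreover have "s \<in> M - ?L" using KM[OF i(1)] s by auto
    ultimately show ?thesis using hub_adjacent[OF xw(1,2) _ xw(3) s(2,3)] by auto
  qed
  have all: "dig x w" if xw: "x \<in> M" "w \<in> M" "x \<noteq> w" for x w
  proof (cases "x \<in> ?L")
    case True
    then show ?thesis using hub_out[OF True] hub_in[OF True] xw by auto
  next
    case x: False
    show ?thesis
    proof (cases "w \<in> ?L")
      case True
      then show ?thesis using hub_out[OF True] hub_in[OF True] xw by auto
    next
      case False
      then show ?thesis using rest[of x w] x xw by auto
    qed
  qed
  have "M = V" by (rule all_of_complete[OF MV _ cM all]) (use yV in auto)
  then show "card V = k * r + 1" "u \<in> V \<Longrightarrow> w \<in> V \<Longrightarrow> u \<noteq> w \<Longrightarrow> dig u w"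
    using cM all by auto
qed

end

section \<open>Cycles of digons\<close>

context regular_hard_cover begin

definition digcycle :: "'v list \<Rightarrow> bool" where
  "digcycle cs \<longleftrightarrow> distinct cs \<and> set cs \<subseteq> V \<and> 3 \<le> length cs \<and> successively dig cs \<and> dig (last cs) (hd cs)"

lemma digcycle_rotate:
  assumes "digcycle (xs @ ys)"
  shows "digcycle (ys @ xs)"
proof (cases "xs = [] \<or> ys = []")
  case True
  then show ?thesis using assms by auto
next
  case False
  then show ?thesis using assms by (auto simp: digcycle_def successively_append_iff)
qed

lemma path_linked: "xs \<noteq> [] \<Longrightarrow> successively dig xs \<Longrightarrow> linked adj (set xs)"
proof (induction xs rule: induct_list012)
  case (2 x)
  then show ?case by (simp add: linked_singleton)
next
  case (3 x y zs)
  have "linked adj (set (y # zs))" using 3 by auto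
  moreover have "adj x y" using 3(4) by auto
  ultimately show ?case using linked_insert[OF symp_adj, of "set (y # zs)" y x] by auto
qed simp

text \<open>Every colour of \<open>y\<close> can be completed to a colouring of all vertices but \<open>x\<close>; the colour
  of \<open>x\<close> that meets \<open>t\<close> has no out-neighbour left among the colours of \<open>y\<close>.\<close>

lemma closed_spreads_out:
  assumes r1: "r = 1" and S: "S = insert y S'" "y \<notin> S'" "S \<subseteq> V" "linked adj S'" "x \<in> S'"
    and xy: "(x, y) \<in> A" and cl: "\<And>u. adj y u \<Longrightarrow> u \<in> S" and xt: "(x, t) \<in> A"
  shows "t \<in> S"
proof (rule ccontr)
  assume tS: "t \<notin> S"
  have V: "x \<in> V" "y \<in> V" "t \<in> V" using S xt A_sub by auto
  have e: "good \<phi> (V - V)" for \<phi> by (simp add: good_empty)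
  have Sne: "S \<noteq> {}" using S by auto
  obtain \<phi> where phi: "good \<phi> (V - S)"
    by (rule linked_greedy[OF subset_refl conn S(3) Sne e])
  have ins: "insert y (V - S) = V - S'" using S by auto
  have ext: "\<exists>\<psi>. \<psi> t = \<phi> t \<and> \<psi> y = c \<and> good \<psi> (V - {x})" if c: "c \<in> X y" for c
  proof -
    have "out \<phi> c (V - S) \<subseteq> {}"
    proof
      fix u assume u: "u \<in> out \<phi> c (V - S)"
      then have "\<phi> u \<in> X u" using phi by (auto simp: good_def col_def)
      then have "(y, u) \<in> A" using E_arc[of y u c "\<phi> u"] u V c by auto
      then show "u \<in> {}" using cl u by auto
    qed
    then have "card (out \<phi> c (V - S)) < r" using r1 by simp
    then have g: "good (\<phi>(y := c)) (V - S')"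
      using good_extend[OF phi _ V(2) _ c] S(1) unfolding ins by auto
    have S'V: "S' \<subseteq> V" and xS: "{x} \<subseteq> S'" using S by auto
    obtain \<psi> where psi: "\<And>u. u \<in> V - S' \<Longrightarrow> \<psi> u = (\<phi>(y := c)) u" "good \<psi> (V - {x})"
      by (rule linked_greedy[OF S'V S(4) xS _ g]) auto
    have "\<psi> t = \<phi> t" "\<psi> y = c" using psi(1)[of t] psi(1)[of y] V tS S by auto
    then show ?thesis using psi(2) by auto
  qed
  obtain c0 where c0: "c0 \<in> X y" by (rule other_colour[OF V(2)])
  from ext[OF c0] obtain \<psi>0 where psi0: "\<psi>0 t = \<phi> t" "\<psi>0 y = c0" "good \<psi>0 (V - {x})"
    by (elim exE conjE)
  \<comment> \<open>All extensions agree with \<open>\<phi>\<close> at \<open>t\<close>, so this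
    \<open>d\<close> meets \<open>t\<close> whatever the colour of \<open>y\<close>.\<close>
  obtain d where d: "d \<in> X x" "(d, \<phi> t) \<in> E"
    using hole_out(4)[OF psi0(3) V(1) xt] unfolding psi0(1) by auto
  have "\<exists>a\<in>X x - {d}. (a, c) \<in> E" if c: "c \<in> X y" for c
  proof -
    from ext[OF c] obtain \<psi> where psi: "\<psi> t = \<phi> t" "\<psi> y = c" "good \<psi> (V - {x})" by (elim exE conjE)
    obtain a where a: "a \<in> X x" "(a, c) \<in> E" using hole_out(4)[OF psi(3) V(1) xy] psi(2) by auto
    have "a \<noteq> d"
    proof
      assume "a = d"
      then have "{t, y} \<subseteq> out \<psi> d (V - {x})" using a d psi xt xy V A_irrefl by auto
      moreover have "t \<noteq> y" using tS S by auto
      ultimately have "2 \<le> card (out \<psi> d (V - {x}))"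
        using card_mono[of "out \<psi> d (V - {x})" "{t, y}"] finV by auto
      then show False using hole_out(3)[OF psi(3) V(1) d(1)] r1 by simp
    qed
    then show ?thesis using a by auto
  qed
  \<comment> \<open>\<open>h\<close> is injective by the matching condition, so it sends the
    \<open>k\<close> colours of \<open>y\<close> into the \<open>k - 1\<close> colours of
    \<open>x\<close> other than \<open>d\<close>.\<close>
  then obtain h where h: "\<And>c. c \<in> X y \<Longrightarrow> h c \<in> X x - {d} \<and> (h c, c) \<in> E" by metis
  have "inj_on h (X y)"
  proof (rule inj_onI)
    fix c c' assume "c \<in> X y" "c' \<in> X y" "h c = h c'"
    then show "c = c'" using h[of c] h[of c'] E_out[OF V(1,2), of "h c" c c'] by auto
  qed
  moreover have "h ` X y \<subseteq> X x - {d}" using h by auto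
  ultimately have "card (X y) \<le> card (X x - {d})"
    using finX[OF V(1)] by (intro card_inj_on_le[of h]) auto
  then show False using regular(3)[OF V(1)] regular(3)[OF V(2)] d(1) finX[OF V(1)] k_ge2 by simp
qed

lemma closed_spreads:
  assumes r1: "r = 1" and S: "S = insert y S'" "y \<notin> S'" "S \<subseteq> V" "linked adj S'" "x \<in> S'"
    and xy: "dig x y" and cl: "\<And>u. adj y u \<Longrightarrow> u \<in> S" and xt: "adj x t"
  shows "t \<in> S"
proof (cases "(x, t) \<in> A")
  case True
  then show ?thesis using closed_spreads_out[OF r1 S conjunct1[OF xy] cl] by blast
next
  case False
  interpret d: regular_hard_cover V "A\<inverse>" X "E\<inverse>" k r by (rule rdual)
  have l: "linked d.adj S'" using S(4) by (simp add: disj_commute)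
  show ?thesis
    by (rule d.closed_spreads_out[OF r1 S(1-3) l S(5)]) (use xy cl xt False in auto)
qed

lemma digcycle_tl:
  assumes "digcycle (y # xs)"
  shows "y \<notin> set xs" "linked adj (set xs)" "xs \<noteq> []"
proof -
  show ne: "xs \<noteq> []" using assms by (auto simp: digcycle_def)
  show "y \<notin> set xs" using assms by (simp add: digcycle_def)
  have "successively dig xs" using assms ne by (simp add: digcycle_def successively_Cons)
  then show "linked adj (set xs)" by (rule path_linked[OF ne])
qed

text \<open>By \<open>closed_spreads\<close> the absence of neighbours outside passes from a vertex
  of the cycle to its successor, hence around the cycle; connectedness does the rest.\<close>

lemma digcycle_closed:
  assumes r1: "r = 1" and cs: "digcycle cs" and y: "y \<in> set cs" "\<And>u. adj y u \<Longrightarrow> u \<in> set cs"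
  shows "set cs = V"
proof -
  have step: "adj x t \<Longrightarrow> t \<in> set (y # x # xs)"
    if c: "digcycle (y # x # xs)" and cl: "\<And>u. adj y u \<Longrightarrow> u \<in> set (y # x # xs)" for y x t xs
  proof (rule closed_spreads[OF r1 _ _ _ digcycle_tl(2)[OF c], where y = y])
    show "dig x y" "set (y # x # xs) \<subseteq> V" "y \<notin> set (x # xs)" using c by (auto simp: digcycle_def)
  qed (use cl in auto)
  have "\<forall>t. adj (hd (rotate n cs)) t \<longrightarrow> t \<in> set cs"
    if "cs = y # xs" "digcycle cs" "\<And>u. adj y u \<Longrightarrow> u \<in> set cs" for n cs y xs
  proof (induction n)
    case 0
    show ?case using that by auto
  next
    case (Suc n)
    have "rotate n cs = drop (n mod length cs) cs @ take (n mod length cs) cs" by (rule rotate_drop_take)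
    moreover have "digcycle (drop (n mod length cs) cs @ take (n mod length cs) cs)"
      by (rule digcycle_rotate) (use that(2) in simp)
    ultimately have dr: "digcycle (rotate n cs)" by simp
    then have "3 \<le> length (rotate n cs)" unfolding digcycle_def by blast
    then obtain a b zs where ab: "rotate n cs = a # b # zs"
      by (metis One_nat_def Suc_1 Suc_le_length_iff numeral_3_eq_3)
    have "set (a # b # zs) = set cs" using ab by (metis set_rotate)
    then have "adj b t \<Longrightarrow> t \<in> set cs" for t
      using step[of a b zs t] dr Suc unfolding ab by auto
    moreover have "rotate (Suc n) cs = b # zs @ [a]" using ab by simp
    ultimately show ?case by simp
  qed
  note rot = this
  obtain as bs where ab: "cs = as @ y # bs" using y(1) by (meson split_list)
  let ?ds = "y # bs @ as"
  have ds: "digcycle ?ds" "set ?ds = set cs" using digcycle_rotate[of as "y # bs"] cs ab by auto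
  have all: "adj x t \<Longrightarrow> t \<in> set cs" if x: "x \<in> set cs" for x t
  proof -
    obtain n where n: "n < length ?ds" "x = ?ds ! n" using x ds(2) by (metis in_set_conv_nth)
    have "hd (rotate n ?ds) = x"
      using n by (subst hd_rotate_conv_nth) auto
    then show "adj x t \<Longrightarrow> t \<in> set cs"
      using rot[of ?ds y "bs @ as" n] ds y(2) by auto
  qed
  show ?thesis
    by (rule linked_closure[OF conn y(1)]) (use all cs in \<open>auto simp: digcycle_def\<close>)
qed

text \<open>Every colour of \<open>u\<close> extends to a colouring with its hole at
  \<open>b\<close> and is then met from \<open>b\<close>. This maps \<open>X u\<close> injectively
  into \<open>X b\<close>; both have \<open>k\<close> elements, so every colour of \<open>b\<close>
  is reached.\<close>

lemma colour_in_nbr: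
  assumes ub: "(u, b) \<in> A" and l: "linked adj (V - {u})" and x0: "x0 \<in> X b"
  obtains a0 where "a0 \<in> X u" "(a0, x0) \<in> E"
proof -
  have V: "u \<in> V" "b \<in> V" "u \<noteq> b" using ub A_sub A_irrefl by auto
  have "\<exists>x\<in>X b. (a, x) \<in> E" if a: "a \<in> X u" for a
  proof -
    have "good ((\<lambda>_. a)(u := a)) (insert u {})"
      by (rule good_extend[OF good_empty _ V(1) _ a]) (use p_pos in \<open>auto simp: nbs_def\<close>)
    moreover have "V - (V - {u}) = insert u {}" using V by auto
    ultimately have g: "good ((\<lambda>_. a)(u := a)) (V - (V - {u}))" by simp
    have sub: "V - {u} \<subseteq> V" "{b} \<subseteq> V - {u}" using V by auto
    obtain \<psi> where psi: "\<And>w. w \<in> V - (V - {u}) \<Longrightarrow> \<psi> w = ((\<lambda>_. a)(u := a)) w" "good \<psi> (V - {b})"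
      by (rule linked_greedy[OF sub(1) l sub(2) _ g]) auto
    have "\<psi> u = a" using psi(1)[of u] V by simp
    then show ?thesis using hole_in(3)[OF psi(2) V(2) ub] by auto
  qed
  then obtain h where h: "\<And>a. a \<in> X u \<Longrightarrow> h a \<in> X b \<and> (a, h a) \<in> E" by metis
  have inj: "inj_on h (X u)"
  proof (rule inj_onI)
    fix a a' assume "a \<in> X u" "a' \<in> X u" "h a = h a'"
    then show "a = a'" using h[of a] h[of a'] E_in[OF V(1,2), of a a' "h a"] by auto
  qed
  have "h ` X u = X b"
    by (rule card_subset_eq)
      (use finX V(2) h card_image[OF inj] regular(3)[OF V(1)] regular(3)[OF V(2)] in auto)
  then have "x0 \<in> h ` X u" using x0 by simp
  then obtain a where "x0 = h a" "a \<in> X u" by (rule imageE)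
  then show thesis using that[of a] h[of a] by simp
qed

text \<open>If \<open>a\<close> and \<open>c\<close> were not joined by a digon, both could be given a colour meeting the same
  colour of \<open>b\<close>, and the remaining vertices could be coloured towards \<open>b\<close>.\<close>

lemma digcycle_chord:
  assumes r1: "r = 1" and k3: "3 \<le> k" and cs: "digcycle (a # b # c # xs)" and V: "set (a # b # c # xs) = V"
  shows "dig a c"
proof (rule ccontr)
  assume nd: "\<not> dig a c"
  have abc: "a \<in> V" "b \<in> V" "c \<in> V" "a \<noteq> b" "b \<noteq> c" "a \<noteq> c" "a \<notin> set xs" "b \<notin> set xs" "c \<notin> set xs"
    using cs V by (auto simp: digcycle_def)
  have la: "linked adj (V - {a})"
  proof -
    have "set (b # c # xs) = V - {a}" using V abc by auto
    then show ?thesis using digcycle_tl(2)[OF cs] by simp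
  qed
  have lc: "linked adj (V - {c})"
  proof -
    have r: "digcycle (c # xs @ [a, b])" using digcycle_rotate[of "[a, b]" "c # xs"] cs by simp
    have "set (xs @ [a, b]) = V - {c}" using V abc by auto
    then show ?thesis using digcycle_tl(2)[OF r] by simp
  qed
  \<comment> \<open>Here \<open>k \<ge> 3\<close> enters: \<open>b\<close> has an out-neighbour
    besides \<open>a\<close> and \<open>c\<close>, so the vertices other than \<open>a\<close> and
    \<open>c\<close> remain linked.\<close>
  have "\<not> {u \<in> V. (b, u) \<in> A} \<subseteq> {a, c}"
  proof
    assume "{u \<in> V. (b, u) \<in> A} \<subseteq> {a, c}"
    then have "card {u \<in> V. (b, u) \<in> A} \<le> card {a, c}" by (intro card_mono) auto
    also have "\<dots> \<le> 2" by (simp add: card_insert_if)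
    finally show False using regular(1)[OF abc(2)] r1 k3 by simp
  qed
  then obtain d where d: "(b, d) \<in> A" "d \<in> set xs" using V A_irrefl by auto
  have "successively dig xs" "xs \<noteq> []" using cs d by (auto simp: digcycle_def successively_Cons)
  then have "linked adj (insert b (set xs))"
    using linked_insert[OF symp_adj path_linked d(2), of b] d(1) by auto
  moreover have "insert b (set xs) = V - {a, c}" using V abc by auto
  ultimately have lW: "linked adj (V - {a, c})" by simp
  obtain x0 where x0: "x0 \<in> X b" by (rule other_colour[OF abc(2)])
  have ab: "(a, b) \<in> A" "(c, b) \<in> A" using cs by (auto simp: digcycle_def)
  obtain a0 where a0: "a0 \<in> X a" "(a0, x0) \<in> E" by (rule colour_in_nbr[OF ab(1) la x0])
  obtain c0 where c0: "c0 \<in> X c" "(c0, x0) \<in> E" by (rule colour_in_nbr[OF ab(2) lc x0])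
  let ?\<phi>1 = "(\<lambda>_. a0)(a := a0)"
  have g1: "good ?\<phi>1 {a}"
    by (rule good_extend[OF good_empty _ abc(1) _ a0(1)]) (use p_pos in \<open>auto simp: nbs_def\<close>)
  have "good (?\<phi>1(c := c0)) (insert c {a})"
  proof (rule good_extend[OF g1 _ abc(3) _ c0(1)])
    \<comment> \<open>Without a digon between \<open>a\<close> and \<open>c\<close>, one direction
      is free between their colours, which suffices for degeneracy when
      \<open>r = 1\<close>.\<close>
    have "(c0, a0) \<notin> E \<or> (a0, c0) \<notin> E"
      using nd E_arc[OF abc(1,3) a0(1) c0(1)] E_arc[OF abc(3,1) c0(1) a0(1)] by auto
    then have "out ?\<phi>1 c0 {a} = {} \<or> inn ?\<phi>1 c0 {a} = {}" by auto
    then show "card (out ?\<phi>1 c0 {a}) < r \<or> card (inn ?\<phi>1 c0 {a}) < r" using r1 by auto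
  qed (use abc in auto)
  moreover have Vac: "V - (V - {a, c}) = insert c {a}" using abc by auto
  ultimately have g: "good (?\<phi>1(c := c0)) (V - (V - {a, c}))" by simp
  have sub: "V - {a, c} \<subseteq> V" "{b} \<subseteq> V - {a, c}" using abc by auto
  obtain \<psi> where psi: "\<And>u. u \<in> V - (V - {a, c}) \<Longrightarrow> \<psi> u = (?\<phi>1(c := c0)) u" "good \<psi> (V - {b})"
    by (rule linked_greedy[OF sub(1) lW sub(2) _ g]) auto
  have "\<psi> a = a0" "\<psi> c = c0" using psi(1)[of a] psi(1)[of c] abc by auto
  then have "{a, c} \<subseteq> inn \<psi> x0 (V - {b})" using a0 c0 abc by auto
  then have "card {a, c} \<le> card (inn \<psi> x0 (V - {b}))" using finV by (intro card_mono) auto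
  then show False using hole_in(2)[OF psi(2) abc(2) x0] r1 abc by simp
qed

text \<open>With \<open>z\<close> the last vertex of the cycle, the new cycle uses the chords from
  \<open>a\<close> to \<open>c\<close> and from \<open>z\<close> to \<open>b\<close>; both skip a
  single vertex, so \<open>digcycle_chord\<close> provides them.\<close>

lemma digcycle_swap:
  assumes r1: "r = 1" and k3: "3 \<le> k" and cs: "digcycle (a # b # c # xs)" and V: "set (a # b # c # xs) = V"
  shows "digcycle (b # a # c # xs)"
proof -
  have ac: "dig a c" by (rule digcycle_chord[OF assms])
  have "xs \<noteq> []"
  proof
    assume xs: "xs = []"
    have aV: "a \<in> V" using V by auto
    have "{u \<in> V. (a, u) \<in> A} \<subseteq> {b, c}" using V xs A_irrefl by auto
    then have "card {u \<in> V. (a, u) \<in> A} \<le> card {b, c}" by (intro card_mono) auto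
    also have "\<dots> \<le> 2" by (simp add: card_insert_if)
    finally show False using regular(1)[OF aV] r1 k3 by simp
  qed
  then obtain ys z where xs: "xs = ys @ [z]" by (metis rev_exhaust)
  have rot: "digcycle (z # a # b # c # ys)"
    using digcycle_rotate[of "a # b # c # ys" "[z]"] cs xs by simp
  have zb: "dig z b"
    by (rule digcycle_chord[OF r1 k3 rot]) (use V xs in auto)
  have "successively dig (c # xs)" using cs by (auto simp: digcycle_def)
  moreover have "dig a b" using cs by (auto simp: digcycle_def)
  ultimately have "successively dig (b # a # c # xs)" using ac by simp
  moreover have "dig (last (b # a # c # xs)) (hd (b # a # c # xs))" using zb xs by simp
  moreover have "distinct (b # a # c # xs)" "set (b # a # c # xs) \<subseteq> V" "3 \<le> length (b # a # c # xs)"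
    using cs by (auto simp: digcycle_def)
  ultimately show ?thesis unfolding digcycle_def by blast
qed

text \<open>\<open>w\<close> is exchanged with its predecessor repeatedly until it follows
  \<open>u\<close>.\<close>

lemma digcycle_dig:
  assumes r1: "r = 1" and k3: "3 \<le> k" and "digcycle (u # ys @ w # zs)" and "set (u # ys @ w # zs) = V"
  shows "dig u w"
  using assms(3,4)
proof (induction ys arbitrary: zs rule: rev_induct)
  case Nil
  then show ?case by (auto simp: digcycle_def)
next
  case (snoc x ys)
  have "digcycle ((x # w # zs) @ (u # ys))"
    using digcycle_rotate[of "u # ys" "x # w # zs"] snoc.prems(1) by simp
  then obtain c rest where c: "zs @ u # ys = c # rest" "digcycle (x # w # c # rest)"
    by (cases "zs @ u # ys") auto
  have "set (x # w # zs @ u # ys) = V" using snoc.prems(2) by auto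
  then have "digcycle (w # x # c # rest)"
    using digcycle_swap[OF r1 k3 c(2)] unfolding c(1) by simp
  then have "digcycle ((w # x # zs) @ (u # ys))" unfolding c(1)[symmetric] by simp
  then have "digcycle (u # ys @ w # x # zs)"
    using digcycle_rotate[of "w # x # zs" "u # ys"] by simp
  then show ?case by (rule snoc.IH) (use snoc.prems(2) in auto)
qed

end

context exhausted_chain begin

text \<open>Let \<open>i\<close> be the least target of \<open>w\<close> and
  \<open>C i = {c}\<close>. The cycle is \<open>c\<close>, \<open>v (Suc i)\<close>, ...,
  \<open>v l\<close>, \<open>w\<close>. From \<open>i\<close> on all components are pairs, with
  \<open>C m = {v m}\<close> for \<open>i < m < l\<close>; as no target lies below \<open>i\<close>,
  every neighbour of \<open>w\<close> is on the cycle.\<close>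

lemma closed_digcycle:
  assumes r1: "r = 1"
  obtains cs y where "digcycle cs" "y \<in> set cs" "\<forall>u. adj y u \<longrightarrow> u \<in> set cs"
proof -
  obtain w where w: "w \<in> Y l" using Y_nonempty by auto
  have wV: "w \<in> V" "w \<in> K l" using w bad_V by auto
  obtain z where z: "z \<in> X w" "z \<noteq> f l w" by (rule other_colour[OF wV(1)])
  obtain j where j: "target w j" by (rule return_target[OF w z])
  define i where "i = (LEAST i. target w i)"
  have i: "target w i" unfolding i_def using j by (rule LeastI)
  have least: "i \<le> m" if "target w m" for m unfolding i_def using that by (rule Least_le)
  have il: "i < l" "complete (f i) (K i)" and dC: "\<And>u. u \<in> C i \<Longrightarrow> dig u w"
    using i by (auto simp: target_def)
  have "card (C i) = 1" using card_C[OF il] r1 by simp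
  then obtain c where Ci: "C i = {c}" by (rule card_1_singletonE)
  have cC: "c \<in> C i" using Ci by auto
  have cK: "c \<in> K i" "c \<noteq> v (Suc i)" using cC by auto
  have cw: "adj c w" using dC[OF cC] by auto
  have cmp: "complete (f m) (K m)" if "i \<le> m" "m \<le> l" for m
  proof (cases "m = i")
    case False
    then have m: "i < m" "m \<le> l" using that by auto
    show ?thesis by (rule turned_complete[OF turned_all[OF il w cC cw m] m])
  qed (use il in simp)
  have pair: "K m = {a, b}" if "i \<le> m" "m \<le> l" "a \<in> K m" "b \<in> K m" "a \<noteq> b" for m a b
  proof -
    have "card (K m) = Suc r" using cmp[OF that(1,2)] by (simp only: complete_def)
    then have "card (K m) = 2" using r1 by linarith
    then show ?thesis using that(3-5) finite_bad[of "f m"]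
      by (intro card_subset_eq[symmetric]) auto
  qed
  have dK: "dig a b" if "i \<le> m" "m \<le> l" "a \<in> K m" "b \<in> K m" "a \<noteq> b" for m a b
    by (rule complete_dig[OF fullf[OF that(2)] cmp[OF that(1,2)] KV that(3-5)])
  let ?vs = "map v [Suc i..<Suc l]"
  let ?cs = "c # ?vs @ [w]"
  have vs_ne: "?vs \<noteq> []" using il by simp
  have hdv: "hd ?vs = v (Suc i)"
    using il(1) by (subst hd_conv_nth[OF vs_ne]) (simp del: upt_Suc)
  have lastv: "last ?vs = v l" using il by simp
  have sv: "successively dig (map v [Suc i..<Suc m])" if "m \<le> l" for m
    using that
  proof (induction m)
    case (Suc m)
    show ?case
    proof (cases "Suc i \<le> m")
      case True
      have "v (Suc m) \<in> K m" "v m \<in> K m" "v m \<noteq> v (Suc m)"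
        using v_next[of m] v_in_K[of m] Suc by auto
      then have "dig (v m) (v (Suc m))" using dK[of m] True Suc by auto
      then have "dig (last (map v [Suc i..<Suc m])) (hd [v (Suc m)])"
        using True by (simp add: last_map)
      moreover have "map v [Suc i..<Suc (Suc m)] = map v [Suc i..<Suc m] @ [v (Suc m)]"
        using True by simp
      moreover have "successively dig (map v [Suc i..<Suc m])" using Suc by simp
      ultimately show ?thesis by (simp only: successively_append_iff) simp
    next
      case False
      then have "m \<le> i" by simp
      then have "[Suc i..<Suc (Suc m)] = [] \<or> [Suc i..<Suc (Suc m)] = [Suc i]"
        by (cases "m = i") auto
      then show ?thesis by auto
    qed
  qed simp
  have "dig c (v (Suc i))" using dK[of i] v_next(1)[of i] cK il by auto
  moreover have vw: "v l \<in> K l" "w \<noteq> v l" using v_in_K[of l] w by auto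
  moreover have "dig (v l) w" using dK[of l "v l" w] vw wV il by auto
  ultimately have suc: "successively dig ?cs"
    using sv[OF order_refl] vs_ne hdv lastv
    by (simp only: successively_Cons successively_append_iff) (simp add: hd_append)
  have inj: "distinct ?vs"
  proof -
    have "inj_on v {Suc i..<Suc l}"
      by (rule linorder_inj_onI) (use v_inj in auto)
    then show ?thesis by (simp add: distinct_map del: upt_Suc)
  qed
  have cvs: "c \<notin> set ?vs" using v_notin_C[of i] cC by auto
  have wvs: "w \<notin> set ?vs"
  proof
    assume "w \<in> set ?vs"
    then obtain m where "m \<in> {Suc i..<Suc l}" and wm: "w = v m"
      unfolding set_map set_upt by (rule imageE)
    then have m: "i < m" "m \<le> l" "w = v m" by auto
    then have "m < l" using vw by (cases "m = l") auto
    then show False using v_in_C[of m] C_disjoint[of m l] m wV by auto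
  qed
  have cw': "c \<noteq> w" using C_disjoint[OF il(1) order_refl] cC wV by auto
  have sub: "set ?cs \<subseteq> V"
  proof -
    have "v m \<in> V" if "m \<le> l" for m using bad_V[OF v_in_K[OF that]] .
    then show ?thesis using wV bad_V[OF cK(1)] by auto
  qed
  have cyc: "digcycle ?cs"
    unfolding digcycle_def using suc inj cvs wvs cw' sub il dC[OF cC] by auto
  have "u \<in> set ?cs" if u: "adj w u" for u
  proof -
    consider "u \<in> K l" | m where "target w m" "u \<in> C m" using end_nbr[OF w u] by auto
    then show ?thesis
    proof cases
      case 1
      have "K l = {v l, w}" using pair[of l "v l" w] vw wV il by auto
      then show ?thesis using 1 il by auto
    next
      case 2
      have im: "i \<le> m" "m < l" using least 2 by (auto simp: target_def)
      show ?thesis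
      proof (cases "m = i")
        case True
        then show ?thesis using 2 Ci by auto
      next
        case False
        have "K m = {v m, v (Suc m)}"
          using pair[of m "v m" "v (Suc m)"] v_in_K[of m] v_next[of m] im by auto
        then have "u = v m" using 2 by auto
        then show ?thesis using False im by auto
      qed
    qed
  qed
  then show thesis using that[OF cyc, of w] by auto
qed

end

text \<open>For \<open>r = 1\<close> the chain always yields a Hamiltonian cycle of digons. Chords
  are forced from \<open>k = 3\<close> on, which leaves the cycle as a separate outcome for
  \<open>k = 2\<close>.\<close>

theorem (in regular_hard_cover) complete_or_cycle:
  "(card V = k * r + 1 \<and> (\<forall>u\<in>V. \<forall>w\<in>V. u \<noteq> w \<longrightarrow> (u, w) \<in> A)) \<or>
   (r = 1 \<and> k = 2 \<and> (\<exists>cs. distinct cs \<and> set cs = V \<and> 3 \<le> length cs \<and>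
      successively (\<lambda>u w. (u, w) \<in> A \<and> (w, u) \<in> A) cs \<and>
      (last cs, hd cs) \<in> A \<and> (hd cs, last cs) \<in> A))"
proof -
  obtain l f v where "exhausted_chain V A X E k r l f v" using exhausted_chain_exists by auto
  then interpret exhausted_chain V A X E k r l f v .
  show ?thesis
  proof (cases "2 \<le> r")
    case True
    then show ?thesis using complete_ge2 by blast
  next
    case False
    then have r1: "r = 1" using p_pos by simp
    obtain cs y where cy: "digcycle cs" "y \<in> set cs" "\<forall>u. adj y u \<longrightarrow> u \<in> set cs"
      by (rule closed_digcycle[OF r1])
    have V: "set cs = V" by (rule digcycle_closed[OF r1 cy(1,2)]) (use cy(3) in auto)
    show ?thesis
    proof (cases "k = 2")
      case True
      then show ?thesis using cy(1) V r1 unfolding digcycle_def by blast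
    next
      case False
      then have k3: "3 \<le> k" using k_ge2 by simp
      have dg: "dig u w" if uw: "u \<in> V" "w \<in> V" "u \<noteq> w" for u w
      proof -
        obtain as bs where cs: "cs = as @ u # bs" using uw V by (metis split_list)
        have "w \<in> set (bs @ as)" using uw V cs by auto
        then obtain ys zs where yz: "bs @ as = ys @ w # zs" by (metis split_list)
        have "digcycle (u # bs @ as)" using digcycle_rotate[of as "u # bs"] cy(1) cs by simp
        moreover have "set (u # bs @ as) = V" using V cs by auto
        ultimately show ?thesis using digcycle_dig[OF r1 k3, of u ys w zs] unfolding yz by blast
      qed
      have yV: "y \<in> V" using cy(2) V by auto
      have "{u \<in> V. (y, u) \<in> A} = V - {y}" using dg[OF yV] A_irrefl by auto
      then have "card (V - {y}) = k * r" using regular(1)[OF yV] by simp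
      then have "card V = k * r + 1" using yV finV by (metis Suc_eq_plus1 card_Suc_Diff1)
      then show ?thesis using dg by blast
    qed
  qed
qed

section \<open>From colourings to digraph properties\<close>

lemma pair_digraph_iff:
  "pair_digraph D \<longleftrightarrow>
     finite (pverts D) \<and> parcs D \<subseteq> pverts D \<times> pverts D \<and> (\<forall>v. (v, v) \<notin> parcs D)"
proof
  assume "pair_digraph D"
  then interpret pair_digraph D .
  show "finite (pverts D) \<and> parcs D \<subseteq> pverts D \<times> pverts D \<and> (\<forall>v. (v, v) \<notin> parcs D)"
    using pair_finite_verts in_arcsD1 in_arcsD2 pair_no_loops by fastforce
next
  assume a: "finite (pverts D) \<and> parcs D \<subseteq> pverts D \<times> pverts D \<and> (\<forall>v. (v, v) \<notin> parcs D)"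
  then have "finite (parcs D)" by (meson finite_SigmaI finite_subset)
  with a show "pair_digraph D" by unfold_locales auto
qed

lemma pair_digraph_pair_induce: "pair_digraph D \<Longrightarrow> S \<subseteq> pverts D \<Longrightarrow> pair_digraph (pair_induce D S)"
  by (auto simp: pair_digraph_iff pair_induce_def dest: finite_subset)

lemma pverts_pair_induce [simp]: "pverts (pair_induce D S) = S"
  by (simp add: pair_induce_def)

lemma parcs_pair_induce [simp]: "(u, v) \<in> parcs (pair_induce D S) \<longleftrightarrow> (u, v) \<in> parcs D \<and> u \<in> S \<and> v \<in> S"
  by (simp add: pair_induce_def)

lemma pair_induce_induce: "S \<subseteq> T \<Longrightarrow> pair_induce (pair_induce D T) S = pair_induce D S"
  by (auto simp: pair_induce_def)

lemma pair_induce_self: "pair_digraph D \<Longrightarrow> pair_induce D (pverts D) = D"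
  by (intro pair_pre_digraph.equality) (auto simp: pair_digraph_iff pair_induce_def)

lemma wf_of_pair_digraph: "pair_digraph D \<Longrightarrow> wf_digraph (with_proj D)"
  by (auto simp: wf_digraph_wp_iff pair_digraph_iff intro!: pair_wf_digraph.intro)

lemma subgraph_pair_iff:
  "pair_digraph D \<Longrightarrow> pair_digraph E \<Longrightarrow>
     subgraph (with_proj E) (with_proj D) \<longleftrightarrow> pverts E \<subseteq> pverts D \<and> parcs E \<subseteq> parcs D"
  by (auto simp: subgraph_def compatible_def wf_of_pair_digraph)

lemma induced_pair_iff:
  assumes "pair_digraph D"
  shows "induced_subgraph (with_proj E) (with_proj D) \<longleftrightarrow>
    pverts E \<subseteq> pverts D \<and> E = pair_induce D (pverts E)" (is "?l \<longleftrightarrow> ?r")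
proof
  assume ?l
  then have "pverts E \<subseteq> pverts D" "parcs E = {(u, v) \<in> parcs D. u \<in> pverts E \<and> v \<in> pverts E}"
    by (auto simp: induced_subgraph_def subgraph_def)
  then show ?r by (simp add: pair_induce_def)
next
  assume r: ?r
  note r1 = conjunct1[OF r] and r2 = conjunct2[OF r]
  have "pair_digraph (pair_induce D (pverts E))" by (rule pair_digraph_pair_induce[OF assms r1])
  then have E: "pair_digraph E" by (subst r2)
  have arcs: "parcs E = {(u, v) \<in> parcs D. u \<in> pverts E \<and> v \<in> pverts E}"
    using arg_cong[OF r2, of parcs] by (simp add: pair_induce_def)
  then have "subgraph (with_proj E) (with_proj D)"
    using subgraph_pair_iff[OF assms E] r1 by auto
  then show ?l using arcs by (auto simp: induced_subgraph_def)
qed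

lemma out_degree_card: "out_degree (with_proj D) v = card {u. (v, u) \<in> parcs D}"
proof -
  have "out_arcs (with_proj D) v = Pair v ` {u. (v, u) \<in> parcs D}"
    by (auto simp: out_arcs_def)
  then show ?thesis by (simp add: out_degree_def card_image inj_on_def)
qed

lemma in_degree_card: "in_degree (with_proj D) v = card {u. (u, v) \<in> parcs D}"
proof -
  have "in_arcs (with_proj D) v = (\<lambda>u. (u, v)) ` {u. (u, v) \<in> parcs D}"
    by (auto simp: in_arcs_def)
  then show ?thesis by (simp add: in_degree_def card_image inj_on_def)
qed

section \<open>Isomorphic copies of digraphs\<close>

definition map_digraph :: "('v \<Rightarrow> 'w) \<Rightarrow> 'v pair_pre_digraph \<Rightarrow> 'w pair_pre_digraph" where
  "map_digraph g D = \<lparr>pverts = g ` pverts D, parcs = (\<lambda>(u, v). (g u, g v)) ` parcs D\<rparr>"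

lemma map_digraph_simps [simp]:
  "pverts (map_digraph g D) = g ` pverts D"
  "parcs (map_digraph g D) = (\<lambda>(u, v). (g u, g v)) ` parcs D"
  by (simp_all add: map_digraph_def)

lemma pair_digraph_map:
  assumes "pair_digraph D" "inj_on g (pverts D)"
  shows "pair_digraph (map_digraph g D)"
  using assms unfolding pair_digraph_iff by (fastforce dest: inj_onD)

lemma digraph_iso_map:
  assumes "pair_digraph D" "inj_on g (pverts D)"
  shows "digraph_iso (with_proj D) (with_proj (map_digraph g D))"
proof -
  let ?f = "\<lparr>iso_verts = g, iso_arcs = (\<lambda>(u, v). (g u, g v)), iso_head = snd, iso_tail = fst\<rparr>"
  have "inj_on (\<lambda>(u, v). (g u, g v)) (parcs D)"
  proof (rule inj_onI)
    fix e e' assume e: "e \<in> parcs D" "e' \<in> parcs D"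
      and eq: "(\<lambda>(u, v). (g u, g v)) e = (\<lambda>(u, v). (g u, g v)) e'"
    have "e \<in> pverts D \<times> pverts D" "e' \<in> pverts D \<times> pverts D" using e assms(1) by (auto simp: pair_digraph_iff)
    then show "e = e'" using eq inj_onD[OF assms(2)] by (cases e, cases e') auto
  qed
  then have "pre_digraph.digraph_isomorphism (with_proj D) ?f"
    using assms wf_of_pair_digraph[OF assms(1)]
    by (auto simp: pre_digraph.digraph_isomorphism_def)
  moreover have "with_proj (map_digraph g D) = app_iso ?f (with_proj D)"
    by (simp add: app_iso_def with_proj_def)
  ultimately show ?thesis unfolding digraph_iso_def by blast
qed

text \<open>The isomorphism is the inverse of \<open>h\<close>. Starting from a bijection out of
  \<open>B\<close> suits the model digraphs on \<open>{..<n}\<close>, whose vertex type differs from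
  that of \<open>D\<close>.\<close>

lemma digraph_iso_bij:
  assumes D: "pair_digraph D" and h: "bij_betw h (pverts B) (pverts D)"
    and B: "parcs B \<subseteq> pverts B \<times> pverts B"
    and arcs: "\<And>i j. i \<in> pverts B \<Longrightarrow> j \<in> pverts B \<Longrightarrow> (i, j) \<in> parcs B \<longleftrightarrow> (h i, h j) \<in> parcs D"
  shows "digraph_iso (with_proj D) (with_proj B)"
proof -
  let ?g = "the_inv_into (pverts B) h"
  have inj: "inj_on h (pverts B)" and img: "h ` pverts B = pverts D"
    using h by (auto simp: bij_betw_def)
  have g: "?g (h i) = i" if "i \<in> pverts B" for i by (rule the_inv_into_f_f[OF inj that])
  have hg: "h (?g v) = v" "?g v \<in> pverts B" if "v \<in> pverts D" for v
    using that f_the_inv_into_f[OF inj, of v] the_inv_into_into[OF inj, of v "pverts B"] img by auto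
  have "pverts (map_digraph ?g D) = pverts B"
    using g img by (auto simp: image_image simp flip: img)
  moreover have "parcs (map_digraph ?g D) = parcs B"
  proof (intro set_eqI iffI)
    fix e assume "e \<in> parcs (map_digraph ?g D)"
    then obtain u v where uv: "(u, v) \<in> parcs D" "e = (?g u, ?g v)" by auto
    then have "u \<in> pverts D" "v \<in> pverts D" using D by (auto simp: pair_digraph_iff)
    then show "e \<in> parcs B" using uv hg[of u] hg[of v] arcs by auto
  next
    fix e assume e: "e \<in> parcs B"
    then obtain i j where ij: "e = (i, j)" "i \<in> pverts B" "j \<in> pverts B" using B by auto
    then have "(h i, h j) \<in> parcs D" using arcs e by auto
    moreover have "e = (?g (h i), ?g (h j))" using ij g by auto
    ultimately show "e \<in> parcs (map_digraph ?g D)" by (auto intro: rev_image_eqI)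
  qed
  ultimately have "map_digraph ?g D = B" by (intro pair_pre_digraph.equality) auto
  moreover have "inj_on ?g (pverts D)" using inj_on_the_inv_into[OF inj] img by simp
  ultimately show ?thesis using digraph_iso_map[OF D] by metis
qed

text \<open>Reachability in the symmetric closure cannot leave a set that has no edges to the
  outside.\<close>

lemma connected_linked:
  assumes "Digraph_Component.connected (with_proj D)"
  shows "pverts D \<noteq> {}" "linked (\<lambda>u v. (u, v) \<in> parcs D \<or> (v, u) \<in> parcs D) (pverts D)"
proof -
  let ?M = "mk_symmetric (with_proj D)"
  have sc: "strongly_connected (with_proj ?M)" using assms by (simp add: connected_def)
  then show "pverts D \<noteq> {}" by (simp add: strongly_connected_def)
  show "linked (\<lambda>u v. (u, v) \<in> parcs D \<or> (v, u) \<in> parcs D) (pverts D)"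
    unfolding linked_def
  proof (intro allI impI, elim conjE, rule ccontr)
    fix Z assume Z: "Z \<noteq> {}" "Z \<subset> pverts D"
      and no: "\<not> (\<exists>u\<in>Z. \<exists>w\<in>pverts D - Z. (u, w) \<in> parcs D \<or> (w, u) \<in> parcs D)"
    obtain u w where uw: "u \<in> Z" "w \<in> pverts D" "w \<notin> Z" using Z by auto
    have "u \<rightarrow>\<^sup>*\<^bsub>with_proj ?M\<^esub> w" using sc uw Z by (auto simp: strongly_connected_def)
    then have "(u, w) \<in> rtrancl_on (pverts D) (parcs ?M)" by (simp add: reachable_def)
    then have "w \<in> Z"
    proof (induction rule: rtrancl_on_induct)
      case (step y z)
      then have "(y, z) \<in> parcs D \<or> (z, y) \<in> parcs D" by (auto simp: parcs_mk_symmetric)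
      then show ?case using no step by blast
    qed (use uw in simp)
    then show False using uw by simp
  qed
qed

lemma card_le_max_degree:
  assumes "pair_digraph D" "v \<in> pverts D"
  shows "card {u. (v, u) \<in> parcs D} \<le> max_out_degree D" "card {u. (u, v) \<in> parcs D} \<le> max_in_degree D"
  using assms unfolding max_out_degree_def max_in_degree_def out_degree_card in_degree_card
  by (auto intro!: Max_ge simp: pair_digraph_iff)

lemma card_ge_CR:
  assumes "F \<in> CR \<D>" "v \<in> pverts F"
  shows "d_out \<D> \<le> card {u. (v, u) \<in> parcs F}" "d_in \<D> \<le> card {u. (u, v) \<in> parcs F}"
proof -
  have fin: "finite (pverts F)" using assms by (auto simp: CR_def pair_digraph_iff)
  have "d_out \<D> \<le> min_out_degree F" "d_in \<D> \<le> min_in_degree F"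
    unfolding d_out_def d_in_def using assms(1) by (auto intro!: cINF_lower)
  moreover have "min_out_degree F \<le> card {u. (v, u) \<in> parcs F}" "min_in_degree F \<le> card {u. (u, v) \<in> parcs F}"
    unfolding min_out_degree_def min_in_degree_def out_degree_card in_degree_card
    using fin assms(2) by (auto intro!: Min_le)
  ultimately show "d_out \<D> \<le> card {u. (v, u) \<in> parcs F}" "d_in \<D> \<le> card {u. (u, v) \<in> parcs F}"
    by auto
qed

section \<open>Colourability by covers and its translation\<close>

text \<open>The predicate under \<open>LEAST\<close> in \<open>dp_chromatic\<close>. It is monotone
  in \<open>k\<close>, since \<open>k_cover\<close> bounds the colour sets from below only.\<close>

definition dp_colourable :: "'a pair_pre_digraph set \<Rightarrow> 'a pair_pre_digraph \<Rightarrow> nat \<Rightarrow> bool" where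
  "dp_colourable \<D> D k \<longleftrightarrow> (\<forall>X H. k_cover k D X H \<longrightarrow> (\<exists>T. transversal \<D> D X H T))"

lemma dp_colourable_mono: "dp_colourable \<D> D k \<Longrightarrow> k \<le> k' \<Longrightarrow> dp_colourable \<D> D k'"
  unfolding dp_colourable_def k_cover_def by (meson le_trans)

lemma dp_chromatic_le: "dp_colourable \<D> D k \<Longrightarrow> dp_chromatic \<D> D \<le> k"
  unfolding dp_chromatic_def dp_colourable_def by (rule Least_le)

lemma k_cover_colour_cover:
  assumes D: "pair_digraph D" and H: "k_cover k D X H"
  shows "colour_cover (pverts D) (parcs D) X (parcs H) k"
proof -
  have H': "pair_digraph H" and disj: "\<And>u v. u \<in> pverts D \<Longrightarrow> v \<in> pverts D \<Longrightarrow> u \<noteq> v \<Longrightarrow> X u \<inter> X v = {}"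
    and un: "(\<Union>v\<in>pverts D. X v) = pverts H"
    and ind: "\<And>v. v \<in> pverts D \<Longrightarrow> arcs_between H (X v) (X v) = {}"
    and bet: "\<And>u v. u \<in> pverts D \<Longrightarrow> v \<in> pverts D \<Longrightarrow> u \<noteq> v \<Longrightarrow>
        (if (u, v) \<in> parcs D then arc_matching (arcs_between H (X u) (X v))
         else arcs_between H (X u) (X v) = {})"
    and size: "\<And>v. v \<in> pverts D \<Longrightarrow> k \<le> card (X v)"
    using H unfolding k_cover_def cover_def independent_in_def by blast+
  have arc: "u \<noteq> v \<and> (u, v) \<in> parcs D \<and> (x, y) \<in> arcs_between H (X u) (X v) \<and> arc_matching (arcs_between H (X u) (X v))"
    if "u \<in> pverts D" "v \<in> pverts D" "x \<in> X u" "y \<in> X v" "(x, y) \<in> parcs H" for u v x y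
  proof -
    have m: "(x, y) \<in> arcs_between H (X u) (X v)" using that by (auto simp: arcs_between_def)
    then have "u \<noteq> v" using ind that(1) by auto
    then show ?thesis using bet[OF that(1,2)] m by (auto split: if_splits)
  qed
  show ?thesis
  proof
    show "finite (pverts D)" "parcs D \<subseteq> pverts D \<times> pverts D" "\<And>v. (v, v) \<notin> parcs D"
      using D by (auto simp: pair_digraph_iff)
    fix v assume v: "v \<in> pverts D"
    have "X v \<subseteq> pverts H" using un v by auto
    then show "finite (X v)" using H' finite_subset by (auto simp: pair_digraph_iff)
    show "k \<le> card (X v)" by (rule size[OF v])
  next
    fix u v x y assume "u \<in> pverts D" "v \<in> pverts D" "x \<in> X u" "y \<in> X v" "(x, y) \<in> parcs H"
    then show "(u, v) \<in> parcs D" using arc by blast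
  next
    fix u v x y y' assume "u \<in> pverts D" "v \<in> pverts D" "x \<in> X u" "y \<in> X v" "y' \<in> X v"
      "(x, y) \<in> parcs H" "(x, y') \<in> parcs H"
    then show "y = y'" using arc[of u v x y] arc[of u v x y'] unfolding arc_matching_def by fastforce
  next
    fix u v x x' y assume "u \<in> pverts D" "v \<in> pverts D" "x \<in> X u" "x' \<in> X u" "y \<in> X v"
      "(x, y) \<in> parcs H" "(x', y) \<in> parcs H"
    then show "x = x'" using arc[of u v x y] arc[of u v x' y] unfolding arc_matching_def by fastforce
  qed
qed

lemma cover_choice:
  assumes D: "pair_digraph D" and H: "k_cover k D X H" and phi: "\<And>v. v \<in> pverts D \<Longrightarrow> \<phi> v \<in> X v"
  shows "inj_on \<phi> (pverts D)" "\<phi> ` pverts D \<subseteq> pverts H" "pair_digraph H"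
    and "pair_induce H (\<phi> ` pverts D) \<in> \<D> \<Longrightarrow> transversal \<D> D X H (\<phi> ` pverts D)"
proof -
  have disj: "\<And>u v. u \<in> pverts D \<Longrightarrow> v \<in> pverts D \<Longrightarrow> u \<noteq> v \<Longrightarrow> X u \<inter> X v = {}"
    and un: "(\<Union>v\<in>pverts D. X v) = pverts H" and H': "pair_digraph H"
    using H unfolding k_cover_def cover_def by blast+
  show "pair_digraph H" by (rule H')
  show inj: "inj_on \<phi> (pverts D)" using disj phi by (intro inj_onI) (metis disjoint_iff)
  show sub: "\<phi> ` pverts D \<subseteq> pverts H" using un phi by auto
  have "\<phi> ` pverts D \<inter> X v = {\<phi> v}" if "v \<in> pverts D" for v
    using disj[OF _ that] phi that by fastforce
  then show "transversal \<D> D X H (\<phi> ` pverts D)" if "pair_induce H (\<phi> ` pverts D) \<in> \<D>"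
    using sub that unfolding transversal_def by simp
qed

context
  fixes \<D> :: "'a::infinite pair_pre_digraph set"
  assumes rel: "strongly_reliable \<D>" and out1: "1 \<le> d_out \<D>" and in1: "1 \<le> d_in \<D>"
begin

lemma member_digraph: "D \<in> \<D> \<Longrightarrow> pair_digraph D"
  using rel by (auto simp: strongly_reliable_def digraph_property_def)

lemma induce_member: "D \<in> \<D> \<Longrightarrow> S \<subseteq> pverts D \<Longrightarrow> pair_induce D S \<in> \<D>"
  using rel member_digraph[of D] induced_pair_iff[of D "pair_induce D S"]
  by (auto simp: strongly_reliable_def hereditary_def)

lemma empty_member: "pair_digraph D \<Longrightarrow> pverts D = {} \<Longrightarrow> D \<in> \<D>"
proof -
  assume D: "pair_digraph D" "pverts D = {}"
  obtain D0 where "D0 \<in> \<D>" using rel by (auto simp: strongly_reliable_def nontrivial_def)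
  then have "pair_induce D0 {} \<in> \<D>" by (rule induce_member) simp
  moreover have "pair_induce D0 {} = D"
    using D by (intro pair_pre_digraph.equality) (auto simp: pair_induce_def pair_digraph_iff)
  ultimately show ?thesis by simp
qed

lemma map_member: "D \<in> \<D> \<Longrightarrow> inj_on g (pverts D) \<Longrightarrow> map_digraph g D \<in> \<D>"
  using rel member_digraph[of D] digraph_iso_map[of D g] pair_digraph_map[of D g]
  unfolding strongly_reliable_def digraph_property_def by blast

text \<open>\<open>F\<close> is a subdigraph of the copy of \<open>D\<close> under \<open>g\<close>,
  so closure under isomorphism and monotonicity apply.\<close>

lemma sub_image_member:
  assumes D: "D \<in> \<D>" and inj: "inj_on g (pverts D)" and F: "pair_digraph F" "pverts F = g ` pverts D"
    and arcs: "\<And>u v. u \<in> pverts D \<Longrightarrow> v \<in> pverts D \<Longrightarrow> (g u, g v) \<in> parcs F \<Longrightarrow> (u, v) \<in> parcs D"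
  shows "F \<in> \<D>"
proof -
  have "parcs F \<subseteq> parcs (map_digraph g D)"
  proof
    fix e assume e: "e \<in> parcs F"
    then have "e \<in> g ` pverts D \<times> g ` pverts D" using F by (auto simp: pair_digraph_iff)
    then obtain u v where uv: "e = (g u, g v)" "u \<in> pverts D" "v \<in> pverts D" by auto
    then have "(u, v) \<in> parcs D" using arcs e by auto
    then show "e \<in> parcs (map_digraph g D)" using uv by (auto intro: rev_image_eqI)
  qed
  then have "subgraph (with_proj F) (with_proj (map_digraph g D))"
    using subgraph_pair_iff[OF pair_digraph_map[OF member_digraph[OF D] inj] F(1)] F(2) by simp
  then show ?thesis
    using rel map_member[OF D inj] unfolding strongly_reliable_def monotone_property_def by blast
qed

text \<open>A vertex set of least size inducing a non-member works; it is nonempty because the empty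
  digraph is a member.\<close>

lemma critical_subdigraph:
  assumes F: "pair_digraph F" "F \<notin> \<D>"
  obtains U where "U \<subseteq> pverts F" "U \<noteq> {}" "pair_induce F U \<in> CR \<D>"
proof -
  let ?P = "\<lambda>U. U \<subseteq> pverts F \<and> pair_induce F U \<notin> \<D>"
  have "?P (pverts F)" using F(2) pair_induce_self[OF F(1)] by simp
  then obtain U where U: "?P U" "\<And>U'. ?P U' \<Longrightarrow> card U \<le> card U'"
    using ex_has_least_nat[of ?P "pverts F" card] by blast
  have finU: "finite U" using U F finite_subset by (auto simp: pair_digraph_iff)
  have pd: "pair_digraph (pair_induce F U)" using U pair_digraph_pair_induce F by auto
  have "pair_induce F (U - {v}) \<in> \<D>" if v: "v \<in> U" for v
  proof (rule ccontr)
    assume "\<not> ?thesis"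
    then have "card U \<le> card (U - {v})" using U by blast
    then show False using v finU by (metis card_Diff1_less not_le)
  qed
  then have "pair_induce F U \<in> CR \<D>"
    using U pd by (auto simp: CR_def pair_induce_induce)
  moreover have "U \<noteq> {}" using empty_member[OF pd] U by auto
  ultimately show thesis using that U by auto
qed

lemma degenerate_member:
  assumes F: "pair_digraph F"
    and deg: "\<And>U. U \<subseteq> pverts F \<Longrightarrow> U \<noteq> {} \<Longrightarrow>
      \<exists>v\<in>U. card {u \<in> U. (v, u) \<in> parcs F} < d_out \<D> \<or> card {u \<in> U. (u, v) \<in> parcs F} < d_in \<D>"
  shows "F \<in> \<D>"
proof (rule ccontr)
  assume "F \<notin> \<D>"
  then obtain U where U: "U \<subseteq> pverts F" "U \<noteq> {}" "pair_induce F U \<in> CR \<D>"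
    using critical_subdigraph[OF F] by metis
  obtain v where v: "v \<in> U"
    "card {u \<in> U. (v, u) \<in> parcs F} < d_out \<D> \<or> card {u \<in> U. (u, v) \<in> parcs F} < d_in \<D>"
    using deg[OF U(1,2)] by auto
  have "{u. (v, u) \<in> parcs (pair_induce F U)} = {u \<in> U. (v, u) \<in> parcs F}"
    "{u. (u, v) \<in> parcs (pair_induce F U)} = {u \<in> U. (u, v) \<in> parcs F}"
    using v(1) by auto
  then show False using card_ge_CR[OF U(3), of v] v by auto
qed

lemma good_transversal:
  assumes D: "pair_digraph D" and H: "k_cover k D X H"
    and g: "colour_cover.good X (parcs H) (d_out \<D>) (d_in \<D>) \<phi> (pverts D)"
  shows "\<exists>T. transversal \<D> D X H T"
proof -
  interpret colour_cover "pverts D" "parcs D" X "parcs H" k "d_out \<D>" "d_in \<D>"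
    by (rule k_cover_colour_cover[OF D H])
  have phi: "\<And>v. v \<in> pverts D \<Longrightarrow> \<phi> v \<in> X v" and dg: "dgn \<phi> (pverts D)"
    using g by (auto simp: good_def col_def)
  note cc = cover_choice[OF D H phi]
  have "pair_induce H (\<phi> ` pverts D) \<in> \<D>"
  proof (rule degenerate_member)
    show "pair_digraph (pair_induce H (\<phi> ` pverts D))" using pair_digraph_pair_induce cc by auto
    fix U assume U: "U \<subseteq> pverts (pair_induce H (\<phi> ` pverts D))" "U \<noteq> {}"
    define W where "W = {v \<in> pverts D. \<phi> v \<in> U}"
    have W: "W \<subseteq> pverts D" "U = \<phi> ` W" "W \<noteq> {}" using U by (auto simp: W_def)
    have finW: "finite W" using W finite_sub by auto
    obtain v where v: "v \<in> W" "card (out \<phi> (\<phi> v) W) < d_out \<D> \<or> card (inn \<phi> (\<phi> v) W) < d_in \<D>"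
      using dg W unfolding degen_def by blast
    let ?F = "pair_induce H (\<phi> ` pverts D)"
    have "{u \<in> U. (\<phi> v, u) \<in> parcs ?F} \<subseteq> \<phi> ` out \<phi> (\<phi> v) W"
      "{u \<in> U. (u, \<phi> v) \<in> parcs ?F} \<subseteq> \<phi> ` inn \<phi> (\<phi> v) W"
      using W by auto
    then have "card {u \<in> U. (\<phi> v, u) \<in> parcs ?F} \<le> card (out \<phi> (\<phi> v) W)"
      "card {u \<in> U. (u, \<phi> v) \<in> parcs ?F} \<le> card (inn \<phi> (\<phi> v) W)"
      using finW by (meson card_image_le card_mono finite_imageI finite_nbs le_trans)+
    then have "card {u \<in> U. (\<phi> v, u) \<in> parcs ?F} < d_out \<D> \<or> card {u \<in> U. (u, \<phi> v) \<in> parcs ?F} < d_in \<D>"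
      using v(2) by linarith
    moreover have "\<phi> v \<in> U" using v(1) by (simp add: W_def)
    ultimately show "\<exists>v\<in>U. card {u \<in> U. (v, u) \<in> parcs ?F} < d_out \<D> \<or> card {u \<in> U. (u, v) \<in> parcs ?F} < d_in \<D>"
      by blast
  qed
  then show ?thesis using cc(4) by blast
qed

lemma degenerate_colourable:
  assumes D: "pair_digraph D"
    and deg: "\<And>U. U \<subseteq> pverts D \<Longrightarrow> U \<noteq> {} \<Longrightarrow>
      \<exists>v\<in>U. card {u \<in> U. (v, u) \<in> parcs D} < k * d_out \<D> \<or> card {u \<in> U. (u, v) \<in> parcs D} < k * d_in \<D>"
  shows "dp_colourable \<D> D k"
  unfolding dp_colourable_def
proof (intro allI impI)
  fix X H assume H: "k_cover k D X H"
  interpret colour_cover "pverts D" "parcs D" X "parcs H" k "d_out \<D>" "d_in \<D>"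
    by (rule k_cover_colour_cover[OF D H])
  have "\<exists>\<psi>. (\<forall>u\<in>{}. \<psi> u = undefined u) \<and> good \<psi> (pverts D)"
  proof (rule greedy)
    show "good undefined {}" by (simp add: good_def col_def degen_def)
    fix U assume "U \<subseteq> pverts D - {}" "U \<noteq> {}"
    then show "\<exists>u\<in>U. card {w \<in> {} \<union> U. (u, w) \<in> parcs D} < k * d_out \<D> \<or>
        card {w \<in> {} \<union> U. (w, u) \<in> parcs D} < k * d_in \<D>"
      using deg[of U] by simp
  qed auto
  then show "\<exists>T. transversal \<D> D X H T" using good_transversal[OF D H] by blast
qed

text \<open>With more colours than vertices no degree reaches its bound. This makes the
  \<open>LEAST\<close> in \<open>dp_chromatic\<close> meaningful.\<close>

lemma colourable_exists:
  assumes D: "pair_digraph D"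
  shows "\<exists>k. dp_colourable \<D> D k"
proof (rule exI, rule degenerate_colourable[OF D])
  fix U assume U: "U \<subseteq> pverts D" "U \<noteq> {}"
  then obtain v where v: "v \<in> U" by auto
  have fin: "finite (pverts D)" using D by (simp add: pair_digraph_iff)
  have "card {u \<in> U. (v, u) \<in> parcs D} \<le> card (pverts D)"
    using U fin by (intro card_mono) auto
  also have "\<dots> < Suc (card (pverts D)) * 1" by simp
  also have "\<dots> \<le> Suc (card (pverts D)) * d_out \<D>" by (rule mult_le_mono2[OF out1])
  finally show "\<exists>v\<in>U. card {u \<in> U. (v, u) \<in> parcs D} < Suc (card (pverts D)) * d_out \<D> \<or>
      card {u \<in> U. (u, v) \<in> parcs D} < Suc (card (pverts D)) * d_in \<D>"
    using v by auto
qed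

lemma less_dp_chromatic:
  assumes D: "pair_digraph D" and k: "\<not> dp_colourable \<D> D k"
  shows "k < dp_chromatic \<D> D"
proof (rule ccontr)
  assume "\<not> ?thesis"
  moreover have "dp_colourable \<D> D (dp_chromatic \<D> D)"
    using colourable_exists[OF D] unfolding dp_chromatic_def dp_colourable_def
    by (rule LeastI_ex)
  ultimately show False using k dp_colourable_mono[of \<D> D _ k] by auto
qed

text \<open>Arcs of the cover lie above arcs of \<open>D\<close>, so the part chosen over
  \<open>S\<close> is a copy of a subdigraph of \<open>pair_induce D S\<close>.\<close>

lemma member_choice:
  assumes D: "pair_digraph D" and H: "k_cover k D X H" and phi: "\<And>v. v \<in> pverts D \<Longrightarrow> \<phi> v \<in> X v"
    and S: "S \<subseteq> pverts D" "pair_induce D S \<in> \<D>"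
  shows "pair_induce H (\<phi> ` S) \<in> \<D>"
proof -
  interpret colour_cover "pverts D" "parcs D" X "parcs H" k "d_out \<D>" "d_in \<D>"
    by (rule k_cover_colour_cover[OF D H])
  note cc = cover_choice[OF D H phi]
  show ?thesis
  proof (rule sub_image_member[OF S(2)])
    show "inj_on \<phi> (pverts (pair_induce D S))" using inj_on_subset[OF cc(1)] S by simp
    show "pair_digraph (pair_induce H (\<phi> ` S))"
      using cc(2,3) S by (intro pair_digraph_pair_induce) auto
    show "pverts (pair_induce H (\<phi> ` S)) = \<phi> ` pverts (pair_induce D S)" by simp
    fix u v assume "u \<in> pverts (pair_induce D S)" "v \<in> pverts (pair_induce D S)"
      "(\<phi> u, \<phi> v) \<in> parcs (pair_induce H (\<phi> ` S))"
    then show "(u, v) \<in> parcs (pair_induce D S)" using E_arc[of u v "\<phi> u" "\<phi> v"] S phi by auto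
  qed
qed

lemma member_colourable:
  assumes "D \<in> \<D>"
  shows "dp_colourable \<D> D 1"
  unfolding dp_colourable_def
proof (intro allI impI)
  fix X H assume H: "k_cover 1 D X H"
  have D: "pair_digraph D" by (rule member_digraph[OF assms])
  have "\<exists>x. x \<in> X v" if "v \<in> pverts D" for v
    using H that unfolding k_cover_def by (metis card.empty ex_in_conv not_one_le_zero)
  then obtain \<phi> where phi: "\<And>v. v \<in> pverts D \<Longrightarrow> \<phi> v \<in> X v" by metis
  have "pair_induce H (\<phi> ` pverts D) \<in> \<D>"
    using member_choice[OF D H phi order_refl] pair_induce_self[OF D] assms by simp
  then show "\<exists>T. transversal \<D> D X H T" using cover_choice(4)[OF D H phi] by blast
qed

text \<open>A disjoint copy of \<open>D\<close>, with one colour per vertex, is a 1-cover whose only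
  possible transversal induces that copy. The infinite vertex type has room for it.\<close>

lemma non_member_not_colourable:
  assumes D: "pair_digraph D" "D \<notin> \<D>"
  shows "\<not> dp_colourable \<D> D 1"
proof
  assume col: "dp_colourable \<D> D 1"
  let ?V = "pverts D"
  have fin: "finite ?V" using D by (simp add: pair_digraph_iff)
  then have "infinite (UNIV - ?V)" using infinite_UNIV by (rule Diff_infinite_finite)
  then obtain B where B: "finite B" "card B = card ?V" "B \<subseteq> UNIV - ?V"
    using infinite_arbitrarily_large by blast
  obtain h where h: "bij_betw h ?V B" using finite_same_card_bij[OF fin B(1)] B(2) by auto
  have inj: "inj_on h ?V" and hB: "h ` ?V = B" using h by (auto simp: bij_betw_def)
  let ?H = "map_digraph h D" and ?X = "\<lambda>v. {h v}"
  have H: "pair_digraph ?H" by (rule pair_digraph_map[OF D(1) inj])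
  have arcs: "(h u, h v) \<in> parcs ?H \<longleftrightarrow> (u, v) \<in> parcs D" if "u \<in> ?V" "v \<in> ?V" for u v
  proof
    assume "(h u, h v) \<in> parcs ?H"
    then obtain a b where ab: "(a, b) \<in> parcs D" "h u = h a" "h v = h b" by auto
    then have "a \<in> ?V" "b \<in> ?V" using D(1) by (auto simp: pair_digraph_iff)
    then show "(u, v) \<in> parcs D" using ab inj_onD[OF inj, of u a] inj_onD[OF inj, of v b] that by simp
  next
    assume "(u, v) \<in> parcs D"
    then show "(h u, h v) \<in> parcs ?H"
      using image_eqI[of "(h u, h v)" "\<lambda>(u, v). (h u, h v)" "(u, v)" "parcs D"] by simp
  qed
  have "k_cover 1 D ?X ?H"
    unfolding k_cover_def cover_def
  proof (intro conjI ballI impI)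
    show "pverts ?H \<inter> ?V = {}" using B hB by auto
    show "(\<Union>v\<in>?V. {h v}) = pverts ?H" by auto
    fix u v assume uv: "u \<in> ?V" "v \<in> ?V" "u \<noteq> v"
    show "{h u} \<inter> {h v} = {}" using inj uv by (auto dest: inj_onD)
    show "if (u, v) \<in> parcs D then arc_matching (arcs_between ?H {h u} {h v})
        else arcs_between ?H {h u} {h v} = {}"
      using arcs[OF uv(1,2)]
      by (auto simp: arc_matching_def arcs_between_def simp del: map_digraph_simps(2))
  next
    fix v assume v: "v \<in> ?V"
    show "independent_in ?H {h v}"
      using arcs[OF v v] D(1) by (auto simp: independent_in_def arcs_between_def pair_digraph_iff simp del: map_digraph_simps(2))
  qed (use H in auto)
  then obtain T where T: "transversal \<D> D ?X ?H T" using col unfolding dp_colourable_def by blast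
  have "h v \<in> T" if "v \<in> ?V" for v
  proof (rule ccontr)
    assume "h v \<notin> T"
    then have "T \<inter> {h v} = {}" by auto
    then show False using T that by (auto simp: transversal_def)
  qed
  then have "T = pverts ?H" using T by (auto simp: transversal_def)
  then have "?H \<in> \<D>" using T pair_induce_self[OF H] by (simp add: transversal_def)
  moreover have "digraph_iso (with_proj ?H) (with_proj D)"
    by (rule digraph_iso_bij[OF H, of h])
      (use inj arcs D(1) in \<open>auto simp: bij_betw_def pair_digraph_iff simp del: map_digraph_simps(2)\<close>)
  ultimately show False using rel D unfolding strongly_reliable_def digraph_property_def by blast
qed

text \<open>A critical digraph gets a transversal from any 2-cover: fix a colour at one vertex and let
  the other vertices avoid its out-neighbours. That colour then has out-degree 0, so it lies in
  no critical subdigraph.\<close>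

lemma critical_2_colourable:
  assumes CR: "D \<in> CR \<D>"
  shows "dp_colourable \<D> D 2"
  unfolding dp_colourable_def
proof (intro allI impI)
  fix X H assume H: "k_cover 2 D X H"
  have D: "pair_digraph D" "D \<notin> \<D>" and Dv: "\<And>v. v \<in> pverts D \<Longrightarrow> pair_induce D (pverts D - {v}) \<in> \<D>"
    using CR by (auto simp: CR_def)
  interpret colour_cover "pverts D" "parcs D" X "parcs H" 2 "d_out \<D>" "d_in \<D>"
    by (rule k_cover_colour_cover[OF D(1) H])
  obtain v where v: "v \<in> pverts D" using empty_member[OF D(1)] D(2) by auto
  have "X v \<noteq> {}" using cardX[OF v] by auto
  then obtain x where x: "x \<in> X v" by auto
  have "\<exists>y\<in>X u. (x, y) \<notin> parcs H" if u: "u \<in> pverts D" for u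
  proof (rule ccontr)
    assume "\<not> ?thesis"
    then have "\<forall>y\<in>X u. \<forall>y'\<in>X u. y = y'" using E_out[OF v u x] by blast
    then have "card (X u) \<le> Suc 0" using card_le_Suc0_iff_eq[OF finX[OF u]] by blast
    then show False using cardX[OF u] by simp
  qed
  then obtain h where h: "\<And>u. u \<in> pverts D \<Longrightarrow> h u \<in> X u \<and> (x, h u) \<notin> parcs H" by metis
  define \<phi> where "\<phi> = h(v := x)"
  have phi: "\<phi> u \<in> X u" if "u \<in> pverts D" for u using h that x by (auto simp: \<phi>_def)
  have nx: "(x, \<phi> u) \<notin> parcs H" if "u \<in> pverts D" for u
    using h[OF that] no_loop[OF v x x] by (auto simp: \<phi>_def)
  note cc = cover_choice[OF D(1) H phi]
  let ?F = "pair_induce H (\<phi> ` pverts D)"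
  have F: "pair_digraph ?F" using cc by (intro pair_digraph_pair_induce) auto
  have "?F \<in> \<D>"
  proof (rule ccontr)
    assume "?F \<notin> \<D>"
    then obtain U where U: "U \<subseteq> pverts ?F" "U \<noteq> {}" "pair_induce ?F U \<in> CR \<D>"
      using critical_subdigraph[OF F] by metis
    have "x \<notin> U"
    proof
      assume xU: "x \<in> U"
      have "{u. (x, u) \<in> parcs (pair_induce ?F U)} = {}" using nx by auto
      moreover have "d_out \<D> \<le> card {u. (x, u) \<in> parcs (pair_induce ?F U)}"
        by (rule card_ge_CR(1)[OF U(3)]) (use xU in simp)
      ultimately show False using out1 by (simp only: card.empty)
    qed
    then have sub: "U \<subseteq> \<phi> ` (pverts D - {v})" using U(1) by (auto simp: \<phi>_def)
    have "pair_induce H (\<phi> ` (pverts D - {v})) \<in> \<D>"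
      by (rule member_choice[OF D(1) H phi _ Dv[OF v]]) auto
    then have "pair_induce (pair_induce H (\<phi> ` (pverts D - {v}))) U \<in> \<D>"
      by (rule induce_member) (use sub in simp)
    moreover have "pair_induce (pair_induce H (\<phi> ` (pverts D - {v}))) U = pair_induce ?F U"
      using U(1) sub by (simp add: pair_induce_induce)
    ultimately show False using U(3) by (simp add: CR_def)
  qed
  then show "\<exists>T. transversal \<D> D X H T" using cc(4) by blast
qed

text \<open>Members are exactly the digraphs of number at most 1, so both kinds of criticality speak
  of the same proper parts; the upper bound 2 for members of \<open>CR \<D>\<close> is
  \<open>critical_2_colourable\<close>.\<close>

lemma CR_eq_dp_crit: "CR \<D> = dp_crit \<D> 2"
proof (intro set_eqI iffI)
  fix D assume CR: "D \<in> CR \<D>"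
  then have D: "pair_digraph D" "D \<notin> \<D>" and Dv: "\<And>v. v \<in> pverts D \<Longrightarrow> pair_induce D (pverts D - {v}) \<in> \<D>"
    by (auto simp: CR_def)
  have "1 < dp_chromatic \<D> D" by (rule less_dp_chromatic[OF D(1) non_member_not_colourable[OF D]])
  moreover have "dp_chromatic \<D> D \<le> 2" by (rule dp_chromatic_le[OF critical_2_colourable[OF CR]])
  ultimately have dp: "dp_chromatic \<D> D = 2" by simp
  have "dp_chromatic \<D> E < 2" if E: "induced_subgraph (with_proj E) (with_proj D)" "E \<noteq> D" for E
  proof -
    note E1 = conjunct1[OF iffD1[OF induced_pair_iff[OF D(1)] E(1)]]
    note E2 = conjunct2[OF iffD1[OF induced_pair_iff[OF D(1)] E(1)]]
    have "pverts E \<noteq> pverts D" using E2 E(2) pair_induce_self[OF D(1)] by metis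
    then obtain v where v: "v \<in> pverts D" "v \<notin> pverts E" using E1 by auto
    then have sub: "pverts E \<subseteq> pverts D - {v}" using E1 by auto
    have "pair_induce (pair_induce D (pverts D - {v})) (pverts E) \<in> \<D>"
      by (rule induce_member[OF Dv[OF v(1)]]) (use sub in simp)
    then have "pair_induce D (pverts E) \<in> \<D>" using pair_induce_induce[OF sub, of D] by simp
    then have "E \<in> \<D>" by (subst E2)
    then show ?thesis using dp_chromatic_le[OF member_colourable, of E] by simp
  qed
  then show "D \<in> dp_crit \<D> 2" using D dp by (auto simp: dp_crit_def)
next
  fix D assume "D \<in> dp_crit \<D> 2"
  then have D: "pair_digraph D" "dp_chromatic \<D> D = 2"
    and E: "\<And>E. induced_subgraph (with_proj E) (with_proj D) \<Longrightarrow> E \<noteq> D \<Longrightarrow> dp_chromatic \<D> E < 2"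
    by (auto simp: dp_crit_def)
  have "D \<notin> \<D>" using dp_chromatic_le[OF member_colourable, of D] D by auto
  moreover have "pair_induce D (pverts D - {v}) \<in> \<D>" if v: "v \<in> pverts D" for v
  proof (rule ccontr)
    let ?E = "pair_induce D (pverts D - {v})"
    assume nm: "?E \<notin> \<D>"
    have pE: "pair_digraph ?E" using pair_digraph_pair_induce[OF D(1)] by auto
    have "pverts ?E \<noteq> pverts D" using v by auto
    then have "?E \<noteq> D" by metis
    moreover have "induced_subgraph (with_proj ?E) (with_proj D)" using induced_pair_iff[OF D(1)] by auto
    ultimately have "dp_chromatic \<D> ?E < 2" by (intro E)
    then show False using less_dp_chromatic[OF pE non_member_not_colourable[OF pE nm]] by simp
  qed
  ultimately show "D \<in> CR \<D>" using D by (simp add: CR_def)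
qed

end

section \<open>Recognising the exceptional digraphs\<close>

lemma bidirected_complete_iso:
  assumes D: "pair_digraph D" and n: "card (pverts D) = n"
    and all: "\<forall>u\<in>pverts D. \<forall>w\<in>pverts D. u \<noteq> w \<longrightarrow> (u, w) \<in> parcs D"
  shows "digraph_iso (with_proj D) (with_proj (bidirected_complete n))"
proof -
  have "\<exists>h. bij_betw h {..<n} (pverts D)"
    by (rule finite_same_card_bij) (use D n in \<open>auto simp: pair_digraph_iff\<close>)
  then obtain h where h: "bij_betw h {..<n} (pverts D)" by blast
  have arcs: "(i, j) \<in> parcs (bidirected_complete n) \<longleftrightarrow> i < n \<and> j < n \<and> i \<noteq> j" for i j
    by (auto simp: bidirected_complete_def bidirected_def doubleton_eq_iff)
  have verts: "pverts (bidirected_complete n) = {..<n}"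
    by (simp add: bidirected_complete_def bidirected_def)
  show ?thesis
  proof (rule digraph_iso_bij[OF D])
    show "bij_betw h (pverts (bidirected_complete n)) (pverts D)" using h verts by simp
    show "parcs (bidirected_complete n) \<subseteq> pverts (bidirected_complete n) \<times> pverts (bidirected_complete n)"
      using arcs verts by auto
    fix i j assume "i \<in> pverts (bidirected_complete n)" "j \<in> pverts (bidirected_complete n)"
    then have ij: "i < n" "j < n" using verts by auto
    then have "h i \<in> pverts D" "h j \<in> pverts D" "h i = h j \<longleftrightarrow> i = j"
      using h by (auto simp: bij_betw_def inj_on_def)
    then show "(i, j) \<in> parcs (bidirected_complete n) \<longleftrightarrow> (h i, h j) \<in> parcs D"
      using arcs ij all D by (auto simp: pair_digraph_iff)
  qed
qed

text \<open>Out-degree 2 excludes chords: predecessor and successor on the cycle, distinct since it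
  has at least 3 vertices, are all out-neighbours.\<close>

lemma bidirected_cycle_iso:
  assumes D: "pair_digraph D" and cs: "distinct cs" "set cs = pverts D" "3 \<le> length cs"
    and suc: "successively (\<lambda>u w. (u, w) \<in> parcs D \<and> (w, u) \<in> parcs D) cs"
    and wrap: "(last cs, hd cs) \<in> parcs D" "(hd cs, last cs) \<in> parcs D"
    and deg: "\<And>v. v \<in> pverts D \<Longrightarrow> card {u. (v, u) \<in> parcs D} = 2"
  shows "digraph_iso (with_proj D) (with_proj (bidirected_cycle (length cs)))"
proof -
  let ?n = "length cs" and ?s = "\<lambda>i. (i + 1) mod length cs"
  have n0: "0 < ?n" using cs(3) by linarith
  have dig: "(cs ! i, cs ! ?s i) \<in> parcs D \<and> (cs ! ?s i, cs ! i) \<in> parcs D" if i: "i < ?n" for i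
  proof (cases "Suc i = ?n")
    case True
    have ne: "cs \<noteq> []" using n0 by simp
    have "i = ?n - 1" "?s i = 0" using True by auto
    then have "cs ! i = last cs" "cs ! ?s i = hd cs"
      using last_conv_nth[OF ne] hd_conv_nth[OF ne] by simp_all
    then show ?thesis using wrap by simp
  next
    case False
    then have "Suc i < ?n" using i by simp
    then show ?thesis using successively_nth[OF suc, of i] by simp
  qed
  have arcs: "(cs ! i, cs ! j) \<in> parcs D \<longleftrightarrow> j = ?s i \<or> i = ?s j" if ij: "i < ?n" "j < ?n" for i j
  proof
    assume a: "(cs ! i, cs ! j) \<in> parcs D"
    define b where "b = (if i = 0 then ?n - 1 else i - 1)"
    have b: "b < ?n" "?s b = i" using n0 ij by (auto simp: b_def)
    have "b \<noteq> ?s i" using cs(3) ij by (cases "Suc i = ?n") (auto simp: b_def)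
    then have ne: "cs ! b \<noteq> cs ! ?s i" using b n0 cs(1) by (simp add: nth_eq_iff_index_eq)
    have iD: "cs ! i \<in> pverts D" using ij cs(2) nth_mem by blast
    have "{cs ! b, cs ! ?s i} \<subseteq> {u. (cs ! i, u) \<in> parcs D}"
      using dig[OF ij(1)] dig[OF b(1)] b(2) by auto
    moreover have "finite {u. (cs ! i, u) \<in> parcs D}" using deg[OF iD] card.infinite by fastforce
    ultimately have "{cs ! b, cs ! ?s i} = {u. (cs ! i, u) \<in> parcs D}"
      using deg[OF iD] ne by (intro card_subset_eq) auto
    then have "cs ! j = cs ! b \<or> cs ! j = cs ! ?s i" using a by auto
    then have "j = b \<or> j = ?s i" using b(1) ij n0 cs(1) by (simp add: nth_eq_iff_index_eq)
    then show "j = ?s i \<or> i = ?s j" using b(2) by auto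
  next
    assume "j = ?s i \<or> i = ?s j"
    then show "(cs ! i, cs ! j) \<in> parcs D" using dig[OF ij(1)] dig[OF ij(2)] by auto
  qed
  have barcs: "(i, j) \<in> parcs (bidirected_cycle ?n) \<longleftrightarrow> i < ?n \<and> j < ?n \<and> (j = ?s i \<or> i = ?s j)" for i j
    using n0 by (auto simp: bidirected_cycle_def bidirected_def doubleton_eq_iff)
  have verts: "pverts (bidirected_cycle ?n) = {..<?n}"
    by (simp add: bidirected_cycle_def bidirected_def)
  show ?thesis
  proof (rule digraph_iso_bij[OF D, of "\<lambda>i. cs ! i"])
    show "bij_betw ((!) cs) (pverts (bidirected_cycle ?n)) (pverts D)"
      using bij_betw_nth[OF cs(1) verts] cs(2) by simp
    show "parcs (bidirected_cycle ?n) \<subseteq> pverts (bidirected_cycle ?n) \<times> pverts (bidirected_cycle ?n)"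
      using barcs verts by auto
    fix i j assume "i \<in> pverts (bidirected_cycle ?n)" "j \<in> pverts (bidirected_cycle ?n)"
    then show "(i, j) \<in> parcs (bidirected_cycle ?n) \<longleftrightarrow> (cs ! i, cs ! j) \<in> parcs D"
      using barcs arcs verts by auto
  qed
qed

theorem theorem12:
  fixes \<D> :: "'a::infinite pair_pre_digraph set"
    and D :: "'a pair_pre_digraph"
  assumes "strongly_reliable \<D>"
    and "d_out \<D> \<ge> 1" and "d_in \<D> \<ge> 1"
    and "pair_digraph D" and "Digraph_Component.connected (with_proj D)"
  shows "int (dp_chromatic \<D> D)
           \<le> max \<lceil>real (max_out_degree D) / real (d_out \<D>)\<rceil>
                 \<lceil>real (max_in_degree D) / real (d_in \<D>)\<rceil>
       \<or> is_K1 D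
       \<or> (\<exists>r\<ge>1. d_out \<D> = r \<and> d_in \<D> = r \<and>
            ((D \<in> CR \<D> \<and> CR \<D> = dp_crit \<D> 2 \<and> diregular r D)
           \<or> (\<exists>k\<ge>1.
                 digraph_iso (with_proj D) (with_proj (bidirected_complete (k * r + 1)))
                 \<and> D \<in> dp_crit \<D> (k + 1))
           \<or> (r = 1 \<and> (\<exists>n\<ge>3.
                 digraph_iso (with_proj D) (with_proj (bidirected_cycle n))
                 \<and> D \<in> dp_crit \<D> 3))))"
proof (rule ccontr)
  assume contra: "\<not> ?thesis"
  note D = assms(4) and rel = assms(1-3)
  let ?V = "pverts D" and ?A = "parcs D" and ?p = "d_out \<D>" and ?q = "d_in \<D>"
  define m where "m = max \<lceil>real (max_out_degree D) / real ?p\<rceil> \<lceil>real (max_in_degree D) / real ?q\<rceil>"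
  have Vne: "?V \<noteq> {}" and conn: "linked (\<lambda>u v. (u, v) \<in> ?A \<or> (v, u) \<in> ?A) ?V"
    using connected_linked[OF assms(5)] by auto
  have finV: "finite ?V" and AV: "?A \<subseteq> ?V \<times> ?V" and irr: "\<And>v. (v, v) \<notin> ?A"
    using D by (auto simp: pair_digraph_iff)
  have notK1: "\<not> is_K1 D" and big: "m < int (dp_chromatic \<D> D)"
    using contra unfolding m_def by auto
  have fins: "finite {u. (v, u) \<in> ?A}" "finite {u. (u, v) \<in> ?A}" for v
    using finV AV by (auto intro: finite_subset[of _ ?V])
  \<comment> \<open>This is where \<open>K1\<close> is excluded: an arc makes the bound
    \<open>m\<close> positive, so at least one colour is available.\<close>
  have "?A \<noteq> {}"
  proof
    assume A0: "?A = {}"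
    obtain v where v: "v \<in> ?V" using Vne by auto
    have "{v} = ?V"
    proof (rule ccontr)
      assume ne: "{v} \<noteq> ?V"
      show False by (rule linkedD[OF conn _ _ ne]) (use v A0 in auto)
    qed
    then have "D = \<lparr>pverts = {v}, parcs = {}\<rparr>" using A0 by (intro pair_pre_digraph.equality) auto
    then show False using notK1 by (auto simp: is_K1_def)
  qed
  then obtain a b where ab: "(a, b) \<in> ?A" by auto
  then have aV: "a \<in> ?V" using AV by auto
  have "card {u. (a, u) \<in> ?A} \<noteq> 0" using ab fins by auto
  then have mo: "1 \<le> max_out_degree D" using card_le_max_degree(1)[OF D aV] by simp
  have le_m: "real (max_out_degree D) / real ?p \<le> m" "real (max_in_degree D) / real ?q \<le> m"
    unfolding m_def by (metis le_of_int_ceiling max.cobounded1 max.cobounded2 of_int_le_iff order_trans)+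
  have "0 < real (max_out_degree D) / real ?p" using mo rel by simp
  then have m1: "1 \<le> m" using le_m(1) by linarith
  define k where "k = nat m"
  have km: "int k = m" "1 \<le> k" using m1 by (auto simp: k_def)
  have rk: "real_of_int m = real k" using km by (metis of_int_of_nat_eq)
  have "real (max_out_degree D) \<le> real k * real ?p" "real (max_in_degree D) \<le> real k * real ?q"
    using le_m rel unfolding rk by (simp_all add: pos_divide_le_eq)
  then have deg: "max_out_degree D \<le> k * ?p" "max_in_degree D \<le> k * ?q"
    by (simp_all flip: of_nat_mult)
  have od: "card {u \<in> ?V. (v, u) \<in> ?A} \<le> k * ?p" "card {u \<in> ?V. (u, v) \<in> ?A} \<le> k * ?q" if v: "v \<in> ?V" for v
  proof -
    have "{u \<in> ?V. (v, u) \<in> ?A} = {u. (v, u) \<in> ?A}" "{u \<in> ?V. (u, v) \<in> ?A} = {u. (u, v) \<in> ?A}"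
      using AV by auto
    then show "card {u \<in> ?V. (v, u) \<in> ?A} \<le> k * ?p" "card {u \<in> ?V. (u, v) \<in> ?A} \<le> k * ?q"
      using card_le_max_degree[OF D v] deg by auto
  qed
  have ncol: "\<not> dp_colourable \<D> D k"
    using dp_chromatic_le[of \<D> D k] big km by auto
  then obtain X H where H: "k_cover k D X H" and noT: "\<not> (\<exists>T. transversal \<D> D X H T)"
    unfolding dp_colourable_def by blast
  interpret cc: colour_cover ?V ?A X "parcs H" k ?p ?q by (rule k_cover_colour_cover[OF D H])
  have nogood: "\<not> cc.good \<phi> ?V" for \<phi>
    using good_transversal[OF rel D H, of \<phi>] noT by auto
  interpret hc: hard_cover ?V ?A X "parcs H" k ?p ?q
    by unfold_locales (use Vne rel km(2) od conn nogood in auto)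
  \<comment> \<open>By connectedness a proper part has a vertex with a neighbour outside, so one of
    its degrees falls below the bound. This makes proper induced subdigraphs colourable with
    \<open>k\<close> colours, hence \<open>D\<close> critical.\<close>
  have slack: "\<exists>v\<in>U. card {u \<in> U. (v, u) \<in> ?A} < k * ?p \<or> card {u \<in> U. (u, v) \<in> ?A} < k * ?q"
    if U: "U \<subseteq> ?V" "U \<noteq> {}" "U \<noteq> ?V" for U
  proof -
    obtain u w where uw: "u \<in> U" "w \<in> ?V" "w \<notin> U" "(u, w) \<in> ?A \<or> (w, u) \<in> ?A"
      by (rule linkedD[OF conn U])
    have uV: "u \<in> ?V" using uw U by auto
    have "card {x \<in> U. (u, x) \<in> ?A} < card {x \<in> ?V. (u, x) \<in> ?A}" if "(u, w) \<in> ?A"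
      by (rule psubset_card_mono) (use that uw U finV in auto)
    moreover have "card {x \<in> U. (x, u) \<in> ?A} < card {x \<in> ?V. (x, u) \<in> ?A}" if "(w, u) \<in> ?A"
      by (rule psubset_card_mono) (use that uw U finV in auto)
    ultimately show ?thesis using od[OF uV] uw(1,4) by (intro bexI[of _ u]) auto
  qed
  have subcol: "dp_colourable \<D> E k" if E: "induced_subgraph (with_proj E) (with_proj D)" "E \<noteq> D" for E
  proof -
    note E1 = conjunct1[OF iffD1[OF induced_pair_iff[OF D] E(1)]]
    note E2 = conjunct2[OF iffD1[OF induced_pair_iff[OF D] E(1)]]
    have neV: "pverts E \<noteq> ?V" using E2 E(2) pair_induce_self[OF D] by metis
    have pE: "pair_digraph E" by (subst E2) (rule pair_digraph_pair_induce[OF D E1])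
    show ?thesis
    proof (rule degenerate_colourable[OF rel pE])
      fix U assume U: "U \<subseteq> pverts E" "U \<noteq> {}"
      have "(x, y) \<in> parcs E \<longleftrightarrow> (x, y) \<in> ?A" if "x \<in> U" "y \<in> U" for x y
        using that U parcs_pair_induce[of x y D "pverts E"] arg_cong[OF E2, of parcs] by auto
      then have "{u \<in> U. (v, u) \<in> parcs E} = {u \<in> U. (v, u) \<in> ?A}"
        "{u \<in> U. (u, v) \<in> parcs E} = {u \<in> U. (u, v) \<in> ?A}" if "v \<in> U" for v
        using that by auto
      then show "\<exists>v\<in>U. card {u \<in> U. (v, u) \<in> parcs E} < k * ?p \<or> card {u \<in> U. (u, v) \<in> parcs E} < k * ?q"
        using slack[of U] U E1 neV by auto
    qed
  qed
  have pq: "?p = ?q" by (rule hc.p_eq_q)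
  \<comment> \<open>One further colour lifts the bound above every degree, so the number of
    \<open>D\<close> is exactly \<open>k + 1\<close>.\<close>
  have "dp_colourable \<D> D (k + 1)"
  proof (rule degenerate_colourable[OF rel D])
    fix U assume U: "U \<subseteq> ?V" "U \<noteq> {}"
    then obtain v where v: "v \<in> U" by auto
    have "card {u \<in> U. (v, u) \<in> ?A} \<le> card {u \<in> ?V. (v, u) \<in> ?A}"
      using U finV by (intro card_mono) auto
    also have "\<dots> \<le> k * ?p" using od v U by auto
    also have "\<dots> < (k + 1) * ?p" using rel(2) by simp
    finally show "\<exists>v\<in>U. card {u \<in> U. (v, u) \<in> ?A} < (k + 1) * ?p \<or> card {u \<in> U. (u, v) \<in> ?A} < (k + 1) * ?q"
      using v by auto
  qed
  then have "dp_chromatic \<D> D \<le> k + 1" by (rule dp_chromatic_le)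
  then have dpD: "dp_chromatic \<D> D = k + 1"
    using less_dp_chromatic[OF rel D ncol] by simp
  have crit: "D \<in> dp_crit \<D> (k + 1)"
    unfolding dp_crit_def using D dpD subcol dp_chromatic_le[of \<D> _ k] by (auto simp: less_Suc_eq_le)
  have reg: "card {u. (v, u) \<in> ?A} = k * ?p" "card {u. (u, v) \<in> ?A} = k * ?q" if v: "v \<in> ?V" for v
  proof -
    have "{u \<in> ?V. (v, u) \<in> ?A} = {u. (v, u) \<in> ?A}" "{u \<in> ?V. (u, v) \<in> ?A} = {u. (u, v) \<in> ?A}"
      using AV by auto
    then show "card {u. (v, u) \<in> ?A} = k * ?p" "card {u. (u, v) \<in> ?A} = k * ?q"
      using hc.regular[OF v] by auto
  qed
  show False
  proof (cases "k = 1")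
    case True
    have "D \<in> CR \<D>" using crit True CR_eq_dp_crit[OF rel] by (simp add: numeral_2_eq_2)
    moreover have "diregular ?p D"
      unfolding diregular_def out_degree_card in_degree_card using reg True pq by auto
    ultimately show False
      using contra rel(2) pq CR_eq_dp_crit[OF rel] by metis
  next
    case False
    then have k2: "2 \<le> k" using km(2) by simp
    interpret rh: regular_hard_cover ?V ?A X "parcs H" k ?p
    proof -
      have "hard_cover ?V ?A X (parcs H) k ?p ?p" using hc.hard_cover_axioms pq by simp
      then show "regular_hard_cover ?V ?A X (parcs H) k ?p"
        using k2 by (simp add: regular_hard_cover_def regular_hard_cover_axioms_def)
    qed
    consider (complete) "card ?V = k * ?p + 1" "\<forall>u\<in>?V. \<forall>w\<in>?V. u \<noteq> w \<longrightarrow> (u, w) \<in> ?A"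
      | (cycle) cs where "?p = 1" "k = 2" "distinct cs" "set cs = ?V" "3 \<le> length cs"
        "successively (\<lambda>u w. (u, w) \<in> ?A \<and> (w, u) \<in> ?A) cs" "(last cs, hd cs) \<in> ?A" "(hd cs, last cs) \<in> ?A"
      using rh.complete_or_cycle by blast
    then show False
    proof cases
      case complete
      have "digraph_iso (with_proj D) (with_proj (bidirected_complete (k * ?p + 1)))"
        by (rule bidirected_complete_iso[OF D complete])
      then show False using contra crit km(2) rel(2) pq by metis
    next
      case cycle
      have "digraph_iso (with_proj D) (with_proj (bidirected_cycle (length cs)))"
        by (rule bidirected_cycle_iso[OF D cycle(3-8)]) (use reg(1) cycle(1,2) in simp)
      moreover have "D \<in> dp_crit \<D> 3" using crit cycle(2) by (simp add: numeral_3_eq_3)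
      ultimately show False using contra cycle(1,5) pq by (metis order_refl)
    qed
  qed
qed

end
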